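(* Let $\mu,\sigma\in\mathscr P_2(\mathbb R^d)$. Then $$\partial_C\, d_{\mathcal W}^2(\cdot,\sigma)(\mu)=\overline{\operatorname{conv}\big(\{2\,\mathrm{id}-2\mathcal B[\gamma]:\gamma\in\Gamma_o(\mu,\sigma)\}\big)}^{L^2_\mu}.$$
   Context: $\mathscr P_2(\mathbb R^d)$ is the space of Borel probability measures on $\mathbb R^d$ with finite second moment, with 2-Wasserstein distance $d_{\mathcal W}$; $\Gamma_o(\mu,\sigma)$ is the set of optimal transport plans between $\mu$ and $\sigma$ for the cost $|x-y|^2$. $L^2_\mu$ is the space of $\mu$-square-integrable maps $\mathbb R^d\to\mathbb R^d$ with inner product $\langle\cdot,\cdot\rangle_\mu$. Barycentric projection: for $\gamma\in\mathscr P_2(\mathbb R^{2d})$ with first marginal $\mu$ and disintegration $\gamma(dx,dy)=\mu(dx)\gamma_x(dy)$, $\mathcal B[\gamma](x):=\int y\,d\gamma_x(y)$, so $\mathcal B[\gamma]\in L^2_\mu$. Clarke subdifferential: let $C_1(\mathbb R^d;\mathbb R^d)$ be the set of continuous maps $w$ with $\sup_x|w(x)|/(1+|x|)<\infty$. For $\mathcal G:\mathscr P_2(\mathbb R^d)\to\mathbb R$ locally Lipschitz around $\mu$ and $w\in C_1(\mathbb R^d;\mathbb R^d)$, set $$D\mathcal G(\mu)(w):=\limsup_{\nu\to\mu,\ t\searrow0}\frac{\mathcal G((\mathrm{id}+tw)_\#\nu)-\mathcal G(\nu)}{t},$$ where $\nu\to\mu$ in $d_{\mathcal W}$, and $\partial_C\mathcal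 G(\mu):=\{\Xi\in L^2_\mu:\ \langle\Xi,w\rangle_\mu\le D\mathcal G(\mu)(w)\ \ \forall w\in C_1(\mathbb R^d;\mathbb R^d)\}$. Here $\mathcal G=d_{\mathcal W}^2(\cdot,\sigma)$. *)

theory Defs
  imports "HOL-Probability.Probability"
begin

section \<open>The Wasserstein space\<close>

definition P2 :: "'a::euclidean_space measure set" where
  "P2 = {\<mu>. prob_space \<mu> \<and> sets \<mu> = sets borel \<and> integrable \<mu> (\<lambda>x. (norm x)\<^sup>2)}"

definition transport_plans ::
  "'a::euclidean_space measure \<Rightarrow> 'a measure \<Rightarrow> ('a \<times> 'a) measure set" where
  "transport_plans \<mu> \<sigma> =
     {\<gamma>. prob_space \<gamma> \<and> sets \<gamma> = sets borel \<and> distr \<gamma> borel fst = \<mu> \<and> distr \<gamma> borel snd = \<sigma>}"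

text \<open>For marginals in \<^const>\<open>P2\<close> the cost is integrable against every plan, so that the Bochner
  integral below is never a junk value, and the infimum is over a nonempty set of nonnegative
  reals.\<close>

definition transport_cost :: "('a::euclidean_space \<times> 'a) measure \<Rightarrow> real" where
  "transport_cost \<gamma> = (\<integral>z. (norm (fst z - snd z))\<^sup>2 \<partial>\<gamma>)"

definition W2 :: "'a::euclidean_space measure \<Rightarrow> 'a measure \<Rightarrow> real" where
  "W2 \<mu> \<sigma> = sqrt (INF \<gamma>\<in>transport_plans \<mu> \<sigma>. transport_cost \<gamma>)"

definition optimal_plans ::
  "'a::euclidean_space measure \<Rightarrow> 'a measure \<Rightarrow> ('a \<times> 'a) measure set" where
  "optimal_plans \<mu> \<sigma> =
     {\<gamma> \<in> transport_plans \<mu> \<sigma>. \<forall>\<gamma>'\<in>transport_plans \<mu> \<sigma>. transport_cost \<gamma> \<le> transport_cost \<gamma>'}"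

section \<open>The space of square-integrable maps\<close>

text \<open>Elements of the Hilbert space are represented by functions, not by classes modulo
  almost-everywhere equality. The sets \<open>clarke_subdifferential G \<mu>\<close> and \<open>L2_closure \<mu> S\<close>
  below are invariant under modification of their members on \<open>\<mu>\<close>-null sets (within
  Borel functions), so that equality of such sets of functions is the same as equality of the
  corresponding sets of classes.\<close>

definition L2 :: "'a::euclidean_space measure \<Rightarrow> ('a \<Rightarrow> 'a) set" where
  "L2 \<mu> = {f \<in> borel_measurable \<mu>. integrable \<mu> (\<lambda>x. (norm (f x))\<^sup>2)}"

definition L2_inner ::
  "'a::euclidean_space measure \<Rightarrow> ('a \<Rightarrow> 'a) \<Rightarrow> ('a \<Rightarrow> 'a) \<Rightarrow> real" where
  "L2_inner \<mu> f g = (\<integral>x. f x \<bullet> g x \<partial>\<mu>)"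

definition L2_norm :: "'a::euclidean_space measure \<Rightarrow> ('a \<Rightarrow> 'a) \<Rightarrow> real" where
  "L2_norm \<mu> f = sqrt (L2_inner \<mu> f f)"

text \<open>The intersection with \<open>L2 \<mu>\<close> keeps \<open>L2_norm\<close> away from functions on which the integral
  takes a junk value; it does nothing for subsets of \<open>L2 \<mu>\<close>.\<close>

definition L2_closure :: "'a::euclidean_space measure \<Rightarrow> ('a \<Rightarrow> 'a) set \<Rightarrow> ('a \<Rightarrow> 'a) set" where
  "L2_closure \<mu> S = {f \<in> L2 \<mu>. \<forall>\<epsilon>>0. \<exists>g \<in> S \<inter> L2 \<mu>. L2_norm \<mu> (\<lambda>x. f x - g x) < \<epsilon>}"

text \<open>Functions are not an instance of \<^class>\<open>real_vector\<close>, so \<open>convex hull\<close> is not available for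
  them; this is the set of finite convex combinations.\<close>

definition fun_convex_hull :: "('a \<Rightarrow> 'b::real_vector) set \<Rightarrow> ('a \<Rightarrow> 'b) set" where
  "fun_convex_hull S =
     {(\<lambda>x. \<Sum>f\<in>F. c f *\<^sub>R f x) | F c. finite F \<and> F \<subseteq> S \<and> (\<forall>f\<in>F. 0 \<le> c f) \<and> sum c F = 1}"

section \<open>Barycentric projection\<close>

definition is_disintegration ::
  "('a::euclidean_space \<times> 'a) measure \<Rightarrow> ('a \<Rightarrow> 'a measure) \<Rightarrow> bool" where
  "is_disintegration \<gamma> k \<longleftrightarrow>
     k \<in> borel \<rightarrow>\<^sub>M prob_algebra borel \<and>
     (\<forall>A\<in>sets borel. emeasure \<gamma> A = (\<integral>\<^sup>+x. emeasure (k x) {y. (x, y) \<in> A} \<partial>(distr \<gamma> borel fst)))"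

text \<open>Disintegrations of probability measures on the product exist, and any two agree almost
  everywhere with respect to the first marginal; so \<open>barycentric_projection \<gamma>\<close> depends on the
  choice only up to a null set.\<close>

definition disintegration ::
  "('a::euclidean_space \<times> 'a) measure \<Rightarrow> 'a \<Rightarrow> 'a measure" where
  "disintegration \<gamma> = (SOME k. is_disintegration \<gamma> k)"

definition barycentric_projection ::
  "('a::euclidean_space \<times> 'a) measure \<Rightarrow> 'a \<Rightarrow> 'a" where
  "barycentric_projection \<gamma> x = (\<integral>y. y \<partial>(disintegration \<gamma> x))"

section \<open>The Clarke subdifferential\<close>

definition C1_maps :: "('a::euclidean_space \<Rightarrow> 'a) set" where
  "C1_maps = {w. continuous_on UNIV w \<and> bdd_above (range (\<lambda>x. norm (w x) / (1 + norm x)))}"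

text \<open>The filter of Wasserstein neighbourhoods of \<open>\<mu>\<close>. It is not punctured: the base points
  \<open>\<nu>\<close> in the Clarke derivative may equal \<open>\<mu>\<close>.\<close>

definition W2_nhds :: "'a::euclidean_space measure \<Rightarrow> 'a measure filter" where
  "W2_nhds \<mu> = (INF \<epsilon>\<in>{0<..}. principal {\<nu> \<in> P2. W2 \<nu> \<mu> < \<epsilon>})"

definition clarke_derivative ::
  "('a::euclidean_space measure \<Rightarrow> real) \<Rightarrow> 'a measure \<Rightarrow> ('a \<Rightarrow> 'a) \<Rightarrow> ereal" where
  "clarke_derivative G \<mu> w =
     Limsup (W2_nhds \<mu> \<times>\<^sub>F at_right 0)
       (\<lambda>(\<nu>, t). ereal ((G (distr \<nu> borel (\<lambda>x. x + t *\<^sub>R w x)) - G \<nu>) / t))"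

definition clarke_subdifferential ::
  "('a::euclidean_space measure \<Rightarrow> real) \<Rightarrow> 'a measure \<Rightarrow> ('a \<Rightarrow> 'a) set" where
  "clarke_subdifferential G \<mu> =
     {\<Xi> \<in> L2 \<mu>. \<forall>w\<in>C1_maps. ereal (L2_inner \<mu> \<Xi> w) \<le> clarke_derivative G \<mu> w}"

end

theory Submission
  imports Defs
begin

text \<open>
  The Clarke derivative in direction \<open>w\<close> is the support function of the set \<open>S\<close> of maps
  \<open>2 id - 2 B[\<gamma>]\<close>, where \<open>\<gamma>\<close> is an optimal plan. For the upper bound, an optimal plan
  for \<open>\<nu>\<close> is a competitor for \<open>(id + t w)\<^sub>#\<nu>\<close>, and gluing it with a nearly optimal plan between
  \<open>\<nu>\<close> and \<open>\<mu>\<close> gives a nearly optimal plan for \<open>\<mu>\<close>; these accumulate at optimal plans.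
  For the lower bound take \<open>\<nu> = (id - t w)\<^sub>#\<mu>\<close>, since \<open>(id + t w)\<^sub>#\<nu>\<close> is then within
  \<open>o(t)\<close> of \<open>\<mu>\<close>. As \<open>C_1\<close> is dense, separation of convex sets in \<open>L\<^sup>2\<close> concludes.

  Compactness of the plans with given marginals does not go through tightness: the values
  \<open>\<gamma>(A \<times> B)\<close> lie in a cube, where Tychonoff applies, and a limit of such bimeasures is again
  a plan, because it is dominated by its marginals. The same argument gives disintegrations.
  Since \<open>\<integral>|x - y|\<^sup>2 d\<gamma>\<close> depends on \<open>\<gamma>\<close> only through \<open>\<integral>x \<bullet> y d\<gamma>\<close>, the cost is
  continuous for this convergence.
\<close>

section \<open>Encoding Euclidean spaces into the real line\<close>

text \<open>For a fixed plan the cost is a quadratic polynomial in the time t of a displacement of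
  its first marginal, so along displacements the squared distance is bounded above by smooth
  functions, and upper bounds by competitors are cheap. A forward step from \<mu> would detect only
  the plan with the least displacement pairing, so the lower bound has to move the base point. Since
  w is merely continuous, id - t w need not be invertible; returning by id + t w leaves the error t
  (w o (id - t w) - w). It is o(t) in L2 because composition with w is continuous at \<mu> under
  linear growth alone. The same continuity, uniform over couplings with \<mu>, carries plans from
  nearby base points \<nu> to \<mu>. All limits are then taken among plans with the fixed marginals
  \<mu> and \<sigma>: there simple functions approximate uniformly in the plan, which makes bilinear
  integrals continuous even for unbounded integrands. In the separation step S is bounded in L2, so
  a strict gap in an L2 direction survives its replacement by a nearby bounded continuous one,
  uniformly over all optimal plans.\<close>

lemma ternary_digit:
  fixes d :: "nat \<Rightarrow> bool"
  defines "r \<equiv> (\<Sum>i. of_bool (d i) * (1/3::real) ^ i)"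
  shows "\<lfloor>3 ^ j * r\<rfloor> mod 3 = (1::int) \<longleftrightarrow> d j"
proof -
  define f where "f i = of_bool (d i) * (1/3::real) ^ i" for i
  have f_le: "f i \<le> (1/3) ^ i" and f_nonneg: "0 \<le> f i" for i
    by (auto simp: f_def)
  have geo: "summable (\<lambda>i. (1/3::real) ^ i)"
    by (rule summable_geometric) simp
  have sf: "summable f"
    by (rule summable_comparison_test'[OF geo]) (use f_le f_nonneg in auto)
  define T where "T = (\<Sum>i. f (i + Suc j))"
  have sT: "summable (\<lambda>i. f (i + Suc j))"
    using sf by (rule summable_ignore_initial_segment)
  have r: "r = T + (\<Sum>i<Suc j. f i)"
    unfolding r_def T_def f_def[symmetric] by (rule suminf_split_initial_segment[OF sf])
  have T0: "0 \<le> T"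
    unfolding T_def by (rule suminf_nonneg[OF sT]) (rule f_nonneg)
  \<comment> \<open>Base 3 makes the scaled tail at most 1/2, so the floor does not see it; in base
    2 the tail could reach 1 and the expansion would be ambiguous.\<close>
  have "T \<le> (\<Sum>i. (1/3) ^ Suc j * (1/3::real) ^ i)"
    unfolding T_def
  proof (rule suminf_le[OF _ sT])
    show "f (i + Suc j) \<le> (1/3) ^ Suc j * (1/3) ^ i" for i
      using f_le[of "i + Suc j"] by (simp add: power_add mult_ac)
    show "summable (\<lambda>i. (1/3) ^ Suc j * (1/3::real) ^ i)"
      using geo by (rule summable_mult)
  qed
  also have "\<dots> = (1/3) ^ Suc j * (3/2)"
    by (subst suminf_mult[OF geo]) (simp add: suminf_geometric)
  finally have T1: "3 ^ j * T \<le> 1/2"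
    by (simp add: field_simps)
  define I :: int where "I = (\<Sum>i<j. of_bool (d i) * 3 ^ (j - i))"
  have "3 ^ j * (\<Sum>i<j. f i) = of_int I"
    unfolding I_def sum_distrib_left of_int_sum
  proof (rule sum.cong[OF refl])
    fix i assume "i \<in> {..<j}"
    then have "(3::real) ^ j = 3 ^ (j - i) * 3 ^ i"
      by (simp flip: power_add)
    then show "3 ^ j * f i = real_of_int (of_bool (d i) * 3 ^ (j - i))"
      by (auto simp: f_def power_one_over field_simps)
  qed
  then have "3 ^ j * r = 3 ^ j * T + of_int (I + of_bool (d j))"
    by (simp add: r algebra_simps) (simp add: f_def power_one_over)
  then have "\<lfloor>3 ^ j * r\<rfloor> = I + of_bool (d j)"
    using T0 T1 by (intro floor_unique) auto
  moreover have "3 dvd I"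
    unfolding I_def by (rule dvd_sum) auto
  ultimately show ?thesis
    by (auto simp: mod_add_left_eq dvd_eq_mod_eq_0 elim!: dvdE)
qed

text \<open>This Borel code with a Borel left inverse reduces kernels on Euclidean space to
  distribution functions on the line. A point is determined by the indices \<open>N n x\<close> of
  approximants within 1/(n+1) in a countable dense set; the graph of n -> \<open>N n x\<close> is
  written as 0-1 digits, from which \<psi> reads the indices back and takes the limit. Off the range
  of \<phi> the values of \<open>LEAST\<close> and \<open>lim\<close> are arbitrary, but \<psi> is
  still Borel.\<close>

lemma exists_real_code:
  "\<exists>(\<phi> :: 'a::euclidean_space \<Rightarrow> real) \<psi>.
     \<phi> \<in> borel_measurable borel \<and> \<psi> \<in> borel_measurable borel \<and> (\<forall>x. \<psi> (\<phi> x) = x)"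
proof -
  obtain D :: "'a set" where D: "countable D" "\<And>X. open X \<Longrightarrow> X \<noteq> {} \<Longrightarrow> \<exists>d\<in>D. d \<in> X"
    using countable_dense_setE by blast
  have "D \<noteq> {}" using D(2)[of UNIV] by auto
  define q where "q = from_nat_into D"
  have q: "\<exists>k. dist x (q k) < 1 / real (Suc n)" for x n
  proof -
    obtain d where "d \<in> D" "d \<in> ball x (1 / real (Suc n))"
      using D(2)[of "ball x (1 / real (Suc n))"] by auto
    then show ?thesis
      using from_nat_into_surj[OF D(1), of d] by (auto simp: q_def)
  qed
  define N where "N n x = (LEAST k. dist x (q k) < 1 / real (Suc n))" for n x
  have N: "dist x (q (N n x)) < 1 / real (Suc n)" for n x
    unfolding N_def by (rule LeastI_ex) (rule q)
  define d where "d x j = (snd (prod_decode j) = N (fst (prod_decode j)) x)" for x j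
  define \<phi> where "\<phi> x = (\<Sum>i. of_bool (d x i) * (1/3::real) ^ i)" for x
  define \<psi> :: "real \<Rightarrow> 'a" where
    "\<psi> r = lim (\<lambda>n. q (LEAST k. \<lfloor>3 ^ prod_encode (n, k) * r\<rfloor> mod 3 = (1::int)))" for r
  have N_meas: "N n \<in> measurable borel (count_space UNIV)" for n
    unfolding N_def by measurable
  have "\<phi> \<in> borel_measurable borel"
    unfolding \<phi>_def
  proof (rule borel_measurable_suminf)
    fix i
    have [measurable]: "N (fst (prod_decode i)) \<in> measurable borel (count_space UNIV)"
      by (rule N_meas)
    show "(\<lambda>x. of_bool (d x i) * (1 / 3::real) ^ i) \<in> borel_measurable borel"
      unfolding d_def by measurable
  qed
  moreover have "\<psi> \<in> borel_measurable borel"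
    unfolding \<psi>_def by measurable
  moreover have "\<psi> (\<phi> x) = x" for x
  proof -
    have "(LEAST k. \<lfloor>3 ^ prod_encode (n, k) * \<phi> x\<rfloor> mod 3 = (1::int)) = N n x" for n
      unfolding \<phi>_def ternary_digit by (simp add: d_def Least_equality)
    then have "\<psi> (\<phi> x) = lim (\<lambda>n. q (N n x))"
      by (simp add: \<psi>_def)
    also have "(\<lambda>n. q (N n x)) \<longlonglongrightarrow> x"
    proof (rule metric_LIMSEQ_I)
      fix e :: real assume "0 < e"
      then obtain n0 where "1 / real (Suc n0) < e"
        using nat_approx_posE by blast
      moreover have "1 / real (Suc n) \<le> 1 / real (Suc n0)" if "n0 \<le> n" for n
        using that by (simp add: frac_le)
      ultimately show "\<exists>no. \<forall>n\<ge>no. dist (q (N n x)) x < e"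
        using N[of x] by (metis dist_commute less_le_trans less_trans linorder_not_less)
    qed
    then have "lim (\<lambda>n. q (N n x)) = x"
      by (rule limI)
    finally show ?thesis .
  qed
  ultimately show ?thesis by blast
qed

section \<open>From bimeasures to kernels\<close>

text \<open>Tested on the bad set where g < f, the hypothesis makes the integral of the difference
  zero; finiteness of the integral of g permits the subtraction there.\<close>

lemma AE_le_if_set_nn_integral_le:
  fixes f g :: "'b \<Rightarrow> ennreal"
  assumes [measurable]: "f \<in> borel_measurable M" "g \<in> borel_measurable M"
    and le: "\<And>A. A \<in> sets M \<Longrightarrow> (\<integral>\<^sup>+x\<in>A. f x \<partial>M) \<le> (\<integral>\<^sup>+x\<in>A. g x \<partial>M)"
    and fin: "(\<integral>\<^sup>+x. g x \<partial>M) < \<infinity>"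
  shows "AE x in M. f x \<le> g x"
proof -
  define A where "A = {x \<in> space M. g x < f x}"
  have A[measurable]: "A \<in> sets M" unfolding A_def by measurable
  have finA: "(\<integral>\<^sup>+x\<in>A. g x \<partial>M) < \<infinity>"
    by (rule le_less_trans[OF nn_integral_mono fin]) (auto split: split_indicator)
  have "(\<integral>\<^sup>+x. f x * indicator A x - g x * indicator A x \<partial>M) = (\<integral>\<^sup>+x\<in>A. f x \<partial>M) - (\<integral>\<^sup>+x\<in>A. g x \<partial>M)"
    by (rule nn_integral_diff) (use finA in \<open>auto simp: A_def split: split_indicator\<close>)
  also have "\<dots> = 0"
    using le[OF A] le_less_trans[OF le[OF A] finA] by (simp add: diff_eq_0_iff_ennreal)
  finally have "AE x in M. f x * indicator A x - g x * indicator A x = 0"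
    by (subst (asm) nn_integral_0_iff_AE) auto
  then show ?thesis
    using AE_space
  proof eventually_elim
    case (elim x)
    show ?case
    proof (rule ccontr)
      assume "\<not> f x \<le> g x"
      then have "g x < f x" by simp
      with elim have "f x - g x = 0" by (simp add: A_def)
      with \<open>g x < f x\<close> show False
        by (metis diff_gt_0_iff_gt_ennreal less_irrefl)
    qed
  qed
qed

text \<open>Along sets decreasing to the empty set the values of f are squeezed to 0 by those of M,
  so finite additivity becomes countable and a Radon-Nikodym density exists. That density is at most
  1 only almost everywhere; \<open>min 1 (enn2real (g x))\<close> makes the bounds hold
  everywhere.\<close>

lemma dominated_additive_density:
  fixes f :: "'b set \<Rightarrow> real"
  assumes "finite_measure M"
    and nonneg: "\<And>A. A \<in> sets M \<Longrightarrow> 0 \<le> f A"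
    and add: "\<And>A B. A \<in> sets M \<Longrightarrow> B \<in> sets M \<Longrightarrow> A \<inter> B = {} \<Longrightarrow> f (A \<union> B) = f A + f B"
    and le: "\<And>A. A \<in> sets M \<Longrightarrow> f A \<le> measure M A"
  shows "\<exists>h\<in>borel_measurable M. (\<forall>x. 0 \<le> h x \<and> h x \<le> 1) \<and>
           (\<forall>A\<in>sets M. (\<integral>\<^sup>+x\<in>A. ennreal (h x) \<partial>M) = ennreal (f A))"
proof -
  interpret finite_measure M by fact
  have f0: "f {} = 0"
    using nonneg[of "{}"] le[of "{}"] by simp
  have ca: "countably_additive (sets M) (\<lambda>A. ennreal (f A))"
  proof (rule sets.empty_continuous_imp_countably_additive)
    show "positive (sets M) (\<lambda>A. ennreal (f A))"
      by (simp add: positive_def f0)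
    show "additive (sets M) (\<lambda>A. ennreal (f A))"
      by (simp add: additive_def add nonneg)
    fix A :: "nat \<Rightarrow> 'b set"
    assume A: "range A \<subseteq> sets M" "decseq A" "(\<Inter>i. A i) = {}"
    have "(\<lambda>i. measure M (A i)) \<longlonglongrightarrow> 0"
      using finite_Lim_measure_decseq[OF A(1,2)] A(3) by simp
    then have "(\<lambda>i. f (A i)) \<longlonglongrightarrow> 0"
      by (rule Lim_null_comparison[rotated]) (use A nonneg le in \<open>auto intro!: always_eventually\<close>)
    then show "(\<lambda>i. ennreal (f (A i))) \<longlonglongrightarrow> 0"
      using tendsto_ennrealI by fastforce
  qed auto
  define N where "N = measure_of (space M) (sets M) (\<lambda>A. ennreal (f A))"
  have sets_N: "sets N = sets M"
    by (simp add: N_def)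
  have N: "emeasure N A = ennreal (f A)" if "A \<in> sets M" for A
    unfolding N_def
    by (rule emeasure_measure_of_sigma[OF _ _ ca that])
       (auto simp: positive_def f0 sets.sigma_algebra_axioms)
  have "absolutely_continuous M N"
    unfolding absolutely_continuous_def
  proof
    fix A assume "A \<in> null_sets M"
    then have "A \<in> sets M" "measure M A = 0"
      by (auto simp: measure_eq_0_null_sets)
    then show "A \<in> null_sets N"
      using le[of A] nonneg[of A] N[of A] sets_N by (intro null_setsI) auto
  qed
  from Radon_Nikodym[OF this sets_N] obtain g where
    g[measurable]: "g \<in> borel_measurable M" and gN: "density M g = N" by auto
  have set_g: "(\<integral>\<^sup>+x\<in>A. g x \<partial>M) = ennreal (f A)" if "A \<in> sets M" for A
    using N[OF that] emeasure_density[OF g that] gN by simp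
  have "AE x in M. g x \<le> 1"
  proof (rule AE_le_if_set_nn_integral_le)
    show "(\<integral>\<^sup>+x\<in>A. g x \<partial>M) \<le> (\<integral>\<^sup>+x\<in>A. 1 \<partial>M)" if "A \<in> sets M" for A
      using that by (simp add: set_g le emeasure_eq_measure)
  qed (auto simp: emeasure_eq_measure)
  then have eq: "AE x in M. ennreal (min 1 (enn2real (g x))) = g x"
  proof eventually_elim
    case (elim x)
    then have "enn2real (g x) \<le> 1" "ennreal (enn2real (g x)) = g x"
      by (auto intro: enn2real_leI simp: ennreal_enn2real_if top_unique)
    then show ?case by (simp add: min_def)
  qed
  show ?thesis
  proof (intro bexI[of _ "\<lambda>x. min 1 (enn2real (g x))"] conjI allI ballI)
    fix A assume A: "A \<in> sets M"
    have "(\<integral>\<^sup>+x\<in>A. ennreal (min 1 (enn2real (g x))) \<partial>M) = (\<integral>\<^sup>+x\<in>A. g x \<partial>M)"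
      by (rule nn_integral_cong_AE) (use eq in \<open>eventually_elim, simp\<close>)
    with set_g[OF A] show "(\<integral>\<^sup>+x\<in>A. ennreal (min 1 (enn2real (g x))) \<partial>M) = ennreal (f A)"
      by simp
  qed auto
qed

text \<open>A monotone function on the rationals need not be right continuous. Its infimum over
  strictly larger rationals is, and it lies between the values of h on either side, which is what
  the two comparison clauses record.\<close>

lemma rational_cdf_extension:
  fixes h :: "rat \<Rightarrow> real"
  assumes mono: "\<And>p q. p \<le> q \<Longrightarrow> h p \<le> h q"
    and range: "\<And>q. 0 \<le> h q" "\<And>q. h q \<le> 1"
    and bot: "\<And>n. \<exists>q. h q < 1 / real (Suc n)"
    and top: "\<And>n. \<exists>q. 1 - 1 / real (Suc n) < h q"
  defines "F \<equiv> (\<lambda>r::real. INF q\<in>{q. r < of_rat q}. h q)"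
  shows "real_distribution (interval_measure F)"
    and "emeasure (interval_measure F) {..r} = ennreal (F r)"
    and "of_rat q \<le> r \<Longrightarrow> h q \<le> F r" and "r < of_rat q \<Longrightarrow> F r \<le> h q" and "0 \<le> F r"
proof -
  have ne: "{q. r < of_rat q} \<noteq> {}" for r :: real
    using of_rat_dense[of r "r + 1"] by auto
  have bdd: "bdd_below (h ` A)" for A
    by (rule bdd_belowI2[of _ 0]) (rule range)
  show ge: "h q \<le> F r" if "of_rat q \<le> r" for q r
    unfolding F_def
  proof (rule cINF_greatest[OF ne])
    fix p assume "p \<in> {q. r < of_rat q}"
    with that have "q \<le> p"
      by (metis less_eq_real_def mem_Collect_eq of_rat_less_eq order.trans)
    then show "h q \<le> h p" by (rule mono)
  qed
  show le: "F r \<le> h q" if "r < of_rat q" for q r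
    unfolding F_def by (rule cINF_lower[OF bdd]) (simp add: that)
  show nonneg: "0 \<le> F r" for r
    unfolding F_def by (rule cINF_greatest[OF ne]) (rule range)
  have le1: "F r \<le> 1" for r
    using ne[of r] le[of r] range(2) order.trans by blast
  have monoF: "F x \<le> F y" if "x \<le> y" for x y
    unfolding F_def
    by (rule cINF_superset_mono[OF ne bdd]) (use that in auto)
  have rc: "continuous (at_right a) F" for a
    unfolding continuous_within
  proof (rule order_tendstoI)
    fix e assume "e < F a"
    then show "eventually (\<lambda>x. e < F x) (at_right a)"
      using monoF by (intro eventually_at_rightI[of a "a + 1"]) (auto intro: less_le_trans)
  next
    fix e assume "F a < e"
    then obtain q where q: "a < of_rat q" "h q < e"
      unfolding F_def using cINF_less_iff[OF ne bdd, of a e] by auto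
    then show "eventually (\<lambda>x. F x < e) (at_right a)"
      using le by (intro eventually_at_rightI[of a "of_rat q"]) (auto intro: le_less_trans)
  qed
  have lbot: "(F \<longlongrightarrow> 0) at_bot"
  proof (rule order_tendstoI)
    fix e :: real assume "e < 0"
    then show "eventually (\<lambda>x. e < F x) at_bot"
      using nonneg by (intro always_eventually allI) (rule less_le_trans)
  next
    fix e :: real assume "0 < e"
    then obtain n where n: "1 / real (Suc n) < e"
      using nat_approx_posE by blast
    from bot[of n] obtain q where "h q < 1 / real (Suc n)" by auto
    with n le have "F x < e" if "x < of_rat q" for x
      using that by (meson le_less_trans less_trans)
    then show "eventually (\<lambda>x. F x < e) at_bot"
      unfolding eventually_at_bot_dense by auto
  qed
  have ltop: "(F \<longlongrightarrow> 1) at_top"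
  proof (rule order_tendstoI)
    fix e :: real assume "1 < e"
    then show "eventually (\<lambda>x. F x < e) at_top"
      using le1 by (intro always_eventually allI) (rule le_less_trans)
  next
    fix e :: real assume "e < 1"
    then obtain n where n: "1 / real (Suc n) < 1 - e"
      using nat_approx_posE[of "1 - e"] by auto
    from top[of n] obtain q where "1 - 1 / real (Suc n) < h q" by auto
    with n have q: "e < h q" by linarith
    have "e < F x" if "of_rat q < x" for x
      using ge[of q x] q that by linarith
    then show "eventually (\<lambda>x. e < F x) at_top"
      unfolding eventually_at_top_dense by auto
  qed
  show "real_distribution (interval_measure F)"
    by (rule real_distribution_interval_measure[OF monoF rc lbot ltop])
  show "emeasure (interval_measure F) {..r} = ennreal (F r)"
    by (rule emeasure_interval_measure_Iic[OF monoF rc lbot])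
qed

text \<open>Additivity in each variable is only finite: domination by the marginals makes each partial
  map countably additive, so that conditional distribution functions come from Radon-Nikodym
  densities.\<close>

lemma bimeasure_kernel_real:
  fixes M :: "'b measure" and N :: "real measure" and m :: "'b set \<Rightarrow> real set \<Rightarrow> real"
  assumes "prob_space M" and "real_distribution N"
    and nonneg: "\<And>A B. A \<in> sets M \<Longrightarrow> B \<in> sets borel \<Longrightarrow> 0 \<le> m A B"
    and add1: "\<And>A A' B. A \<in> sets M \<Longrightarrow> A' \<in> sets M \<Longrightarrow> A \<inter> A' = {} \<Longrightarrow> B \<in> sets borel \<Longrightarrow>
      m (A \<union> A') B = m A B + m A' B"
    and add2: "\<And>A B B'. A \<in> sets M \<Longrightarrow> B \<in> sets borel \<Longrightarrow> B' \<in> sets borel \<Longrightarrow> B \<inter> B' = {} \<Longrightarrow>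
      m A (B \<union> B') = m A B + m A B'"
    and marg1: "\<And>A. A \<in> sets M \<Longrightarrow> m A UNIV = measure M A"
    and marg2: "\<And>B. B \<in> sets borel \<Longrightarrow> m (space M) B = measure N B"
  shows "\<exists>k\<in>M \<rightarrow>\<^sub>M prob_algebra borel. \<forall>A\<in>sets M. \<forall>B\<in>sets borel.
           (\<integral>\<^sup>+x\<in>A. emeasure (k x) B \<partial>M) = ennreal (m A B)"
proof -
  interpret prob_space M by fact
  interpret N: real_distribution N by fact
  have mono2: "m A B \<le> m A B'" if "A \<in> sets M" "B \<in> sets borel" "B' \<in> sets borel" "B \<subseteq> B'" for A B B'
    using add2[of A B "B' - B"] nonneg[of A "B' - B"] that by (auto simp: Un_absorb1)
  have mono1: "m A B \<le> m A' B" if "A \<in> sets M" "A' \<in> sets M" "B \<in> sets borel" "A \<subseteq> A'" for A A' B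
    using add1[of A "A' - A" B] nonneg[of "A' - A" B] that by (auto simp: Un_absorb1)
  have le1: "m A B \<le> measure M A" if "A \<in> sets M" "B \<in> sets borel" for A B
    using mono2[of A B UNIV] that by (simp add: marg1)
  have le2: "m A B \<le> measure N B" if "A \<in> sets M" "B \<in> sets borel" for A B
    using mono1[of A "space M" B] that sets.sets_into_space[of A M] by (simp add: marg2)
  define R :: "rat \<Rightarrow> real set" where "R q = {..of_rat q}" for q
  have R[measurable]: "R q \<in> sets borel" for q by (simp add: R_def)
  \<comment> \<open>\<open>h q\<close> is the conditional distribution function at q; rational q
    leave only countably many almost-everywhere conditions.\<close>
  have "\<exists>h\<in>borel_measurable M. (\<forall>x. 0 \<le> h x \<and> h x \<le> 1) \<and>
           (\<forall>A\<in>sets M. (\<integral>\<^sup>+x\<in>A. ennreal (h x) \<partial>M) = ennreal (m A (R q)))" for q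
    by (rule dominated_additive_density) (auto intro!: finite_measure_axioms nonneg add1 le1 R)
  then obtain h where h[measurable]: "\<And>q. h q \<in> borel_measurable M"
    and h01: "\<And>q x. 0 \<le> h q x" "\<And>q x. h q x \<le> (1::real)"
    and hm: "\<And>q A. A \<in> sets M \<Longrightarrow> (\<integral>\<^sup>+x\<in>A. ennreal (h q x) \<partial>M) = ennreal (m A (R q))"
    by metis
  have AE_mono: "AE x in M. h p x \<le> h q x" if "p \<le> q" for p q
  proof -
    have "AE x in M. ennreal (h p x) \<le> ennreal (h q x)"
    proof (rule AE_le_if_set_nn_integral_le)
      show "(\<integral>\<^sup>+x\<in>A. ennreal (h p x) \<partial>M) \<le> (\<integral>\<^sup>+x\<in>A. ennreal (h q x) \<partial>M)" if A: "A \<in> sets M" for A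
        using A \<open>p \<le> q\<close> by (simp add: hm R_def mono2 of_rat_less_eq ennreal_leI)
      show "(\<integral>\<^sup>+x. ennreal (h q x) \<partial>M) < \<infinity>"
        using hm[OF sets.top, of q] by (simp cong: nn_integral_cong)
    qed auto
    then show ?thesis by eventually_elim (simp add: h01)
  qed
  have ex_rat_le: "\<exists>q::rat. of_rat q \<le> y" and ex_rat_ge: "\<exists>q::rat. y \<le> of_rat q" for y :: real
    using of_rat_dense[of "y - 1" y] of_rat_dense[of y "y + 1"] by (auto intro: less_imp_le)
  have N_bot: "\<exists>q. measure N (R q) < e" if "0 < e" for e
  proof -
    have "eventually (\<lambda>y. cdf N y < e) at_bot"
      using N.cdf_lim_at_bot that by (rule order_tendstoD)
    then obtain y where "cdf N y < e"
      by (auto simp: eventually_at_bot_linorder)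
    moreover obtain q :: rat where "of_rat q \<le> y"
      using ex_rat_le by blast
    ultimately show ?thesis
      using N.cdf_nondecreasing[of "of_rat q" y] by (auto simp: cdf_def R_def intro!: exI[of _ q])
  qed
  have N_top: "\<exists>q. 1 - e < measure N (R q)" if "0 < e" for e
  proof -
    have "eventually (\<lambda>y. 1 - e < cdf N y) at_top"
      using N.cdf_lim_at_top_prob that by (intro order_tendstoD(1)) auto
    then obtain y where "1 - e < cdf N y"
      by (auto simp: eventually_at_top_linorder)
    moreover obtain q :: rat where "y \<le> of_rat q"
      using ex_rat_ge by blast
    ultimately show ?thesis
      using N.cdf_nondecreasing[of y "of_rat q"] by (auto simp: cdf_def R_def intro!: exI[of _ q])
  qed
  have AE_notin: "AE x in M. x \<notin> A"
    if "A \<in> sets M" "\<And>e. 0 < e \<Longrightarrow> 1 / real (Suc n) * measure M A \<le> e" for A n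
  proof -
    have "1 / real (Suc n) * measure M A \<le> 0"
      by (rule field_le_epsilon) (use that(2) in simp)
    then have "measure M A = 0"
      by (simp add: zero_less_mult_iff field_simps measure_le_0_iff)
    then show ?thesis
      using that(1) by (intro AE_not_in) (simp add: null_sets_def emeasure_eq_measure)
  qed
  have AE_bot: "AE x in M. \<exists>q. h q x < 1 / real (Suc n)" for n
  proof -
    define A where "A = {x\<in>space M. \<forall>q. 1 / real (Suc n) \<le> h q x}"
    have A[measurable]: "A \<in> sets M" unfolding A_def by measurable
    \<comment> \<open>Markov's inequality. Since \<open>m A (R q)\<close> is also below
      \<open>measure N (R q)\<close>, the mass of A is forced to 0 as q decreases.\<close>
    have bound: "1 / real (Suc n) * measure M A \<le> m A (R q)" for q
    proof -
      have "ennreal (1 / real (Suc n) * measure M A) = (\<integral>\<^sup>+x\<in>A. ennreal (1 / real (Suc n)) \<partial>M)"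
        by (subst nn_integral_cmult_indicator[OF A])
           (simp only: emeasure_eq_measure, rule ennreal_mult, auto)
      also have "\<dots> \<le> (\<integral>\<^sup>+x\<in>A. ennreal (h q x) \<partial>M)"
        by (rule nn_integral_mono) (auto simp: A_def intro: ennreal_leI split: split_indicator)
      finally show ?thesis
        using nonneg[OF A R] by (simp add: hm ennreal_le_iff)
    qed
    have "AE x in M. x \<notin> A"
    proof (rule AE_notin[OF A])
      fix e :: real assume "0 < e"
      with N_bot obtain q where "measure N (R q) < e" by blast
      with bound[of q] le2[OF A R, of q] show "1 / real (Suc n) * measure M A \<le> e" by linarith
    qed
    then show ?thesis
      using AE_space by eventually_elim (auto simp: A_def not_le)
  qed
  have AE_top: "AE x in M. \<exists>q. 1 - 1 / real (Suc n) < h q x" for n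
  proof -
    define A where "A = {x\<in>space M. \<forall>q. h q x \<le> 1 - 1 / real (Suc n)}"
    have A[measurable]: "A \<in> sets M" unfolding A_def by measurable
    have c: "0 \<le> 1 - 1 / real (Suc n)" by simp
    have bound: "m A (R q) \<le> (1 - 1 / real (Suc n)) * measure M A" for q
    proof -
      have "(\<integral>\<^sup>+x\<in>A. ennreal (h q x) \<partial>M) \<le> (\<integral>\<^sup>+x\<in>A. ennreal (1 - 1 / real (Suc n)) \<partial>M)"
        by (rule nn_integral_mono) (auto simp: A_def intro: ennreal_leI split: split_indicator)
      also have "\<dots> = ennreal ((1 - 1 / real (Suc n)) * measure M A)"
        using c by (simp add: nn_integral_cmult_indicator emeasure_eq_measure ennreal_mult del: of_nat_Suc)
      finally show ?thesis
        using c by (simp add: hm ennreal_le_iff del: of_nat_Suc)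
    qed
    have "AE x in M. x \<notin> A"
    proof (rule AE_notin[OF A])
      fix e :: real assume "0 < e"
      with N_top obtain q where q: "1 - e < measure N (R q)" by blast
      \<comment> \<open>Domination by N is applied to the complementary half-line, whose N-mass is
        below e; combined with \<open>bound\<close>, this makes the mass of A arbitrarily
        small.\<close>
      have "m A UNIV = m A (R q) + m A (- R q)"
        using add2[of A "R q" "- R q"] by auto
      moreover have "m A (- R q) \<le> measure N (- R q)"
        by (rule le2) auto
      moreover have "measure N (- R q) = 1 - measure N (R q)"
        using N.prob_compl[of "R q"] by (simp add: Compl_eq_Diff_UNIV)
      ultimately have "measure M A - m A (R q) \<le> e"
        using q by (simp add: marg1)
      with bound[of q] show "1 / real (Suc n) * measure M A \<le> e"
        by (simp add: algebra_simps)
    qed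
    then show ?thesis
      using AE_space by eventually_elim (auto simp: A_def not_le)
  qed
  define good where "good x \<longleftrightarrow> (\<forall>p q. p \<le> q \<longrightarrow> h p x \<le> h q x) \<and>
    (\<forall>n. \<exists>q. h q x < 1 / real (Suc n)) \<and> (\<forall>n. \<exists>q. 1 - 1 / real (Suc n) < h q x)" for x
  have AE_good: "AE x in M. good x"
    unfolding good_def using AE_mono AE_bot AE_top
    by (auto simp: AE_all_countable simp del: of_nat_Suc intro!: AE_impI)
  have [measurable]: "Measurable.pred M good"
    unfolding good_def by measurable
  \<comment> \<open>At bad points the values are those of the distribution function of the point
    mass at 0, so that the extension yields a probability measure for every x.\<close>
  define g where "g q x = (if good x then h q x else of_bool (0 \<le> q))" for q x
  have g[measurable]: "g q \<in> borel_measurable M" for q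
    unfolding g_def by measurable
  have g_mono: "g p x \<le> g q x" if "p \<le> q" for p q x
    using that by (auto simp: g_def good_def)
  have g01: "0 \<le> g q x" "g q x \<le> 1" for q x
    using h01 by (auto simp: g_def)
  have g_bot: "\<exists>q. g q x < 1 / real (Suc n)" for x n
    by (cases "good x") (auto simp: g_def good_def intro!: exI[of _ "-1"])
  have g_top: "\<exists>q. 1 - 1 / real (Suc n) < g q x" for x n
    by (cases "good x") (auto simp: g_def good_def intro!: exI[of _ 1])
  have gm: "(\<integral>\<^sup>+x\<in>A. ennreal (g q x) \<partial>M) = ennreal (m A (R q))" if "A \<in> sets M" for A q
    unfolding hm[OF that, symmetric]
    by (rule nn_integral_cong_AE) (use AE_good in \<open>eventually_elim, simp add: g_def\<close>)
  define F where "F x r = (INF q\<in>{q. r < of_rat q}. g q x)" for x and r :: real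
  note F_ext = rational_cdf_extension[of "\<lambda>q. g q x" for x, OF g_mono g01 g_bot g_top, folded F_def]
  define k where "k x = interval_measure (F x)" for x
  have k_Iic: "emeasure (k x) {..r} = ennreal (F x r)" for x r
    unfolding k_def by (rule F_ext(2))
  have k_meas: "k \<in> M \<rightarrow>\<^sub>M prob_algebra borel"
  proof (rule measurable_prob_algebra_generated)
    show "sets borel = sigma_sets UNIV (range (\<lambda>r::real. {..r}))"
      by (subst borel_eq_atMost) simp
    show "Int_stable (range (\<lambda>r::real. {..r}))"
      by (auto simp: Int_stable_def)
    show "prob_space (k x)" for x
      using F_ext(1)[of x] by (simp add: k_def real_distribution_def)
    show "sets (k x) = sets borel" for x
      by (simp add: k_def)
    fix A :: "real set" assume "A \<in> range (\<lambda>r. {..r})"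
    then obtain r where A: "A = {..r}" by auto
    have ne: "{q. r < of_rat q} \<noteq> {}"
      using of_rat_dense[of r "r + 1"] by auto
    have "(\<lambda>x. F x r) \<in> borel_measurable M"
      unfolding F_def
      by (rule borel_measurable_cINF[OF countableI_type])
         (auto intro!: bdd_belowI2[of _ 0] g01)
    then show "(\<lambda>x. emeasure (k x) A) \<in> borel_measurable M"
      by (simp add: A k_Iic)
  qed auto
  note k_sub = measurable_prob_algebraD[OF k_meas]
  have "(\<integral>\<^sup>+x\<in>A. emeasure (k x) B \<partial>M) = ennreal (m A B)" if A[measurable]: "A \<in> sets M" and B: "B \<in> sets borel" for A B
  proof -
    have finA: "finite_measure (density M (indicator A))"
      by (rule finite_measureI) (simp add: emeasure_density emeasure_eq_measure cong: nn_integral_cong)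
    \<comment> \<open>For fixed A the identity compares two finite measures on the line: the mixture
      K of k over A, and the measure L with values \<open>m A B\<close>. Their distribution
      functions are interleaved at the rationals and agree by right continuity.\<close>
    define K where "K = (density M (indicator A)) \<bind> k"
    have k_sub': "k \<in> density M (indicator A) \<rightarrow>\<^sub>M subprob_algebra borel"
      using k_sub by (simp cong: measurable_cong_sets)
    have K: "emeasure K B = (\<integral>\<^sup>+x\<in>A. emeasure (k x) B \<partial>M)" if "B \<in> sets borel" for B
      unfolding K_def using k_sub that
      by (subst emeasure_bind[OF _ k_sub' that])
         (auto simp: not_empty nn_integral_density mult.commute intro!: nn_integral_cong)
    have sets_K: "sets K = sets borel"
      unfolding K_def by (rule sets_bind[OF sets_kernel[OF k_sub']]) (auto simp: not_empty)
    have k_prob: "prob_space (k x)" "space (k x) = UNIV" for x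
      using F_ext(1)[of x] by (auto simp: k_def real_distribution_def)
    have K_UNIV: "emeasure K UNIV = ennreal (measure M A)"
      using prob_space.emeasure_space_1[OF k_prob(1)] k_prob(2)
      by (subst K) (auto simp: emeasure_eq_measure)
    have spK: "space K = UNIV"
      using sets_eq_imp_space_eq[OF sets_K] by simp
    have "finite_measure K"
      by (rule finite_measureI) (simp only: spK K_UNIV, simp)
    then interpret K: finite_borel_measure K
      using sets_K by (simp add: finite_borel_measure_def finite_borel_measure_axioms_def)
    \<comment> \<open>Domination in the second variable makes \<open>m A B\<close> countably
      additive in B; the density realises it as the measure L.\<close>
    have "\<exists>h\<in>borel_measurable N. (\<forall>x. 0 \<le> h x \<and> h x \<le> 1) \<and>
           (\<forall>B\<in>sets N. (\<integral>\<^sup>+y\<in>B. ennreal (h y) \<partial>N) = ennreal (m A B))"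
      by (rule dominated_additive_density) (auto intro!: N.finite_measure_axioms nonneg add2 le2 A)
    then obtain h' where h'[measurable]: "h' \<in> borel_measurable N"
      and hm': "\<And>B. B \<in> sets borel \<Longrightarrow> (\<integral>\<^sup>+y\<in>B. ennreal (h' y) \<partial>N) = ennreal (m A B)"
      by auto
    define L where "L = density N h'"
    have L: "emeasure L B = ennreal (m A B)" if "B \<in> sets borel" for B
      unfolding L_def using that by (subst emeasure_density) (auto simp: hm')
    have sets_L: "sets L = sets borel" by (simp add: L_def)
    have "finite_measure L"
      by (rule finite_measureI) (use L[of UNIV] sets_eq_imp_space_eq[OF sets_L] in simp)
    then interpret L: finite_borel_measure L
      using sets_L by (simp add: finite_borel_measure_def finite_borel_measure_axioms_def)
    have cdf_L: "cdf L r = m A {..r}" for r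
      using nonneg[OF A, of "{..r}"] by (simp add: cdf_def measure_def L)
    have cdf_K: "ennreal (cdf K r) = (\<integral>\<^sup>+x\<in>A. ennreal (F x r) \<partial>M)" for r
      using K[of "{..r}"] by (simp add: cdf_def K.emeasure_eq_measure k_Iic)
    have K_le: "cdf K r \<le> cdf L (of_rat q)" if "r < of_rat q" for r q
    proof -
      have "ennreal (cdf K r) \<le> (\<integral>\<^sup>+x\<in>A. ennreal (g q x) \<partial>M)"
        unfolding cdf_K by (rule nn_integral_mono) (auto intro!: F_ext(4) ennreal_leI that split: split_indicator)
      then show ?thesis
        using nonneg[OF A R] by (simp add: gm ennreal_le_iff cdf_L R_def)
    qed
    have L_le: "cdf L (of_rat q) \<le> cdf K r" if "of_rat q \<le> r" for r q
    proof -
      have "(\<integral>\<^sup>+x\<in>A. ennreal (g q x) \<partial>M) \<le> ennreal (cdf K r)"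
        unfolding cdf_K by (rule nn_integral_mono) (auto intro!: F_ext(3) ennreal_leI that split: split_indicator)
      then show ?thesis
        using K.cdf_nonneg by (simp add: gm ennreal_le_iff cdf_L R_def)
    qed
    have le_right: "x \<le> cdf P r" if P: "finite_borel_measure P" and x: "\<And>s. r < s \<Longrightarrow> x \<le> cdf P s"
      for P r x
    proof (rule tendsto_lowerbound)
      show "(cdf P \<longlongrightarrow> cdf P r) (at_right r)"
        using finite_borel_measure.cdf_is_right_cont[OF P] by (simp add: continuous_within)
      show "eventually (\<lambda>s. x \<le> cdf P s) (at_right r)"
        using x by (auto simp: eventually_at_filter)
    qed simp
    have "cdf K = cdf L"
    proof (intro ext antisym)
      fix r
      show "cdf K r \<le> cdf L r"
      proof (rule le_right[OF L.finite_borel_measure_axioms])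
        fix s assume "r < s"
        then obtain q where "r < of_rat q" "of_rat q < s" using of_rat_dense by blast
        with K_le[of r q] L.cdf_nondecreasing[of "of_rat q" s] show "cdf K r \<le> cdf L s" by simp
      qed
      show "cdf L r \<le> cdf K r"
      proof (rule le_right[OF K.finite_borel_measure_axioms])
        fix s assume "r < s"
        then obtain q where "r < of_rat q" "of_rat q < s" using of_rat_dense by blast
        with L_le[of q s] L.cdf_nondecreasing[of r "of_rat q"] show "cdf L r \<le> cdf K s" by simp
      qed
    qed
    then have "K = L"
      by (rule cdf_unique'[OF K.finite_borel_measure_axioms L.finite_borel_measure_axioms])
    then show ?thesis
      using K[OF B] L[OF B] by simp
  qed
  with k_meas show ?thesis by blast
qed

text \<open>The bimeasure is moved to the line by \<phi> in the second variable, and the resulting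
  kernel is pushed back by \<psi>. As \<psi> inverts \<phi>, the preimage under \<phi> of the
  preimage of B under \<psi> is B again.\<close>

lemma bimeasure_kernel:
  fixes M :: "'b measure" and N :: "'a::euclidean_space measure" and m :: "'b set \<Rightarrow> 'a set \<Rightarrow> real"
  assumes M: "prob_space M" and N: "prob_space N" and sets_N: "sets N = sets borel"
    and nonneg: "\<And>A B. A \<in> sets M \<Longrightarrow> B \<in> sets borel \<Longrightarrow> 0 \<le> m A B"
    and add1: "\<And>A A' B. A \<in> sets M \<Longrightarrow> A' \<in> sets M \<Longrightarrow> A \<inter> A' = {} \<Longrightarrow> B \<in> sets borel \<Longrightarrow>
      m (A \<union> A') B = m A B + m A' B"
    and add2: "\<And>A B B'. A \<in> sets M \<Longrightarrow> B \<in> sets borel \<Longrightarrow> B' \<in> sets borel \<Longrightarrow> B \<inter> B' = {} \<Longrightarrow>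
      m A (B \<union> B') = m A B + m A B'"
    and marg1: "\<And>A. A \<in> sets M \<Longrightarrow> m A UNIV = measure M A"
    and marg2: "\<And>B. B \<in> sets borel \<Longrightarrow> m (space M) B = measure N B"
  shows "\<exists>k\<in>M \<rightarrow>\<^sub>M prob_algebra borel. \<forall>A\<in>sets M. \<forall>B\<in>sets borel.
           (\<integral>\<^sup>+x\<in>A. emeasure (k x) B \<partial>M) = ennreal (m A B)"
proof -
  obtain \<phi> :: "'a \<Rightarrow> real" and \<psi> where \<phi>[measurable]: "\<phi> \<in> borel_measurable borel"
    and \<psi>[measurable]: "\<psi> \<in> borel_measurable borel" and inv: "\<And>x. \<psi> (\<phi> x) = x"
    using exists_real_code by blast
  have [measurable_cong]: "sets N = sets borel" by (rule sets_N)
  have spN: "space N = UNIV" using sets_eq_imp_space_eq[OF sets_N] by simp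
  have vim: "\<phi> -` B \<in> sets borel" if "B \<in> sets borel" for B
    using measurable_sets[OF \<phi> that] by simp
  have "\<exists>k\<in>M \<rightarrow>\<^sub>M prob_algebra borel. \<forall>A\<in>sets M. \<forall>B\<in>sets borel.
           (\<integral>\<^sup>+x\<in>A. emeasure (k x) B \<partial>M) = ennreal (m A (\<phi> -` B))"
  proof (rule bimeasure_kernel_real)
    show "real_distribution (distr N borel \<phi>)"
      by (rule prob_space.real_distribution_distr[OF N]) measurable
    show "m (space M) (\<phi> -` B) = measure (distr N borel \<phi>) B" if "B \<in> sets borel" for B
      using that by (subst measure_distr) (auto simp: marg2 vim spN)
  qed (auto simp: M nonneg vim marg1 add1 intro!: add2)
  then obtain k where k[measurable]: "k \<in> M \<rightarrow>\<^sub>M prob_algebra borel"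
    and km: "\<And>A B. A \<in> sets M \<Longrightarrow> B \<in> sets borel \<Longrightarrow> (\<integral>\<^sup>+x\<in>A. emeasure (k x) B \<partial>M) = ennreal (m A (\<phi> -` B))"
    by blast
  show ?thesis
  proof (intro bexI[of _ "\<lambda>x. distr (k x) borel \<psi>"] ballI)
    show "(\<lambda>x. distr (k x) borel \<psi>) \<in> M \<rightarrow>\<^sub>M prob_algebra borel"
      by measurable
    fix A and B :: "'a set" assume A: "A \<in> sets M" and B: "B \<in> sets borel"
    have sk: "sets (k x) = sets borel" "space (k x) = UNIV" if "x \<in> space M" for x
      using measurable_space[OF k that] by (auto simp: space_prob_algebra dest: sets_eq_imp_space_eq)
    have vB: "\<psi> -` B \<in> sets borel"
      using measurable_sets[OF \<psi> B] by simp
    have "(\<integral>\<^sup>+x\<in>A. emeasure (distr (k x) borel \<psi>) B \<partial>M) = (\<integral>\<^sup>+x\<in>A. emeasure (k x) (\<psi> -` B) \<partial>M)"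
      by (rule nn_integral_cong) (use B in \<open>simp add: emeasure_distr sk cong: measurable_cong_sets\<close>)
    also have "\<dots> = ennreal (m A (\<phi> -` \<psi> -` B))"
      by (rule km[OF A vB])
    also have "\<phi> -` \<psi> -` B = B"
      by (auto simp: inv)
    finally show "(\<integral>\<^sup>+x\<in>A. emeasure (distr (k x) borel \<psi>) B \<partial>M) = ennreal (m A B)" .
  qed
qed

section \<open>Kernel products and disintegration\<close>

text \<open>The semidirect product M(dx) k_x(dy). As a \<open>bind\<close> it inherits measurability
  and the nonnegative Fubini formula from the Giry monad.\<close>

definition kernel_prod :: "'b measure \<Rightarrow> 'c measure \<Rightarrow> ('b \<Rightarrow> 'c measure) \<Rightarrow> ('b \<times> 'c) measure" where
  "kernel_prod M N k = M \<bind> (\<lambda>x. distr (k x) (M \<Otimes>\<^sub>M N) (Pair x))"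

context
  fixes M :: "'b measure" and N :: "'c measure" and k :: "'b \<Rightarrow> 'c measure"
  assumes M: "prob_space M" and k[measurable]: "k \<in> M \<rightarrow>\<^sub>M prob_algebra N"
begin

interpretation prob_space M by (rule M)

lemma sets_prob_kernel: "x \<in> space M \<Longrightarrow> sets (k x) = sets N"
  using measurable_space[OF k] by (simp add: space_prob_algebra)

lemma prob_space_prob_kernel: "x \<in> space M \<Longrightarrow> prob_space (k x)"
  using measurable_space[OF k] by (simp add: space_prob_algebra)

lemma kernel_Pair_measurable:
  "(\<lambda>x. distr (k x) (M \<Otimes>\<^sub>M N) (Pair x)) \<in> M \<rightarrow>\<^sub>M prob_algebra (M \<Otimes>\<^sub>M N)"
  by measurable

lemma sets_kernel_prod: "sets (kernel_prod M N k) = sets (M \<Otimes>\<^sub>M N)"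
  unfolding kernel_prod_def by (rule sets_bind) (auto simp: not_empty)

lemma prob_space_kernel_prod: "prob_space (kernel_prod M N k)"
  unfolding kernel_prod_def
  by (rule prob_space_bind'[OF _ kernel_Pair_measurable]) (auto simp: space_prob_algebra prob_space_axioms)

lemma nn_integral_kernel_prod:
  assumes f: "f \<in> borel_measurable (M \<Otimes>\<^sub>M N)"
  shows "(\<integral>\<^sup>+z. f z \<partial>kernel_prod M N k) = (\<integral>\<^sup>+x. \<integral>\<^sup>+y. f (x, y) \<partial>k x \<partial>M)"
proof -
  have "(\<integral>\<^sup>+z. f z \<partial>kernel_prod M N k) = (\<integral>\<^sup>+x. \<integral>\<^sup>+z. f z \<partial>distr (k x) (M \<Otimes>\<^sub>M N) (Pair x) \<partial>M)"
    unfolding kernel_prod_def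
    by (rule nn_integral_bind[OF f measurable_prob_algebraD[OF kernel_Pair_measurable]])
  also have "\<dots> = (\<integral>\<^sup>+x. \<integral>\<^sup>+y. f (x, y) \<partial>k x \<partial>M)"
  proof (rule nn_integral_cong)
    fix x assume x: "x \<in> space M"
    have "Pair x \<in> k x \<rightarrow>\<^sub>M M \<Otimes>\<^sub>M N"
      using x by (simp cong: measurable_cong_sets add: sets_prob_kernel)
    then show "(\<integral>\<^sup>+z. f z \<partial>distr (k x) (M \<Otimes>\<^sub>M N) (Pair x)) = (\<integral>\<^sup>+y. f (x, y) \<partial>k x)"
      by (rule nn_integral_distr) (use f in simp)
  qed
  finally show ?thesis .
qed

lemma emeasure_kernel_prod:
  assumes A: "A \<in> sets (M \<Otimes>\<^sub>M N)"
  shows "emeasure (kernel_prod M N k) A = (\<integral>\<^sup>+x. emeasure (k x) (Pair x -` A) \<partial>M)"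
proof -
  have "emeasure (kernel_prod M N k) A = (\<integral>\<^sup>+z. indicator A z \<partial>kernel_prod M N k)"
    using A by (simp add: sets_kernel_prod)
  also have "\<dots> = (\<integral>\<^sup>+x. \<integral>\<^sup>+y. indicator A (x, y) \<partial>k x \<partial>M)"
    by (rule nn_integral_kernel_prod) (use A in simp)
  also have "\<dots> = (\<integral>\<^sup>+x. emeasure (k x) (Pair x -` A) \<partial>M)"
  proof (rule nn_integral_cong)
    fix x assume x: "x \<in> space M"
    have "(\<integral>\<^sup>+y. indicator A (x, y) \<partial>k x) = (\<integral>\<^sup>+y. indicator (Pair x -` A) y \<partial>k x)"
      by (rule nn_integral_cong) (simp split: split_indicator)
    also have "\<dots> = emeasure (k x) (Pair x -` A)"
      using sets_Pair1[OF A, of x] by (simp add: sets_prob_kernel[OF x])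
    finally show "(\<integral>\<^sup>+y. indicator A (x, y) \<partial>k x) = emeasure (k x) (Pair x -` A)" .
  qed
  finally show ?thesis .
qed

lemma distr_kernel_prod_fst: "distr (kernel_prod M N k) M fst = M"
proof (rule measure_eqI)
  fix A assume "A \<in> sets (distr (kernel_prod M N k) M fst)"
  then have A[measurable]: "A \<in> sets M" by simp
  have [measurable_cong]: "sets (kernel_prod M N k) = sets (M \<Otimes>\<^sub>M N)" by (rule sets_kernel_prod)
  have "emeasure (distr (kernel_prod M N k) M fst) A = (\<integral>\<^sup>+z. indicator A (fst z) \<partial>kernel_prod M N k)"
    by (subst nn_integral_indicator[symmetric], simp, subst nn_integral_distr) auto
  also have "\<dots> = (\<integral>\<^sup>+x. \<integral>\<^sup>+y. indicator A x \<partial>k x \<partial>M)"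
    by (subst nn_integral_kernel_prod) auto
  also have "\<dots> = (\<integral>\<^sup>+x. indicator A x \<partial>M)"
    by (rule nn_integral_cong) (simp add: prob_space.emeasure_space_1[OF prob_space_prob_kernel])
  finally show "emeasure (distr (kernel_prod M N k) M fst) A = emeasure M A" by simp
qed simp

lemma integral_kernel_measurable:
  fixes f :: "'b \<times> 'c \<Rightarrow> real"
  assumes fm: "f \<in> borel_measurable (M \<Otimes>\<^sub>M N)"
  shows "(\<lambda>x. \<integral>y. f (x, y) \<partial>k x) \<in> borel_measurable M"
proof -
  have "(\<lambda>x. \<integral>z. f z \<partial>distr (k x) (M \<Otimes>\<^sub>M N) (Pair x)) \<in> borel_measurable M"
    by (rule measurable_compose[OF measurable_prob_algebraD[OF kernel_Pair_measurable] integral_measurable_subprob_algebra[OF fm]])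
  also have "?this \<longleftrightarrow> (\<lambda>x. \<integral>y. f (x, y) \<partial>k x) \<in> borel_measurable M"
  proof (rule measurable_cong)
    fix x assume x: "x \<in> space M"
    have "Pair x \<in> k x \<rightarrow>\<^sub>M M \<Otimes>\<^sub>M N"
      using x by (simp cong: measurable_cong_sets add: sets_prob_kernel)
    then show "(\<integral>z. f z \<partial>distr (k x) (M \<Otimes>\<^sub>M N) (Pair x)) = (\<integral>y. f (x, y) \<partial>k x)"
      by (rule integral_distr[OF _ fm])
  qed
  finally show ?thesis .
qed

lemma
  fixes f :: "'b \<times> 'c \<Rightarrow> real"
  assumes f: "integrable (kernel_prod M N k) f"
  shows AE_integrable_kernel_prod: "AE x in M. integrable (k x) (\<lambda>y. f (x, y))"
    and integral_kernel_prod: "(\<integral>z. f z \<partial>kernel_prod M N k) = (\<integral>x. \<integral>y. f (x, y) \<partial>k x \<partial>M)"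
proof -
  have [measurable_cong]: "sets (kernel_prod M N k) = sets (M \<Otimes>\<^sub>M N)" by (rule sets_kernel_prod)
  have fm[measurable]: "f \<in> borel_measurable (M \<Otimes>\<^sub>M N)"
    using borel_measurable_integrable[OF f] by simp
  \<comment> \<open>\<open>ennreal\<close> sends negative reals to 0, so P applied to f and to -f
    integrates the positive and the negative part; the factor s below covers both signs.\<close>
  define P where "P g x = (\<integral>\<^sup>+y. ennreal (g (x, y)) \<partial>k x)" for g :: "'b \<times> 'c \<Rightarrow> real" and x
  have P_meas: "P g \<in> borel_measurable M" if [measurable]: "g \<in> borel_measurable (M \<Otimes>\<^sub>M N)" for g
    unfolding P_def
    by (rule nn_integral_measurable_subprob_algebra2[where N=N, OF _ measurable_prob_algebraD[OF k]]) simp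
  have P_int: "(\<integral>\<^sup>+x. P g x \<partial>M) = (\<integral>\<^sup>+z. ennreal (g z) \<partial>kernel_prod M N k)"
    if [measurable]: "g \<in> borel_measurable (M \<Otimes>\<^sub>M N)" for g
    unfolding P_def by (rule nn_integral_kernel_prod[symmetric]) simp
  have fin: "(\<integral>\<^sup>+x. P (\<lambda>z. norm (f z)) x \<partial>M) < \<infinity>"
    using f by (subst P_int) (auto simp: integrable_iff_bounded)
  have fin': "(\<integral>\<^sup>+x. P (\<lambda>z. s * f z) x \<partial>M) < \<infinity>" if "\<bar>s\<bar> \<le> 1" for s
  proof (rule le_less_trans[OF nn_integral_mono fin])
    fix x
    have "s * f z \<le> norm (f z)" for z
      using mult_right_mono[OF that, of "\<bar>f z\<bar>"] abs_ge_self[of "s * f z"] by (simp add: abs_mult)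
    then show "P (\<lambda>z. s * f z) x \<le> P (\<lambda>z. norm (f z)) x"
      unfolding P_def by (intro nn_integral_mono ennreal_leI)
  qed
  have AEfin: "AE x in M. P g x \<noteq> \<infinity>"
    if "g \<in> borel_measurable (M \<Otimes>\<^sub>M N)" "(\<integral>\<^sup>+x. P g x \<partial>M) < \<infinity>" for g
    by (rule nn_integral_PInf_AE[OF P_meas]) (use that in auto)
  have fmeas: "(\<lambda>y. f (x, y)) \<in> borel_measurable (k x)" if "x \<in> space M" for x
    using that by (simp cong: measurable_cong_sets add: sets_prob_kernel)
  have norm_meas: "norm \<in> borel \<rightarrow>\<^sub>M (borel :: real measure)"
    by measurable
  show AE_int: "AE x in M. integrable (k x) (\<lambda>y. f (x, y))"
    using AEfin[OF _ fin, OF measurable_compose[OF fm norm_meas]] AE_space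
    by eventually_elim (use fmeas in \<open>auto simp: integrable_iff_bounded P_def less_top\<close>)
  have part: "integrable M (\<lambda>x. enn2real (P g x))" "(\<integral>x. enn2real (P g x) \<partial>M) = enn2real (\<integral>\<^sup>+z. ennreal (g z) \<partial>kernel_prod M N k)"
    if g: "g \<in> borel_measurable (M \<Otimes>\<^sub>M N)" "(\<integral>\<^sup>+x. P g x \<partial>M) < \<infinity>" for g
  proof -
    note [measurable] = P_meas[OF g(1)]
    have eq: "(\<integral>\<^sup>+x. ennreal (enn2real (P g x)) \<partial>M) = (\<integral>\<^sup>+x. P g x \<partial>M)"
      by (rule nn_integral_cong_AE)
         (use AEfin[OF g] in \<open>eventually_elim, simp add: ennreal_enn2real_if\<close>)
    show "integrable M (\<lambda>x. enn2real (P g x))"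
      by (rule integrableI_bounded) (use eq g(2) in auto)
    show "(\<integral>x. enn2real (P g x) \<partial>M) = enn2real (\<integral>\<^sup>+z. ennreal (g z) \<partial>kernel_prod M N k)"
      by (subst integral_eq_nn_integral) (auto simp: eq P_int[OF g(1)])
  qed
  have p: "integrable M (\<lambda>x. enn2real (P f x))" "(\<integral>x. enn2real (P f x) \<partial>M) = enn2real (\<integral>\<^sup>+z. ennreal (f z) \<partial>kernel_prod M N k)"
    using part[OF fm] fin'[of 1] by auto
  have n: "integrable M (\<lambda>x. enn2real (P (\<lambda>z. - f z) x))"
    "(\<integral>x. enn2real (P (\<lambda>z. - f z) x) \<partial>M) = enn2real (\<integral>\<^sup>+z. ennreal (- f z) \<partial>kernel_prod M N k)"
    using part[of "\<lambda>z. - f z"] fin'[of "-1"] by auto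
  have "(\<integral>x. \<integral>y. f (x, y) \<partial>k x \<partial>M) = (\<integral>x. enn2real (P f x) - enn2real (P (\<lambda>z. - f z) x) \<partial>M)"
  proof (rule integral_cong_AE)
    have eq: "AE x in M. (\<integral>y. f (x, y) \<partial>k x) = enn2real (P f x) - enn2real (P (\<lambda>z. - f z) x)"
      using AE_int by eventually_elim (simp add: real_lebesgue_integral_def P_def)
    then show "AE x in M. (\<integral>y. f (x, y) \<partial>k x) = enn2real (P f x) - enn2real (P (\<lambda>z. - f z) x)" .
    show "(\<lambda>x. enn2real (P f x) - enn2real (P (\<lambda>z. - f z) x)) \<in> borel_measurable M"
      using P_meas[OF fm] P_meas[of "\<lambda>z. - f z"] by simp
    show "(\<lambda>x. \<integral>y. f (x, y) \<partial>k x) \<in> borel_measurable M"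
      by (rule integral_kernel_measurable[OF fm])
  qed
  also have "\<dots> = (\<integral>z. f z \<partial>kernel_prod M N k)"
    using p n by (simp add: real_lebesgue_integral_def[OF f])
  finally show "(\<integral>z. f z \<partial>kernel_prod M N k) = (\<integral>x. \<integral>y. f (x, y) \<partial>k x \<partial>M)" ..
qed

end

lemma measure_eqI_rectangles:
  fixes P Q :: "('b::second_countable_topology \<times> 'c::second_countable_topology) measure"
  assumes "prob_space P" "prob_space Q" and sets: "sets P = sets borel" "sets Q = sets borel"
    and eq: "\<And>A B. A \<in> sets borel \<Longrightarrow> B \<in> sets borel \<Longrightarrow> emeasure P (A \<times> B) = emeasure Q (A \<times> B)"
  shows "P = Q"
proof (rule measure_eqI_generator_eq)
  let ?E = "{a \<times> b | a b. a \<in> sets (borel::'b measure) \<and> b \<in> sets (borel::'c measure)}"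
  have gen: "sets (borel :: ('b \<times> 'c) measure) = sigma_sets UNIV ?E"
    using sets_pair_measure[of "borel::'b measure" "borel::'c measure"] unfolding borel_prod by simp
  show "Int_stable ?E" by (rule Int_stable_pair_measure_generator)
  show "sets P = sigma_sets UNIV ?E" "sets Q = sigma_sets UNIV ?E"
    using gen sets by auto
  show "emeasure P X = emeasure Q X" if "X \<in> ?E" for X
    using that eq by auto
  show "range (\<lambda>_::nat. UNIV \<times> UNIV) \<subseteq> ?E" by (auto simp del: UNIV_Times_UNIV) (rule exI[of _ UNIV], rule exI[of _ UNIV], simp)
  show "emeasure P (UNIV \<times> UNIV) \<noteq> \<infinity>"
    using prob_space.emeasure_space_1[OF assms(1)] sets_eq_imp_space_eq[OF sets(1)] by simp
qed auto

text \<open>The kernel is returned along with the measure because, for the rectangle values of a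
  given plan, it is a disintegration, while for a limit of plans the measure itself is
  wanted.\<close>

lemma bimeasure_extension:
  fixes M N :: "'a::euclidean_space measure" and m :: "'a set \<Rightarrow> 'a set \<Rightarrow> real"
  assumes M: "prob_space M" and sets_M: "sets M = sets borel"
    and N: "prob_space N" and sets_N: "sets N = sets borel"
    and nonneg: "\<And>A B. A \<in> sets borel \<Longrightarrow> B \<in> sets borel \<Longrightarrow> 0 \<le> m A B"
    and add1: "\<And>A A' B. A \<in> sets borel \<Longrightarrow> A' \<in> sets borel \<Longrightarrow> A \<inter> A' = {} \<Longrightarrow> B \<in> sets borel \<Longrightarrow>
      m (A \<union> A') B = m A B + m A' B"
    and add2: "\<And>A B B'. A \<in> sets borel \<Longrightarrow> B \<in> sets borel \<Longrightarrow> B' \<in> sets borel \<Longrightarrow> B \<inter> B' = {} \<Longrightarrow>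
      m A (B \<union> B') = m A B + m A B'"
    and marg1: "\<And>A. A \<in> sets borel \<Longrightarrow> m A UNIV = measure M A"
    and marg2: "\<And>B. B \<in> sets borel \<Longrightarrow> m UNIV B = measure N B"
  obtains k where "k \<in> borel \<rightarrow>\<^sub>M prob_algebra borel" "prob_space (kernel_prod M borel k)"
    "sets (kernel_prod M borel k) = sets borel"
    "\<And>A B. A \<in> sets borel \<Longrightarrow> B \<in> sets borel \<Longrightarrow> measure (kernel_prod M borel k) (A \<times> B) = m A B"
proof -
  have sp: "space M = UNIV" using sets_eq_imp_space_eq[OF sets_M] by simp
  have "\<exists>k\<in>M \<rightarrow>\<^sub>M prob_algebra borel. \<forall>A\<in>sets M. \<forall>B\<in>sets borel.
           (\<integral>\<^sup>+x\<in>A. emeasure (k x) B \<partial>M) = ennreal (m A B)"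
    by (rule bimeasure_kernel[OF M N sets_N])
       (simp_all add: sets_M sp marg1 marg2 nonneg add1 add2)
  then obtain k where k: "k \<in> M \<rightarrow>\<^sub>M prob_algebra borel"
    and km: "\<And>A B. A \<in> sets borel \<Longrightarrow> B \<in> sets borel \<Longrightarrow> (\<integral>\<^sup>+x\<in>A. emeasure (k x) B \<partial>M) = ennreal (m A B)"
    unfolding sets_M by blast
  have sets: "sets (kernel_prod M borel k) = sets borel"
    unfolding sets_kernel_prod[OF M k] borel_prod[symmetric]
    by (rule sets_pair_measure_cong) (auto simp: sets_M)
  show thesis
  proof (rule that[OF _ prob_space_kernel_prod[OF M k] sets])
    show "k \<in> borel \<rightarrow>\<^sub>M prob_algebra borel"
      using k by (simp cong: measurable_cong_sets add: sets_M)
    fix A B :: "'a set" assume A: "A \<in> sets borel" and B: "B \<in> sets borel"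
    have "emeasure (kernel_prod M borel k) (A \<times> B) = (\<integral>\<^sup>+x. emeasure (k x) (Pair x -` (A \<times> B)) \<partial>M)"
      by (rule emeasure_kernel_prod[OF M k]) (use A B in \<open>auto simp: sets_M\<close>)
    also have "\<dots> = (\<integral>\<^sup>+x\<in>A. emeasure (k x) B \<partial>M)"
      by (rule nn_integral_cong) (auto split: split_indicator)
    finally show "measure (kernel_prod M borel k) (A \<times> B) = m A B"
      using km[OF A B] nonneg[OF A B] by (simp add: measure_def)
  qed
qed

lemma space_borel_measure: "sets M = sets borel \<Longrightarrow> space M = UNIV"
  using sets_eq_imp_space_eq[of M borel] by simp

lemma is_disintegration_kernel_prod:
  fixes \<gamma> :: "('a::euclidean_space \<times> 'a) measure"
  assumes \<gamma>: "prob_space \<gamma>" "sets \<gamma> = sets borel"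
  defines "\<mu> \<equiv> distr \<gamma> borel fst"
  shows "is_disintegration \<gamma> k \<longleftrightarrow> k \<in> borel \<rightarrow>\<^sub>M prob_algebra borel \<and> \<gamma> = kernel_prod \<mu> borel k"
proof -
  have [measurable_cong]: "sets \<gamma> = sets (borel \<Otimes>\<^sub>M borel)"
    unfolding borel_prod by (rule \<gamma>)
  have \<mu>: "prob_space \<mu>" "sets \<mu> = sets borel"
    unfolding \<mu>_def by (auto intro!: prob_space.prob_space_distr[OF \<gamma>(1)])
  have "(\<forall>A\<in>sets borel. emeasure \<gamma> A = (\<integral>\<^sup>+x. emeasure (k x) {y. (x, y) \<in> A} \<partial>\<mu>)) \<longleftrightarrow> \<gamma> = kernel_prod \<mu> borel k"
    if "k \<in> borel \<rightarrow>\<^sub>M prob_algebra borel"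
  proof -
    have k: "k \<in> \<mu> \<rightarrow>\<^sub>M prob_algebra borel"
      using that by (simp cong: measurable_cong_sets add: \<mu>)
    have sets: "sets (\<mu> \<Otimes>\<^sub>M borel) = sets (borel :: ('a \<times> 'a) measure)"
      unfolding borel_prod[symmetric] by (rule sets_pair_measure_cong) (auto simp: \<mu>)
    have "emeasure (kernel_prod \<mu> borel k) A = (\<integral>\<^sup>+x. emeasure (k x) {y. (x, y) \<in> A} \<partial>\<mu>)" if "A \<in> sets borel" for A
      using emeasure_kernel_prod[OF \<mu>(1) k, unfolded sets, OF that] by (simp add: vimage_def)
    then show ?thesis
      by (auto intro!: measure_eqI simp: \<gamma> sets sets_kernel_prod[OF \<mu>(1) k])
  qed
  then show ?thesis
    unfolding is_disintegration_def \<mu>_def by blast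
qed

text \<open>The rectangle values of \<gamma> form a bimeasure with the marginals of \<gamma>.
  Agreement on rectangles identifies the kernel product with \<gamma>, so the choice in
  \<open>disintegration\<close> is from a nonempty set.\<close>

lemma is_disintegration_disintegration:
  fixes \<gamma> :: "('a::euclidean_space \<times> 'a) measure"
  assumes \<gamma>: "prob_space \<gamma>" "sets \<gamma> = sets borel"
  shows "is_disintegration \<gamma> (disintegration \<gamma>)"
proof -
  interpret prob_space \<gamma> by fact
  have [measurable_cong]: "sets \<gamma> = sets (borel \<Otimes>\<^sub>M borel)"
    unfolding borel_prod by (rule \<gamma>)
  have sp: "space \<gamma> = UNIV" by (rule space_borel_measure) fact
  define \<mu> where "\<mu> = distr \<gamma> borel fst"
  define \<sigma> where "\<sigma> = distr \<gamma> borel snd"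
  have \<mu>: "prob_space \<mu>" "sets \<mu> = sets borel" and \<sigma>: "prob_space \<sigma>" "sets \<sigma> = sets borel"
    unfolding \<mu>_def \<sigma>_def by (auto intro!: prob_space_distr)
  have rect: "A \<times> B \<in> sets \<gamma>" if "A \<in> sets borel" "B \<in> sets borel" for A B :: "'a set"
    using that by (simp add: \<gamma>(2) borel_prod[symmetric])
  have \<mu>_eq: "measure \<gamma> (A \<times> UNIV) = measure \<mu> A" if "A \<in> sets borel" for A
    unfolding \<mu>_def using that by (subst measure_distr) (auto simp: sp vimage_fst)
  have \<sigma>_eq: "measure \<gamma> (UNIV \<times> B) = measure \<sigma> B" if "B \<in> sets borel" for B
    unfolding \<sigma>_def using that by (subst measure_distr) (auto simp: sp vimage_snd)
  obtain k where k: "k \<in> borel \<rightarrow>\<^sub>M prob_algebra borel" "prob_space (kernel_prod \<mu> borel k)"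
    "sets (kernel_prod \<mu> borel k) = sets borel"
    "\<And>A B. A \<in> sets borel \<Longrightarrow> B \<in> sets borel \<Longrightarrow> measure (kernel_prod \<mu> borel k) (A \<times> B) = measure \<gamma> (A \<times> B)"
  proof (rule bimeasure_extension[OF \<mu> \<sigma>, of "\<lambda>A B. measure \<gamma> (A \<times> B)"])
    fix A A' B :: "'a set" assume "A \<in> sets borel" "A' \<in> sets borel" "A \<inter> A' = {}" "B \<in> sets borel"
    then show "measure \<gamma> ((A \<union> A') \<times> B) = measure \<gamma> (A \<times> B) + measure \<gamma> (A' \<times> B)"
      unfolding Sigma_Un_distrib1 by (intro finite_measure_Union rect) auto
  next
    fix A B B' :: "'a set" assume "A \<in> sets borel" "B \<in> sets borel" "B' \<in> sets borel" "B \<inter> B' = {}"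
    then show "measure \<gamma> (A \<times> (B \<union> B')) = measure \<gamma> (A \<times> B) + measure \<gamma> (A \<times> B')"
      unfolding Sigma_Un_distrib2 by (intro finite_measure_Union rect) auto
  qed (auto simp: \<mu>_eq \<sigma>_eq)
  have "\<gamma> = kernel_prod \<mu> borel k"
    by (rule measure_eqI_rectangles[OF \<gamma>(1) k(2) \<gamma>(2) k(3)])
       (use k(4) in \<open>simp add: emeasure_eq_measure finite_measure.emeasure_eq_measure[OF prob_space.finite_measure[OF k(2)]]\<close>)
  then have "is_disintegration \<gamma> k"
    using k(1) by (simp add: is_disintegration_kernel_prod[OF \<gamma>] \<mu>_def)
  then show ?thesis
    unfolding disintegration_def by (rule someI[of "is_disintegration \<gamma>"])
qed

section \<open>Square-integrable maps\<close>

text \<open>The analogue of \<open>L2\<close> with an arbitrary domain: plans and couplings live on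
  product spaces, where inequalities between distances become inequalities between norms of random
  variables.\<close>

definition sqint :: "'b measure \<Rightarrow> ('b \<Rightarrow> 'a::euclidean_space) \<Rightarrow> bool" where
  "sqint M f \<longleftrightarrow> f \<in> borel_measurable M \<and> integrable M (\<lambda>x. (norm (f x))\<^sup>2)"

definition nrm :: "'b measure \<Rightarrow> ('b \<Rightarrow> 'a::euclidean_space) \<Rightarrow> real" where
  "nrm M f = sqrt (\<integral>x. (norm (f x))\<^sup>2 \<partial>M)"

lemma sqint_measurable[measurable_dest]: "sqint M f \<Longrightarrow> f \<in> borel_measurable M"
  by (simp add: sqint_def)

lemma sqint_integrable: "sqint M f \<Longrightarrow> integrable M (\<lambda>x. (norm (f x))\<^sup>2)"
  by (simp add: sqint_def)

lemma L2_iff_sqint: "f \<in> L2 \<mu> \<longleftrightarrow> sqint \<mu> f"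
  by (simp add: L2_def sqint_def)

lemma L2_norm_eq_nrm: "L2_norm \<mu> f = nrm \<mu> f"
  by (simp add: L2_norm_def L2_inner_def nrm_def power2_norm_eq_inner)

lemma nrm_nonneg: "0 \<le> nrm M f"
  by (simp add: nrm_def)

lemma nrm_square: "(nrm M f)\<^sup>2 = (\<integral>x. (norm (f x))\<^sup>2 \<partial>M)"
  by (simp add: nrm_def integral_nonneg_AE)

lemma norm_add_square_le: "(norm (x + y))\<^sup>2 \<le> 2 * (norm x)\<^sup>2 + 2 * (norm (y::'a::real_inner))\<^sup>2"
proof -
  have "(norm (x + y))\<^sup>2 + (norm (x - y))\<^sup>2 = 2 * (norm x)\<^sup>2 + 2 * (norm y)\<^sup>2"
    by (simp add: power2_norm_eq_inner inner_add_left inner_add_right inner_diff_left inner_diff_right)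
  then show ?thesis by (metis zero_le_power2 le_add_same_cancel1)
qed

lemma sqint_bound:
  assumes "integrable M g" "f \<in> borel_measurable M" "\<And>x. x \<in> space M \<Longrightarrow> (norm (f x))\<^sup>2 \<le> g x"
  shows "sqint M f"
  unfolding sqint_def
proof
  have [measurable]: "f \<in> borel_measurable M" by fact
  show "integrable M (\<lambda>x. (norm (f x))\<^sup>2)"
    by (rule Bochner_Integration.integrable_bound[OF assms(1)])
       (use assms(3) in \<open>auto intro!: AE_I2 order.trans[OF _ abs_ge_self]\<close>)
qed fact

lemma sqint_zero: "sqint M (\<lambda>x. 0)"
  by (simp add: sqint_def)

lemma sqint_add: "sqint M f \<Longrightarrow> sqint M g \<Longrightarrow> sqint M (\<lambda>x. f x + g x)"
  by (rule sqint_bound[where g="\<lambda>x. 2 * (norm (f x))\<^sup>2 + 2 * (norm (g x))\<^sup>2"])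
     (auto simp: norm_add_square_le sqint_integrable)

lemma sqint_scaleR: "sqint M f \<Longrightarrow> sqint M (\<lambda>x. c *\<^sub>R f x)"
  by (rule sqint_bound[where g="\<lambda>x. c\<^sup>2 * (norm (f x))\<^sup>2"])
     (auto simp: sqint_integrable power_mult_distrib)

lemma sqint_diff: "sqint M f \<Longrightarrow> sqint M g \<Longrightarrow> sqint M (\<lambda>x. f x - g x)"
  using sqint_add[of M f "\<lambda>x. (-1) *\<^sub>R g x"] sqint_scaleR[of M g "-1"] by simp

lemma sqint_sum: "finite I \<Longrightarrow> (\<And>i. i \<in> I \<Longrightarrow> sqint M (f i)) \<Longrightarrow> sqint M (\<lambda>x. \<Sum>i\<in>I. f i x)"
  by (induction I rule: finite_induct) (auto simp: sqint_zero intro: sqint_add)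

lemma sqint_inner:
  fixes f g :: "'b \<Rightarrow> 'a::euclidean_space"
  assumes "sqint M f" "sqint M g"
  shows "integrable M (\<lambda>x. f x \<bullet> g x)"
proof (rule Bochner_Integration.integrable_bound)
  have [measurable]: "f \<in> borel_measurable M" "g \<in> borel_measurable M"
    using assms by (auto simp: sqint_def)
  show "integrable M (\<lambda>x. (norm (f x))\<^sup>2 + (norm (g x))\<^sup>2)"
    using assms by (simp add: sqint_integrable)
  show "(\<lambda>x. f x \<bullet> g x) \<in> borel_measurable M"
    by measurable
  have "\<bar>u \<bullet> v\<bar> \<le> (norm u)\<^sup>2 + (norm v)\<^sup>2" for u v :: 'a
    using Cauchy_Schwarz_ineq2[of u v] sum_squares_bound[of "norm u" "norm v"]
      mult_nonneg_nonneg[OF norm_ge_zero[of u] norm_ge_zero[of v]] by linarith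
  then show "AE x in M. norm (f x \<bullet> g x) \<le> norm ((norm (f x))\<^sup>2 + (norm (g x))\<^sup>2)"
    by simp
qed

lemma nrm_scaleR: "nrm M (\<lambda>x. c *\<^sub>R f x) = \<bar>c\<bar> * nrm M f"
  by (simp add: nrm_def power_mult_distrib real_sqrt_mult)

lemma nrm_diff_commute: "nrm M (\<lambda>x. f x - g x) = nrm M (\<lambda>x. g x - f x)"
  by (simp add: nrm_def norm_minus_commute)

lemma nrm_square_add:
  assumes "sqint M f" "sqint M g"
  shows "(nrm M (\<lambda>x. f x + g x))\<^sup>2 = (nrm M f)\<^sup>2 + 2 * (\<integral>x. f x \<bullet> g x \<partial>M) + (nrm M g)\<^sup>2"
proof -
  have "(norm (f x + g x))\<^sup>2 = (norm (f x))\<^sup>2 + 2 * (f x \<bullet> g x) + (norm (g x))\<^sup>2" for x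
    by (simp add: power2_norm_eq_inner inner_add_left inner_add_right inner_commute)
  then show ?thesis
    using assms by (simp add: nrm_square sqint_integrable sqint_inner)
qed

lemma sqint_Cauchy_Schwarz:
  assumes f: "sqint M f" and g: "sqint M g"
  shows "\<bar>\<integral>x. f x \<bullet> g x \<partial>M\<bar> \<le> nrm M f * nrm M g"
proof -
  define A where "A = (nrm M f)\<^sup>2"
  define B where "B = (\<integral>x. f x \<bullet> g x \<partial>M)"
  define C where "C = (nrm M g)\<^sup>2"
  have nonneg: "0 \<le> A + 2 * t * B + t\<^sup>2 * C" for t
  proof -
    have "0 \<le> (nrm M (\<lambda>x. f x + t *\<^sub>R g x))\<^sup>2" by simp
    also have "\<dots> = A + 2 * t * B + t\<^sup>2 * C"
      by (subst nrm_square_add[OF f sqint_scaleR[OF g]])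
         (simp add: nrm_scaleR A_def B_def C_def power_mult_distrib)
    finally show ?thesis .
  qed
  have "B\<^sup>2 \<le> A * C"
  proof (cases "C = 0")
    case True
    have "B = 0"
    proof (rule ccontr)
      assume "B \<noteq> 0"
      \<comment> \<open>This t makes A + 2 t B equal to -1.\<close>
      with nonneg[of "- (A + 1) / (2 * B)"] True show False
        by (simp add: field_simps)
    qed
    then show ?thesis by (simp add: True)
  next
    case False
    then have "0 < C" by (simp add: C_def)
    with nonneg[of "- B / C"] show ?thesis
      by (simp add: field_simps power2_eq_square)
  qed
  then have "sqrt (B\<^sup>2) \<le> sqrt (A * C)" by (rule real_sqrt_le_mono)
  then show ?thesis
    by (simp add: A_def B_def C_def real_sqrt_mult nrm_nonneg)
qed

lemma nrm_triangle:
  assumes "sqint M f" "sqint M g"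
  shows "nrm M (\<lambda>x. f x + g x) \<le> nrm M f + nrm M g"
proof (rule power2_le_imp_le)
  show "(nrm M (\<lambda>x. f x + g x))\<^sup>2 \<le> (nrm M f + nrm M g)\<^sup>2"
    using sqint_Cauchy_Schwarz[OF assms] by (simp add: nrm_square_add[OF assms] power2_sum)
qed (simp add: nrm_nonneg)

lemma nrm_le:
  assumes "integrable M g" "\<And>x. x \<in> space M \<Longrightarrow> (norm (f x))\<^sup>2 \<le> g x" "(\<integral>x. g x \<partial>M) \<le> c\<^sup>2" "0 \<le> c"
    "f \<in> borel_measurable M"
  shows "nrm M f \<le> c"
proof (rule power2_le_imp_le)
  have "(nrm M f)\<^sup>2 \<le> (\<integral>x. g x \<partial>M)"
    unfolding nrm_square
    by (rule integral_mono[OF sqint_integrable[OF sqint_bound[OF assms(1,5,2)]] assms(1,2)])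
  then show "(nrm M f)\<^sup>2 \<le> c\<^sup>2" using assms(3) by simp
qed fact

lemma sqint_distr:
  assumes "T \<in> M \<rightarrow>\<^sub>M N" "f \<in> borel_measurable N"
  shows "sqint (distr M N T) f \<longleftrightarrow> sqint M (\<lambda>x. f (T x))"
  using assms by (auto simp: sqint_def integrable_distr_eq)

lemma nrm_distr:
  assumes "T \<in> M \<rightarrow>\<^sub>M N" "f \<in> borel_measurable N"
  shows "nrm (distr M N T) f = nrm M (\<lambda>x. f (T x))"
  using assms by (simp add: nrm_def integral_distr)

section \<open>Density of simple and of bounded continuous maps in L2\<close>

lemma sqint_simple_approx:
  assumes f: "sqint M f" and "0 < e"
  shows "\<exists>s. simple_function M s \<and> sqint M s \<and> nrm M (\<lambda>x. f x - s x) < e"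
proof -
  have fm[measurable]: "f \<in> borel_measurable M" using f by (simp add: sqint_def)
  obtain s where s: "\<And>i. simple_function M (s i)"
    and lim: "\<And>x. x \<in> space M \<Longrightarrow> (\<lambda>i. s i x) \<longlonglongrightarrow> f x"
    and bound: "\<And>i x. x \<in> space M \<Longrightarrow> dist (s i x) 0 \<le> 2 * dist (f x) 0"
    using borel_measurable_implies_sequence_metric[OF fm, of 0] by blast
  have s_meas[measurable]: "s i \<in> borel_measurable M" for i
    using s by (rule borel_measurable_simple_function)
  have sq: "sqint M (s i)" for i
  proof (rule sqint_bound)
    show "integrable M (\<lambda>x. 4 * (norm (f x))\<^sup>2)" using f by (simp add: sqint_integrable)
    show "(norm (s i x))\<^sup>2 \<le> 4 * (norm (f x))\<^sup>2" if "x \<in> space M" for x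
      using power_mono[OF bound[OF that, of i], of 2] by (simp add: power_mult_distrib dist_norm)
  qed measurable
  have "(\<lambda>i. \<integral>x. (norm (f x - s i x))\<^sup>2 \<partial>M) \<longlonglongrightarrow> (\<integral>x. 0 \<partial>M)"
  proof (rule integral_dominated_convergence)
    \<comment> \<open>10 = 2 + 2 * 4, since the approximants are bounded in norm by twice f.\<close>
    show "integrable M (\<lambda>x. 10 * (norm (f x))\<^sup>2)" using f by (simp add: sqint_integrable)
    show "AE x in M. norm ((norm (f x - s i x))\<^sup>2) \<le> 10 * (norm (f x))\<^sup>2" for i
    proof (rule AE_I2)
      fix x assume x: "x \<in> space M"
      have "(norm (f x - s i x))\<^sup>2 \<le> 2 * (norm (f x))\<^sup>2 + 2 * (norm (s i x))\<^sup>2"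
        using norm_add_square_le[of "f x" "- s i x"] by simp
      moreover have "(norm (s i x))\<^sup>2 \<le> 4 * (norm (f x))\<^sup>2"
        using power_mono[OF bound[OF x, of i], of 2] by (simp add: power_mult_distrib dist_norm)
      ultimately show "norm ((norm (f x - s i x))\<^sup>2) \<le> 10 * (norm (f x))\<^sup>2" by simp
    qed
    show "AE x in M. (\<lambda>i. (norm (f x - s i x))\<^sup>2) \<longlonglongrightarrow> 0"
    proof (rule AE_I2)
      fix x assume "x \<in> space M"
      then have "(\<lambda>i. (norm (f x - s i x))\<^sup>2) \<longlonglongrightarrow> (norm (f x - f x))\<^sup>2"
        by (intro tendsto_intros lim)
      then show "(\<lambda>i. (norm (f x - s i x))\<^sup>2) \<longlonglongrightarrow> 0" by simp
    qed
  qed measurable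
  then have "(\<lambda>i. \<integral>x. (norm (f x - s i x))\<^sup>2 \<partial>M) \<longlonglongrightarrow> 0" by simp
  then have "eventually (\<lambda>i. (\<integral>x. (norm (f x - s i x))\<^sup>2 \<partial>M) < e\<^sup>2) sequentially"
    by (rule order_tendstoD) (use \<open>0 < e\<close> in simp)
  then obtain i where "(\<integral>x. (norm (f x - s i x))\<^sup>2 \<partial>M) < e\<^sup>2"
    using eventually_happens by force
  then have "nrm M (\<lambda>x. f x - s i x) < e"
    unfolding nrm_def using \<open>0 < e\<close> by (intro real_less_lsqrt) auto
  with s sq show ?thesis by blast
qed

text \<open>Squeeze A between a compact K and an open U with \<open>U - K\<close> of small measure.
  The Urysohn function between them takes values in the segment from 0 to y, so it differs from the
  indicator map only on \<open>U - K\<close>, and there by at most the norm of y.\<close>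

lemma sqint_continuous_approx_indicator:
  fixes y :: "'a::euclidean_space" and \<mu> :: "'a measure"
  assumes \<mu>: "finite_measure \<mu>" "sets \<mu> = sets borel" and A: "A \<in> sets borel" and "0 < e"
  shows "\<exists>w. continuous_on UNIV w \<and> bounded (range w) \<and> sqint \<mu> w \<and>
           nrm \<mu> (\<lambda>x. indicator A x *\<^sub>R y - w x) < e"
proof -
  interpret finite_measure \<mu> by fact
  have sp: "space \<mu> = UNIV" using sets_eq_imp_space_eq[OF \<mu>(2)] by simp
  have [measurable_cong]: "sets \<mu> = sets borel" by fact
  have [measurable]: "A \<in> sets borel" by fact
  \<comment> \<open>Chosen so that ((norm y)^2 + 1) * 2d equals e^2, as \<open>U - K\<close> gets
    mass below 2d; the added 1 covers y = 0.\<close>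
  define d where "d = e\<^sup>2 / (2 * ((norm y)\<^sup>2 + 1))"
  have npos: "0 < (norm y)\<^sup>2 + 1" by (simp add: add_nonneg_pos)
  have d: "0 < d" using \<open>0 < e\<close> npos by (simp add: d_def)
  have "\<exists>K\<in>{K. K \<subseteq> A \<and> compact K}. emeasure \<mu> A < emeasure \<mu> K + ennreal d"
  proof (rule ccontr)
    assume "\<not> ?thesis"
    then have "emeasure \<mu> K + ennreal d \<le> emeasure \<mu> A" if "K \<in> {K. K \<subseteq> A \<and> compact K}" for K
      using that by (auto simp: not_less)
    then have le: "measure \<mu> K \<le> measure \<mu> A - d" if "K \<subseteq> A" "compact K" for K
    proof -
      from that have "emeasure \<mu> K + ennreal d \<le> emeasure \<mu> A"
        using \<open>\<And>K. K \<in> {K. K \<subseteq> A \<and> compact K} \<Longrightarrow> emeasure \<mu> K + ennreal d \<le> emeasure \<mu> A\<close> by auto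
      then have "ennreal (measure \<mu> K + d) \<le> ennreal (measure \<mu> A)"
        using d by (simp add: emeasure_eq_measure)
      then show ?thesis by (simp add: ennreal_le_iff)
    qed
    have Ad: "0 \<le> measure \<mu> A - d" using le[of "{}"] by simp
    have "emeasure \<mu> A = (SUP K\<in>{K. K \<subseteq> A \<and> compact K}. emeasure \<mu> K)"
      by (rule inner_regular[OF \<mu>(2) _ A]) simp
    also have "\<dots> \<le> ennreal (measure \<mu> A - d)"
      using le by (intro SUP_least) (auto simp: emeasure_eq_measure intro!: ennreal_leI)
    finally show False
      using d Ad by (simp add: emeasure_eq_measure)
  qed
  then obtain K where K: "K \<subseteq> A" "compact K" "emeasure \<mu> A < emeasure \<mu> K + ennreal d" by auto
  have Km[measurable]: "K \<in> sets borel" using K(2) by (simp add: compact_imp_closed)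
  have "\<exists>U\<in>{U. A \<subseteq> U \<and> open U}. emeasure \<mu> U < emeasure \<mu> A + ennreal d"
  proof -
    have "emeasure \<mu> A = (INF U\<in>{U. A \<subseteq> U \<and> open U}. emeasure \<mu> U)"
      by (rule outer_regular[OF \<mu>(2) _ A]) simp
    moreover have "emeasure \<mu> A < emeasure \<mu> A + ennreal d"
      using d by (simp add: emeasure_eq_measure ennreal_less_iff flip: ennreal_plus)
    ultimately show ?thesis by (metis INF_less_iff)
  qed
  then obtain U where U: "A \<subseteq> U" "open U" "emeasure \<mu> U < emeasure \<mu> A + ennreal d" by auto
  have Um[measurable]: "U \<in> sets borel" using U(2) by simp
  have "measure \<mu> A < measure \<mu> K + d" "measure \<mu> U < measure \<mu> A + d"
    using K(3) U(3) d by (simp_all add: emeasure_eq_measure ennreal_less_iff flip: ennreal_plus)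
  moreover have "measure \<mu> (U - K) = measure \<mu> U - measure \<mu> K"
    using K U by (intro finite_measure_Diff) (auto simp: \<mu>(2))
  ultimately have UK: "measure \<mu> (U - K) < 2 * d" by linarith
  obtain w :: "'a \<Rightarrow> 'a" where w: "continuous_on UNIV w" "\<And>x. w x \<in> closed_segment y 0"
    "\<And>x. x \<in> K \<Longrightarrow> w x = y" "\<And>x. x \<in> - U \<Longrightarrow> w x = 0"
  proof (rule Urysohn[of K "- U" y 0])
    show "closed K" using K(2) by (rule compact_imp_closed)
    show "closed (- U)" using U(2) by (rule closed_Compl)
    show "K \<inter> - U = {}" using K(1) U(1) by auto
  qed (rule that)
  have [measurable]: "w \<in> borel_measurable borel"
    using w(1) by (rule borel_measurable_continuous_onI)
  have w_norm: "norm (w x) \<le> norm y" for x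
    using w(2)[of x] by (auto simp: in_segment mult_left_le_one_le)
  have yw: "norm (y - w x) \<le> norm y" for x
  proof -
    from w(2)[of x] obtain u where u: "0 \<le> u" "u \<le> 1" "w x = (1 - u) *\<^sub>R y"
      by (auto simp: in_segment)
    then have "y - w x = u *\<^sub>R y" by (simp add: algebra_simps)
    with u show ?thesis by (simp add: mult_left_le_one_le)
  qed
  have "sqint \<mu> w"
    by (rule sqint_bound[of _ "\<lambda>x. (norm y)\<^sup>2"]) (auto intro: power_mono w_norm)
  moreover have "nrm \<mu> (\<lambda>x. indicator A x *\<^sub>R y - w x) < e"
  proof -
    have "nrm \<mu> (\<lambda>x. indicator A x *\<^sub>R y - w x) \<le> sqrt ((norm y)\<^sup>2 * measure \<mu> (U - K))"
    proof (rule nrm_le)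
      show "integrable \<mu> (\<lambda>x. (norm y)\<^sup>2 * indicator (U - K) x)"
        by (simp add: emeasure_eq_measure)
      show "(norm (indicator A x *\<^sub>R y - w x))\<^sup>2 \<le> (norm y)\<^sup>2 * indicator (U - K) x" for x
        using w(3,4)[of x] w_norm[of x] yw[of x] K(1) U(1)
        by (auto simp: indicator_def intro: power_mono)
      show "(\<lambda>x. indicator A x *\<^sub>R y - w x) \<in> borel_measurable \<mu>" by measurable
    qed auto
    also have "\<dots> < e"
    proof (rule real_less_lsqrt)
      have "(norm y)\<^sup>2 * measure \<mu> (U - K) \<le> ((norm y)\<^sup>2 + 1) * measure \<mu> (U - K)"
        by (simp add: algebra_simps)
      also have "\<dots> < ((norm y)\<^sup>2 + 1) * (2 * d)"
        using UK npos by (rule mult_strict_left_mono)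
      also have "\<dots> = e\<^sup>2"
        unfolding d_def using npos by (simp add: field_simps)
      finally show "(norm y)\<^sup>2 * measure \<mu> (U - K) < e\<^sup>2" .
    qed (use \<open>0 < e\<close> in auto)
    finally show ?thesis .
  qed
  moreover have "bounded (range w)"
    using w_norm by (auto simp: bounded_iff)
  ultimately show ?thesis using w(1) by blast
qed

lemma simple_function_sum_level_sets:
  fixes s :: "'a \<Rightarrow> 'b::real_vector"
  assumes "finite (range s)"
  shows "s x = (\<Sum>y\<in>range s. indicator (s -` {y}) x *\<^sub>R y)"
proof -
  have "(\<Sum>y\<in>range s. indicator (s -` {y}) x *\<^sub>R y) = (\<Sum>y\<in>range s. if y = s x then y else 0)"
    by (rule sum.cong) (auto simp: indicator_def)
  then show ?thesis using assms by simp
qed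

text \<open>Density in the form that the separation argument consumes: bounded continuous maps
  belong to \<open>C1_maps\<close>.\<close>

lemma sqint_continuous_approx:
  fixes \<mu> :: "'a::euclidean_space measure" and f :: "'a \<Rightarrow> 'a"
  assumes \<mu>: "finite_measure \<mu>" "sets \<mu> = sets borel" and f: "sqint \<mu> f" and "0 < e"
  shows "\<exists>w. continuous_on UNIV w \<and> bounded (range w) \<and> sqint \<mu> w \<and> nrm \<mu> (\<lambda>x. f x - w x) < e"
proof -
  interpret finite_measure \<mu> by fact
  have sp: "space \<mu> = UNIV" using sets_eq_imp_space_eq[OF \<mu>(2)] by simp
  have ind: "sqint \<mu> (\<lambda>x. indicator A x *\<^sub>R y)" if "A \<in> sets \<mu>" for A and y :: 'a
    using that by (intro sqint_bound[of _ "\<lambda>x. (norm y)\<^sup>2"]) (auto simp: indicator_def)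
  have sum_approx: "\<exists>w. continuous_on UNIV w \<and> bounded (range w) \<and> sqint \<mu> w \<and>
      nrm \<mu> (\<lambda>x. (\<Sum>y\<in>Y. indicator (A y) x *\<^sub>R y) - w x) < e"
    if "finite Y" "\<And>y. y \<in> Y \<Longrightarrow> A y \<in> sets \<mu>" "0 < e" for Y :: "'a set" and A e
    using that
  proof (induction Y arbitrary: e rule: finite_induct)
    case empty
    then show ?case by (intro exI[of _ "\<lambda>_. 0"]) (auto simp: nrm_def sqint_zero)
  next
    case (insert y Y)
    obtain w where w: "continuous_on UNIV w" "bounded (range w)" "sqint \<mu> w"
      "nrm \<mu> (\<lambda>x. (\<Sum>y\<in>Y. indicator (A y) x *\<^sub>R y) - w x) < e / 2"
      using insert.IH[of "e / 2"] insert.prems by auto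
    obtain v where v: "continuous_on UNIV v" "bounded (range v)" "sqint \<mu> v"
      "nrm \<mu> (\<lambda>x. indicator (A y) x *\<^sub>R y - v x) < e / 2"
      using sqint_continuous_approx_indicator[OF \<mu>, of "A y" "e / 2" y] insert.prems by (auto simp: \<mu>(2))
    have "nrm \<mu> (\<lambda>x. (indicator (A y) x *\<^sub>R y - v x) + ((\<Sum>y\<in>Y. indicator (A y) x *\<^sub>R y) - w x)) < e"
      using w(4) v(4) insert.prems
      by (intro le_less_trans[OF nrm_triangle]) (auto intro!: sqint_diff sqint_sum ind v w insert.hyps)
    moreover have "(indicator (A y) x *\<^sub>R y - v x) + ((\<Sum>y\<in>Y. indicator (A y) x *\<^sub>R y) - w x) =
        (\<Sum>y\<in>insert y Y. indicator (A y) x *\<^sub>R y) - (v x + w x)" for x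
      unfolding sum.insert[OF insert.hyps] by (rule add_diff_add[symmetric])
    ultimately show ?case
      using v w by (intro exI[of _ "\<lambda>x. v x + w x"])
        (auto intro!: continuous_on_add bounded_plus_comp sqint_add)
  qed
  obtain s where s: "simple_function \<mu> s" "sqint \<mu> s" "nrm \<mu> (\<lambda>x. f x - s x) < e / 2"
    using sqint_simple_approx[OF f, of "e / 2"] \<open>0 < e\<close> by auto
  have fin: "finite (range s)" using simple_functionD(1)[OF s(1)] by (simp add: sp)
  note s_eq = simple_function_sum_level_sets[OF fin]
  obtain w where w: "continuous_on UNIV w" "bounded (range w)" "sqint \<mu> w"
    "nrm \<mu> (\<lambda>x. (\<Sum>y\<in>range s. indicator (s -` {y}) x *\<^sub>R y) - w x) < e / 2"
    using sum_approx[OF fin, of "\<lambda>y. s -` {y}" "e / 2"] simple_functionD(2)[OF s(1)] \<open>0 < e\<close>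
    by (auto simp: sp)
  have "nrm \<mu> (\<lambda>x. (f x - s x) + (s x - w x)) < e"
    using s(3) w(4) unfolding s_eq[symmetric]
    by (intro le_less_trans[OF nrm_triangle]) (auto intro!: sqint_diff f s w)
  with w show ?thesis by (intro exI[of _ w]) simp
qed

section \<open>Compactness of transport plans\<close>

text \<open>A power of the unit interval need not be sequentially compact, so convergence is along a filter
  \<open>H\<close> finer than \<^const>\<open>sequentially\<close> in place of a subsequence.\<close>

lemma cube_cluster_point:
  fixes x :: "nat \<Rightarrow> 'i \<Rightarrow> real"
  assumes x: "\<And>n i. 0 \<le> x n i" "\<And>n i. x n i \<le> 1"
  obtains l H where "H \<noteq> bot" "H \<le> sequentially" "\<And>i. ((\<lambda>n. x n i) \<longlongrightarrow> l i) H"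
proof -
  have "compactin (product_topology (\<lambda>_::'i. euclidean) UNIV) (PiE UNIV (\<lambda>_. {0..1::real}))"
    by (simp add: compactin_PiE compactin_euclidean_iff)
  then have "compact (PiE UNIV (\<lambda>_::'i. {0..1::real}))"
    by (simp add: euclidean_product_topology compactin_euclidean_iff)
  moreover have "filtermap x sequentially \<noteq> bot"
    by (simp add: filtermap_bot_iff)
  moreover have "eventually (\<lambda>y. y \<in> PiE UNIV (\<lambda>_::'i. {0..1::real})) (filtermap x sequentially)"
    using x by (auto simp: eventually_filtermap PiE_def)
  ultimately obtain l where l: "inf (nhds l) (filtermap x sequentially) \<noteq> bot"
    unfolding compact_filter by metis
  define H where "H = inf sequentially (filtercomap x (nhds l))"
  have "H \<noteq> bot"
  proof
    assume "H = bot"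
    then have "eventually (\<lambda>_. False) H" by simp
    then obtain P Q where P: "eventually P sequentially" and Q: "eventually Q (filtercomap x (nhds l))"
      and PQ: "\<And>n. P n \<Longrightarrow> Q n \<Longrightarrow> False"
      unfolding H_def eventually_inf by auto
    from Q obtain R where R: "eventually R (nhds l)" "\<And>n. R (x n) \<Longrightarrow> Q n"
      unfolding eventually_filtercomap by auto
    have "eventually (\<lambda>y. \<not> R y) (filtermap x sequentially)"
      unfolding eventually_filtermap using P by eventually_elim (use PQ R in auto)
    with R(1) have "eventually (\<lambda>_. False) (inf (nhds l) (filtermap x sequentially))"
      unfolding eventually_inf by blast
    with l show False by (simp add: trivial_limit_def)
  qed
  moreover have "H \<le> sequentially" by (simp add: H_def)
  moreover have "((\<lambda>n. x n i) \<longlongrightarrow> l i) H" for i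
  proof -
    have x_lim: "filterlim x (nhds l) H"
      unfolding H_def by (rule filterlim_mono[OF filterlim_filtercomap order_refl inf.cobounded2])
    show ?thesis
    proof (rule topological_tendstoI)
      fix S assume S: "open S" "l i \<in> S"
      have "open ((\<lambda>f::'i \<Rightarrow> real. f i) -` S)"
        using continuous_on_open_vimage[OF open_UNIV, of "\<lambda>f::'i \<Rightarrow> real. f i"]
          continuous_on_product_coordinates[of i] S(1) by simp
      then have "eventually (\<lambda>f. f \<in> (\<lambda>f. f i) -` S) (nhds l)"
        using S(2) by (intro eventually_nhds_in_open) simp_all
      from filterlim_iff[THEN iffD1, OF x_lim, rule_format, OF this]
      show "eventually (\<lambda>n. x n i \<in> S) H" by simp
    qed
  qed
  ultimately show thesis by (rule that)
qed

lemma transport_plansD: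
  assumes "\<gamma> \<in> transport_plans \<mu> \<sigma>"
  shows "prob_space \<gamma>" "sets \<gamma> = sets borel" "space \<gamma> = UNIV"
    "distr \<gamma> borel fst = \<mu>" "distr \<gamma> borel snd = \<sigma>"
    "fst \<in> \<gamma> \<rightarrow>\<^sub>M borel" "snd \<in> \<gamma> \<rightarrow>\<^sub>M borel"
proof -
  show *: "prob_space \<gamma>" "sets \<gamma> = sets borel" "distr \<gamma> borel fst = \<mu>" "distr \<gamma> borel snd = \<sigma>"
    using assms by (auto simp: transport_plans_def)
  show "space \<gamma> = UNIV" using * by (simp add: space_borel_measure)
  have [measurable_cong]: "sets \<gamma> = sets (borel \<Otimes>\<^sub>M borel)"
    unfolding borel_prod by (rule *)
  show "fst \<in> \<gamma> \<rightarrow>\<^sub>M borel" "snd \<in> \<gamma> \<rightarrow>\<^sub>M borel" by measurable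
qed

lemma P2D:
  assumes "\<mu> \<in> P2"
  shows "prob_space \<mu>" "sets \<mu> = sets borel" "space \<mu> = UNIV" "sqint \<mu> (\<lambda>x. x)"
  using assms by (auto simp: P2_def sqint_def space_borel_measure cong: measurable_cong_sets)

lemma transport_plans_rect:
  fixes \<gamma> :: "('a::euclidean_space \<times> 'a) measure"
  assumes \<gamma>: "\<gamma> \<in> transport_plans \<mu> \<sigma>"
  shows "A \<in> sets borel \<Longrightarrow> B \<in> sets borel \<Longrightarrow> A \<times> B \<in> sets \<gamma>"
    "A \<in> sets borel \<Longrightarrow> measure \<gamma> (A \<times> UNIV) = measure \<mu> A"
    "B \<in> sets borel \<Longrightarrow> measure \<gamma> (UNIV \<times> B) = measure \<sigma> B"
proof -
  note T = transport_plansD[OF \<gamma>]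
  show "A \<in> sets borel \<Longrightarrow> B \<in> sets borel \<Longrightarrow> A \<times> B \<in> sets \<gamma>"
    by (simp add: T(2) borel_prod[symmetric])
  show "A \<in> sets borel \<Longrightarrow> measure \<gamma> (A \<times> UNIV) = measure \<mu> A"
    unfolding T(4)[symmetric] using T by (subst measure_distr) (auto simp: vimage_fst)
  show "B \<in> sets borel \<Longrightarrow> measure \<gamma> (UNIV \<times> B) = measure \<sigma> B"
    unfolding T(5)[symmetric] using T by (subst measure_distr) (auto simp: vimage_snd)
qed

lemma measure_eqI_borel:
  assumes "prob_space M" "prob_space N" "sets M = sets borel" "sets N = sets borel"
    and "\<And>A. A \<in> sets borel \<Longrightarrow> measure M A = measure N A"
  shows "M = N"
  using assms by (intro measure_eqI)
    (auto simp: finite_measure.emeasure_eq_measure[OF prob_space.finite_measure])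

lemma transport_plans_rectI:
  fixes \<mu> \<sigma> :: "'a::euclidean_space measure"
  assumes \<mu>: "prob_space \<mu>" "sets \<mu> = sets borel" and \<sigma>: "prob_space \<sigma>" "sets \<sigma> = sets borel"
    and \<gamma>: "prob_space \<gamma>" "sets \<gamma> = sets borel"
    and marg1: "\<And>A. A \<in> sets borel \<Longrightarrow> measure \<gamma> (A \<times> UNIV) = measure \<mu> A"
    and marg2: "\<And>B. B \<in> sets borel \<Longrightarrow> measure \<gamma> (UNIV \<times> B) = measure \<sigma> B"
  shows "\<gamma> \<in> transport_plans \<mu> \<sigma>"
proof -
  have sp: "space \<gamma> = UNIV" using \<gamma>(2) by (rule space_borel_measure)
  have [measurable_cong]: "sets \<gamma> = sets (borel \<Otimes>\<^sub>M borel)"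
    unfolding borel_prod by (rule \<gamma>)
  have "measure (distr \<gamma> borel fst) A = measure \<mu> A" if "A \<in> sets borel" for A
    using that by (subst measure_distr) (auto simp: sp vimage_fst marg1)
  moreover have "measure (distr \<gamma> borel snd) B = measure \<sigma> B" if "B \<in> sets borel" for B
    using that by (subst measure_distr) (auto simp: sp vimage_snd marg2)
  ultimately show ?thesis
    unfolding transport_plans_def using \<gamma>
    by (auto intro!: measure_eqI_borel prob_space.prob_space_distr \<gamma> \<mu> \<sigma>)
qed

lemma transport_plans_cluster_point:
  fixes \<gamma> :: "nat \<Rightarrow> ('a::euclidean_space \<times> 'a) measure"
  assumes \<mu>: "prob_space \<mu>" "sets \<mu> = sets borel" and \<sigma>: "prob_space \<sigma>" "sets \<sigma> = sets borel"
    and \<gamma>: "\<And>n. \<gamma> n \<in> transport_plans \<mu> \<sigma>"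
  obtains \<gamma>' H where "\<gamma>' \<in> transport_plans \<mu> \<sigma>" "H \<noteq> bot" "H \<le> sequentially"
    "\<And>A B. A \<in> sets borel \<Longrightarrow> B \<in> sets borel \<Longrightarrow>
       ((\<lambda>n. measure (\<gamma> n) (A \<times> B)) \<longlongrightarrow> measure \<gamma>' (A \<times> B)) H"
proof -
  note T = transport_plansD[OF \<gamma>] and R = transport_plans_rect[OF \<gamma>]
  obtain l H where H: "H \<noteq> bot" "H \<le> sequentially"
    and l: "\<And>i. ((\<lambda>n. case i of (A, B) \<Rightarrow> measure (\<gamma> n) (A \<times> B)) \<longlongrightarrow> l i) H"
    by (rule cube_cluster_point[of "\<lambda>n (A, B). measure (\<gamma> n) (A \<times> B)"])
       (auto simp: prob_space.prob_le_1[OF T(1)])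
  have lim: "((\<lambda>n. measure (\<gamma> n) (A \<times> B)) \<longlongrightarrow> l (A, B)) H" for A B
    using l[of "(A, B)"] by simp
  have marg1: "l (A, UNIV) = measure \<mu> A" if "A \<in> sets borel" for A
    using lim[of A UNIV] H(1) by (simp add: R(2)[OF that] tendsto_const_iff)
  have marg2: "l (UNIV, B) = measure \<sigma> B" if "B \<in> sets borel" for B
    using lim[of UNIV B] H(1) by (simp add: R(3)[OF that] tendsto_const_iff)
  obtain k where k: "k \<in> borel \<rightarrow>\<^sub>M prob_algebra borel" "prob_space (kernel_prod \<mu> borel k)"
    "sets (kernel_prod \<mu> borel k) = sets borel"
    "\<And>A B. A \<in> sets borel \<Longrightarrow> B \<in> sets borel \<Longrightarrow> measure (kernel_prod \<mu> borel k) (A \<times> B) = l (A, B)"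
  \<comment> \<open>Identities between finitely many rectangle values survive the limit along H, and
    so do the marginals; countable additivity is not passed to the limit but recovered from
    domination.\<close>
  proof (rule bimeasure_extension[OF \<mu> \<sigma>, of "\<lambda>A B. l (A, B)"])
    show "0 \<le> l (A, B)" for A B
      by (rule tendsto_lowerbound[OF lim]) (auto simp: H)
  next
    fix A A' B :: "'a set" assume A: "A \<in> sets borel" "A' \<in> sets borel" "A \<inter> A' = {}" "B \<in> sets borel"
    have "measure (\<gamma> n) ((A \<union> A') \<times> B) = measure (\<gamma> n) (A \<times> B) + measure (\<gamma> n) (A' \<times> B)" for n
      unfolding Sigma_Un_distrib1 using A
      by (intro finite_measure.finite_measure_Union R prob_space.finite_measure T(1)) auto
    then show "l (A \<union> A', B) = l (A, B) + l (A', B)"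
      using tendsto_add[OF lim[of A B] lim[of A' B]] lim[of "A \<union> A'" B] tendsto_unique[OF H(1)] by simp
  next
    fix A B B' :: "'a set" assume A: "A \<in> sets borel" "B \<in> sets borel" "B' \<in> sets borel" "B \<inter> B' = {}"
    have "measure (\<gamma> n) (A \<times> (B \<union> B')) = measure (\<gamma> n) (A \<times> B) + measure (\<gamma> n) (A \<times> B')" for n
      unfolding Sigma_Un_distrib2 using A
      by (intro finite_measure.finite_measure_Union R prob_space.finite_measure T(1)) auto
    then show "l (A, B \<union> B') = l (A, B) + l (A, B')"
      using tendsto_add[OF lim[of A B] lim[of A B']] lim[of A "B \<union> B'"] tendsto_unique[OF H(1)] by simp
  qed (auto simp: marg1 marg2)
  define \<gamma>' where "\<gamma>' = kernel_prod \<mu> borel k"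
  note k' = k(2-4)[folded \<gamma>'_def]
  have "\<gamma>' \<in> transport_plans \<mu> \<sigma>"
    by (rule transport_plans_rectI[OF \<mu> \<sigma> k'(1,2)]) (simp_all add: k'(3) marg1 marg2)
  then show thesis
    by (rule that[OF _ H]) (use lim k' in simp)
qed

lemma transport_plans_sqint:
  fixes f g :: "'a::euclidean_space \<Rightarrow> 'a"
  assumes \<gamma>: "\<gamma> \<in> transport_plans \<mu> \<sigma>"
  shows "sqint \<mu> f \<Longrightarrow> sqint \<gamma> (\<lambda>z. f (fst z))" "sqint \<mu> f \<Longrightarrow> nrm \<gamma> (\<lambda>z. f (fst z)) = nrm \<mu> f"
    "sqint \<sigma> g \<Longrightarrow> sqint \<gamma> (\<lambda>z. g (snd z))" "sqint \<sigma> g \<Longrightarrow> nrm \<gamma> (\<lambda>z. g (snd z)) = nrm \<sigma> g"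
proof -
  note T = transport_plansD[OF \<gamma>]
  have "f \<in> borel_measurable borel" if "sqint \<mu> f"
    using that unfolding T(4)[symmetric] sqint_def by simp
  then show "sqint \<mu> f \<Longrightarrow> sqint \<gamma> (\<lambda>z. f (fst z))" "sqint \<mu> f \<Longrightarrow> nrm \<gamma> (\<lambda>z. f (fst z)) = nrm \<mu> f"
    using sqint_distr[OF T(6)] nrm_distr[OF T(6)] unfolding T(4) by metis+
  have "g \<in> borel_measurable borel" if "sqint \<sigma> g"
    using that unfolding T(5)[symmetric] sqint_def by simp
  then show "sqint \<sigma> g \<Longrightarrow> sqint \<gamma> (\<lambda>z. g (snd z))" "sqint \<sigma> g \<Longrightarrow> nrm \<gamma> (\<lambda>z. g (snd z)) = nrm \<sigma> g"
    using sqint_distr[OF T(7)] nrm_distr[OF T(7)] unfolding T(5) by metis+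
qed

lemma transport_plans_inner_bound:
  fixes f g :: "'a::euclidean_space \<Rightarrow> 'a"
  assumes \<gamma>: "\<gamma> \<in> transport_plans \<mu> \<sigma>" and "sqint \<mu> f" "sqint \<sigma> g"
  shows "integrable \<gamma> (\<lambda>z. f (fst z) \<bullet> g (snd z))"
    "\<bar>\<integral>z. f (fst z) \<bullet> g (snd z) \<partial>\<gamma>\<bar> \<le> nrm \<mu> f * nrm \<sigma> g"
  using sqint_inner[OF transport_plans_sqint(1,3)[OF \<gamma>], of f g]
    sqint_Cauchy_Schwarz[OF transport_plans_sqint(1,3)[OF \<gamma>], of f g]
    transport_plans_sqint(2,4)[OF \<gamma>] assms(2,3) by auto

lemma transport_plans_inner_simple:
  fixes s t :: "'a::euclidean_space \<Rightarrow> 'a"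
  assumes \<gamma>: "\<gamma> \<in> transport_plans \<mu> \<sigma>" and s: "simple_function \<mu> s" and t: "simple_function \<sigma> t"
  shows "(\<integral>z. s (fst z) \<bullet> t (snd z) \<partial>\<gamma>) =
    (\<Sum>a\<in>range s. \<Sum>b\<in>range t. measure \<gamma> ((s -` {a}) \<times> (t -` {b})) * (a \<bullet> b))"
proof -
  note T = transport_plansD[OF \<gamma>]
  have sp: "space \<mu> = UNIV" "space \<sigma> = UNIV" "sets \<mu> = sets borel" "sets \<sigma> = sets borel"
    using T(4,5) by auto
  have fin: "finite (range s)" "finite (range t)"
    using simple_functionD(1)[OF s] simple_functionD(1)[OF t] by (auto simp: sp)
  have lev: "s -` {a} \<in> sets borel" "t -` {a} \<in> sets borel" for a
    using simple_functionD(2)[OF s, of "{a}"] simple_functionD(2)[OF t, of "{a}"] by (auto simp: sp)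
  have rect: "(s -` {a}) \<times> (t -` {b}) \<in> sets \<gamma>" for a b
    by (rule transport_plans_rect(1)[OF \<gamma> lev])
  have eq: "s (fst z) \<bullet> t (snd z) =
    (\<Sum>a\<in>range s. \<Sum>b\<in>range t. indicator ((s -` {a}) \<times> (t -` {b})) z * (a \<bullet> b))" for z
    by (subst simple_function_sum_level_sets[OF fin(1)], subst simple_function_sum_level_sets[OF fin(2)])
       (subst inner_sum_left, subst inner_sum_right, intro sum.cong refl, simp add: indicator_times mult_ac)
  have int: "integrable \<gamma> (\<lambda>z. indicator ((s -` {a}) \<times> (t -` {b})) z * (a \<bullet> b))" for a b
    using rect by (simp add: finite_measure.emeasure_finite[OF prob_space.finite_measure[OF T(1)]] less_top[symmetric])
  have "(\<integral>z. s (fst z) \<bullet> t (snd z) \<partial>\<gamma>) =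
    (\<integral>z. (\<Sum>a\<in>range s. \<Sum>b\<in>range t. indicator ((s -` {a}) \<times> (t -` {b})) z * (a \<bullet> b)) \<partial>\<gamma>)"
    by (rule Bochner_Integration.integral_cong[OF refl eq])
  also have "\<dots> = (\<Sum>a\<in>range s. \<integral>z. (\<Sum>b\<in>range t. indicator ((s -` {a}) \<times> (t -` {b})) z * (a \<bullet> b)) \<partial>\<gamma>)"
    by (rule Bochner_Integration.integral_sum) (intro Bochner_Integration.integrable_sum int)
  also have "\<dots> = (\<Sum>a\<in>range s. \<Sum>b\<in>range t. \<integral>z. indicator ((s -` {a}) \<times> (t -` {b})) z * (a \<bullet> b) \<partial>\<gamma>)"
    by (intro sum.cong refl Bochner_Integration.integral_sum int)
  also have "\<dots> = (\<Sum>a\<in>range s. \<Sum>b\<in>range t. measure \<gamma> ((s -` {a}) \<times> (t -` {b})) * (a \<bullet> b))"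
    using rect by (intro sum.cong refl) simp
  finally show ?thesis .
qed

text \<open>With both marginals fixed, replacing f and g by simple functions changes the integral by
  an amount controlled by L2 errors under \<mu> and \<sigma> alone, hence uniformly over plans. For
  simple functions the integral is a finite combination of rectangle values.\<close>

lemma transport_plans_inner_tendsto:
  fixes f g :: "'a::euclidean_space \<Rightarrow> 'a"
  assumes \<gamma>: "\<And>n. \<gamma> n \<in> transport_plans \<mu> \<sigma>" and \<gamma>': "\<gamma>' \<in> transport_plans \<mu> \<sigma>"
    and lim: "\<And>A B. A \<in> sets borel \<Longrightarrow> B \<in> sets borel \<Longrightarrow>
       ((\<lambda>n. measure (\<gamma> n) (A \<times> B)) \<longlongrightarrow> measure \<gamma>' (A \<times> B)) H"
    and f: "sqint \<mu> f" and g: "sqint \<sigma> g"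
  shows "((\<lambda>n. \<integral>z. f (fst z) \<bullet> g (snd z) \<partial>\<gamma> n) \<longlongrightarrow> (\<integral>z. f (fst z) \<bullet> g (snd z) \<partial>\<gamma>')) H"
proof (rule tendstoI)
  fix e :: real assume "0 < e"
  have sp: "space \<mu> = UNIV" "space \<sigma> = UNIV" "sets \<mu> = sets borel" "sets \<sigma> = sets borel"
    using transport_plansD(4,5)[OF \<gamma>'] by auto
  define c where "c = nrm \<mu> f + nrm \<sigma> g + 1"
  have c: "0 < c" unfolding c_def using nrm_nonneg[of \<mu> f] nrm_nonneg[of \<sigma> g] by linarith
  \<comment> \<open>The two replacement errors add up to at most d * nrm \<sigma> g + (nrm \<mu> f +
    d) * d, which is at most d * c for d at most 1. The resulting e / 4 is spent once for
    \<open>\<gamma> n\<close> and once for \<gamma>'.\<close>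
  define d where "d = min 1 (e / (4 * c))"
  have d: "0 < d" "d \<le> 1" "d * c \<le> e / 4"
    using \<open>0 < e\<close> c by (auto simp: d_def min_def field_simps)
  obtain s where s: "simple_function \<mu> s" "sqint \<mu> s" "nrm \<mu> (\<lambda>x. f x - s x) < d"
    using sqint_simple_approx[OF f d(1)] by auto
  obtain t where t: "simple_function \<sigma> t" "sqint \<sigma> t" "nrm \<sigma> (\<lambda>x. g x - t x) < d"
    using sqint_simple_approx[OF g d(1)] by auto
  define I where "I \<gamma> = (\<integral>z. f (fst z) \<bullet> g (snd z) \<partial>\<gamma>)" for \<gamma>
  define J where "J \<gamma> = (\<integral>z. s (fst z) \<bullet> t (snd z) \<partial>\<gamma>)" for \<gamma>
  have close: "\<bar>I \<gamma> - J \<gamma>\<bar> \<le> e / 4" if \<gamma>: "\<gamma> \<in> transport_plans \<mu> \<sigma>" for \<gamma>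
  proof -
    note B = transport_plans_inner_bound[OF \<gamma>]
    have "nrm \<mu> (\<lambda>x. f x + (s x - f x)) \<le> nrm \<mu> f + nrm \<mu> (\<lambda>x. s x - f x)"
      by (rule nrm_triangle[OF f sqint_diff[OF s(2) f]])
    then have ns: "nrm \<mu> s \<le> nrm \<mu> f + d"
      using s(3) nrm_diff_commute[of \<mu> f s] by simp
    have "I \<gamma> - J \<gamma> = (\<integral>z. (f (fst z) - s (fst z)) \<bullet> g (snd z) \<partial>\<gamma>) + (\<integral>z. s (fst z) \<bullet> (g (snd z) - t (snd z)) \<partial>\<gamma>)"
      unfolding I_def J_def using B(1)[OF f g] B(1)[OF s(2) g] B(1)[OF s(2) t(2)]
      by (simp add: inner_diff_left inner_diff_right)
    also have "\<bar>\<dots>\<bar> \<le> nrm \<mu> (\<lambda>x. f x - s x) * nrm \<sigma> g + nrm \<mu> s * nrm \<sigma> (\<lambda>x. g x - t x)"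
      using B(2)[OF sqint_diff[OF f s(2)] g] B(2)[OF s(2) sqint_diff[OF g t(2)]] by linarith
    also have "\<dots> \<le> d * nrm \<sigma> g + (nrm \<mu> f + d) * d"
      using s(3) t(3) ns by (intro add_mono mult_mono) (auto simp: nrm_nonneg d(1) less_imp_le add_nonneg_nonneg)
    also have "\<dots> \<le> d * c"
      using d(1,2) by (simp add: c_def algebra_simps mult_left_le)
    finally show ?thesis using d(3) by linarith
  qed
  have lev: "s -` {a} \<in> sets borel" "t -` {a} \<in> sets borel" for a
    using simple_functionD(2)[OF s(1), of "{a}"] simple_functionD(2)[OF t(1), of "{a}"] by (auto simp: sp)
  have "((\<lambda>n. J (\<gamma> n)) \<longlongrightarrow> J \<gamma>') H"
    unfolding J_def transport_plans_inner_simple[OF \<gamma> s(1) t(1)] transport_plans_inner_simple[OF \<gamma>' s(1) t(1)]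
    by (intro tendsto_intros lim lev)
  then have "eventually (\<lambda>n. dist (J (\<gamma> n)) (J \<gamma>') < e / 4) H"
    using \<open>0 < e\<close> by (intro tendstoD) auto
  then show "eventually (\<lambda>n. dist (I (\<gamma> n)) (I \<gamma>') < e) H"
  proof eventually_elim
    case (elim n)
    with close[OF \<gamma>[of n]] close[OF \<gamma>'] \<open>0 < e\<close> show ?case
      unfolding dist_real_def by linarith
  qed
qed

section \<open>Existence of optimal plans and compactness of nearly optimal ones\<close>

lemma transport_cost_eq:
  assumes \<mu>: "\<mu> \<in> P2" and \<sigma>: "\<sigma> \<in> P2" and \<gamma>: "\<gamma> \<in> transport_plans \<mu> \<sigma>"
  shows "transport_cost \<gamma> = (nrm \<mu> (\<lambda>x. x))\<^sup>2 + (nrm \<sigma> (\<lambda>x. x))\<^sup>2 - 2 * (\<integral>z. fst z \<bullet> snd z \<partial>\<gamma>)"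
proof -
  note S = transport_plans_sqint[OF \<gamma>]
  have f: "sqint \<gamma> fst" "nrm \<gamma> fst = nrm \<mu> (\<lambda>x. x)" and g: "sqint \<gamma> snd" "nrm \<gamma> snd = nrm \<sigma> (\<lambda>x. x)"
    using S(1,2)[OF P2D(4)[OF \<mu>]] S(3,4)[OF P2D(4)[OF \<sigma>]] by auto
  have "transport_cost \<gamma> = (nrm \<gamma> (\<lambda>z. fst z + (-1) *\<^sub>R snd z))\<^sup>2"
    by (simp add: transport_cost_def nrm_square)
  also have "\<dots> = (nrm \<mu> (\<lambda>x. x))\<^sup>2 - 2 * (\<integral>z. fst z \<bullet> snd z \<partial>\<gamma>) + (nrm \<sigma> (\<lambda>x. x))\<^sup>2"
    by (subst nrm_square_add[OF f(1) sqint_scaleR[OF g(1)]])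
       (use nrm_scaleR[of \<gamma> "-1" snd] f g in simp)
  finally show ?thesis by simp
qed

lemma pair_measure_transport_plan:
  fixes \<mu> \<sigma> :: "'a::euclidean_space measure"
  assumes \<mu>: "prob_space \<mu>" "sets \<mu> = sets borel" and \<sigma>: "prob_space \<sigma>" "sets \<sigma> = sets borel"
  shows "\<mu> \<Otimes>\<^sub>M \<sigma> \<in> transport_plans \<mu> \<sigma>"
proof -
  interpret P: pair_prob_space \<mu> \<sigma>
    using \<mu>(1) \<sigma>(1) by (simp add: pair_prob_space_def pair_sigma_finite_def prob_space_imp_sigma_finite)
  have sets: "sets (\<mu> \<Otimes>\<^sub>M \<sigma>) = sets borel"
    unfolding borel_prod[symmetric] by (rule sets_pair_measure_cong) (auto simp: \<mu> \<sigma>)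
  have Times: "emeasure (\<mu> \<Otimes>\<^sub>M \<sigma>) (A \<times> B) = emeasure \<mu> A * emeasure \<sigma> B"
    if "A \<in> sets borel" "B \<in> sets borel" for A B
    using that by (intro P.M2.emeasure_pair_measure_Times) (auto simp: \<mu> \<sigma>)
  have one: "emeasure \<mu> UNIV = 1" "emeasure \<sigma> UNIV = 1"
    using P.M1.emeasure_space_1 P.M2.emeasure_space_1 \<mu> \<sigma> by (simp_all add: space_borel_measure)
  show ?thesis
    by (rule transport_plans_rectI[OF \<mu> \<sigma> P.prob_space_axioms sets])
       (simp_all add: measure_def Times one)
qed

lemma W2_square:
  assumes "\<mu> \<in> P2" "\<sigma> \<in> P2"
  shows "(W2 \<mu> \<sigma>)\<^sup>2 = (INF \<gamma>\<in>transport_plans \<mu> \<sigma>. transport_cost \<gamma>)"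
    and "\<gamma> \<in> transport_plans \<mu> \<sigma> \<Longrightarrow> (W2 \<mu> \<sigma>)\<^sup>2 \<le> transport_cost \<gamma>"
    and "0 < e \<Longrightarrow> \<exists>\<gamma>\<in>transport_plans \<mu> \<sigma>. transport_cost \<gamma> < (W2 \<mu> \<sigma>)\<^sup>2 + e"
    and "0 \<le> W2 \<mu> \<sigma>"
proof -
  have ne: "transport_plans \<mu> \<sigma> \<noteq> {}"
    using pair_measure_transport_plan[OF P2D(1,2)[OF assms(1)] P2D(1,2)[OF assms(2)]] by auto
  have nn: "0 \<le> transport_cost \<gamma>" for \<gamma> :: "('a \<times> 'a) measure"
    by (simp add: transport_cost_def)
  have bdd: "bdd_below (transport_cost ` transport_plans \<mu> \<sigma>)"
    by (rule bdd_belowI2[OF nn])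
  have inn: "0 \<le> (INF \<gamma>\<in>transport_plans \<mu> \<sigma>. transport_cost \<gamma>)"
    by (rule cINF_greatest[OF ne nn])
  show eq: "(W2 \<mu> \<sigma>)\<^sup>2 = (INF \<gamma>\<in>transport_plans \<mu> \<sigma>. transport_cost \<gamma>)"
    unfolding W2_def using inn by simp
  show "0 \<le> W2 \<mu> \<sigma>" unfolding W2_def using inn by simp
  show "\<gamma> \<in> transport_plans \<mu> \<sigma> \<Longrightarrow> (W2 \<mu> \<sigma>)\<^sup>2 \<le> transport_cost \<gamma>"
    unfolding eq by (rule cINF_lower[OF bdd])
  show "0 < e \<Longrightarrow> \<exists>\<gamma>\<in>transport_plans \<mu> \<sigma>. transport_cost \<gamma> < (W2 \<mu> \<sigma>)\<^sup>2 + e"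
    unfolding eq using cINF_less_iff[OF ne bdd] by (metis less_add_same_cancel1)
qed

lemma optimal_plans_iff:
  assumes "\<mu> \<in> P2" "\<sigma> \<in> P2"
  shows "\<gamma> \<in> optimal_plans \<mu> \<sigma> \<longleftrightarrow> \<gamma> \<in> transport_plans \<mu> \<sigma> \<and> transport_cost \<gamma> = (W2 \<mu> \<sigma>)\<^sup>2"
proof -
  have "transport_cost \<gamma> = (W2 \<mu> \<sigma>)\<^sup>2" if "\<gamma> \<in> optimal_plans \<mu> \<sigma>"
  proof (rule antisym)
    show "transport_cost \<gamma> \<le> (W2 \<mu> \<sigma>)\<^sup>2"
    proof (rule field_le_epsilon)
      fix e :: real assume "0 < e"
      with W2_square(3)[OF assms] that show "transport_cost \<gamma> \<le> (W2 \<mu> \<sigma>)\<^sup>2 + e"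
        by (fastforce simp: optimal_plans_def)
    qed
    show "(W2 \<mu> \<sigma>)\<^sup>2 \<le> transport_cost \<gamma>"
      using that by (intro W2_square(2)[OF assms]) (simp add: optimal_plans_def)
  qed
  then show ?thesis
    using W2_square(2)[OF assms] by (auto simp: optimal_plans_def)
qed

text \<open>Convergence of the pairings for all f and g is exported because the cost and the
  displacement pairings are affine functions of such integrals.\<close>

lemma nearly_optimal_plans_cluster_point:
  fixes \<gamma> :: "nat \<Rightarrow> ('a::euclidean_space \<times> 'a) measure"
  assumes \<mu>: "\<mu> \<in> P2" and \<sigma>: "\<sigma> \<in> P2"
    and \<gamma>: "\<And>n. \<gamma> n \<in> transport_plans \<mu> \<sigma>"
    and cost: "\<And>n. transport_cost (\<gamma> n) \<le> (W2 \<mu> \<sigma>)\<^sup>2 + 1 / real (Suc n)"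
  obtains \<gamma>' H where "\<gamma>' \<in> optimal_plans \<mu> \<sigma>" "H \<noteq> bot"
    "\<And>f g :: 'a \<Rightarrow> 'a. sqint \<mu> f \<Longrightarrow> sqint \<sigma> g \<Longrightarrow>
       ((\<lambda>n. \<integral>z. f (fst z) \<bullet> g (snd z) \<partial>\<gamma> n) \<longlongrightarrow> (\<integral>z. f (fst z) \<bullet> g (snd z) \<partial>\<gamma>')) H"
proof -
  obtain \<gamma>' H where \<gamma>': "\<gamma>' \<in> transport_plans \<mu> \<sigma>" and H: "H \<noteq> bot" "H \<le> sequentially"
    and lim: "\<And>A B. A \<in> sets borel \<Longrightarrow> B \<in> sets borel \<Longrightarrow>
       ((\<lambda>n. measure (\<gamma> n) (A \<times> B)) \<longlongrightarrow> measure \<gamma>' (A \<times> B)) H"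
    by (rule transport_plans_cluster_point[where \<gamma>=\<gamma>, OF P2D(1,2)[OF \<mu>] P2D(1,2)[OF \<sigma>] \<gamma>]) blast
  note lim' = transport_plans_inner_tendsto[OF \<gamma> \<gamma>' lim]
  have lim_cost: "((\<lambda>n. transport_cost (\<gamma> n)) \<longlongrightarrow> transport_cost \<gamma>') H"
    unfolding transport_cost_eq[OF \<mu> \<sigma> \<gamma>] transport_cost_eq[OF \<mu> \<sigma> \<gamma>']
    by (intro tendsto_intros lim' P2D(4) \<mu> \<sigma>)
  have "((\<lambda>n. (W2 \<mu> \<sigma>)\<^sup>2 + 1 / real (Suc n)) \<longlongrightarrow> (W2 \<mu> \<sigma>)\<^sup>2 + 0) H"
    by (intro tendsto_intros tendsto_mono[OF H(2) LIMSEQ_Suc[OF lim_1_over_n]])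
  from this lim_cost have "transport_cost \<gamma>' \<le> (W2 \<mu> \<sigma>)\<^sup>2 + 0"
    by (rule tendsto_le[OF H(1)]) (rule always_eventually, rule allI, rule cost)
  then have "transport_cost \<gamma>' = (W2 \<mu> \<sigma>)\<^sup>2"
    using W2_square(2)[OF \<mu> \<sigma> \<gamma>'] by linarith
  with \<gamma>' have "\<gamma>' \<in> optimal_plans \<mu> \<sigma>"
    unfolding optimal_plans_iff[OF \<mu> \<sigma>] by blast
  then show thesis by (rule that[OF _ H(1) lim'])
qed

lemma optimal_plans_nonempty:
  assumes \<mu>: "\<mu> \<in> P2" and \<sigma>: "\<sigma> \<in> P2"
  obtains \<gamma> where "\<gamma> \<in> optimal_plans \<mu> \<sigma>"
proof -
  have "\<exists>\<gamma>\<in>transport_plans \<mu> \<sigma>. transport_cost \<gamma> < (W2 \<mu> \<sigma>)\<^sup>2 + 1 / real (Suc n)" for n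
    by (rule W2_square(3)[OF assms]) simp
  then obtain \<gamma> where "\<And>n. \<gamma> n \<in> transport_plans \<mu> \<sigma>"
    "\<And>n. transport_cost (\<gamma> n) \<le> (W2 \<mu> \<sigma>)\<^sup>2 + 1 / real (Suc n)"
    by (metis less_imp_le)
  from nearly_optimal_plans_cluster_point[OF assms this] that show thesis by blast
qed

text \<open>Uniformity by compactness: plans with excess cost at most 1/(n+1) and pairing at most c
  - e accumulate at an optimal plan, whose pairing is then at most c - e, against the bound
  c.\<close>

lemma nearly_optimal_plans_bound:
  fixes f :: "'a::euclidean_space \<Rightarrow> 'a"
  assumes \<mu>: "\<mu> \<in> P2" and \<sigma>: "\<sigma> \<in> P2" and f: "sqint \<mu> f" and "0 < e"
    and bound: "\<And>\<gamma>. \<gamma> \<in> optimal_plans \<mu> \<sigma> \<Longrightarrow> c \<le> (\<integral>z. f (fst z) \<bullet> snd z \<partial>\<gamma>)"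
  shows "\<exists>d>0. \<forall>\<gamma>\<in>transport_plans \<mu> \<sigma>. transport_cost \<gamma> \<le> (W2 \<mu> \<sigma>)\<^sup>2 + d \<longrightarrow>
    c - e \<le> (\<integral>z. f (fst z) \<bullet> snd z \<partial>\<gamma>)"
proof (rule ccontr)
  assume "\<not> ?thesis"
  then have "\<exists>\<gamma>\<in>transport_plans \<mu> \<sigma>. transport_cost \<gamma> \<le> (W2 \<mu> \<sigma>)\<^sup>2 + 1 / real (Suc n) \<and>
    (\<integral>z. f (fst z) \<bullet> snd z \<partial>\<gamma>) \<le> c - e" for n
    by (metis linear of_nat_0_less_iff zero_less_Suc zero_less_divide_1_iff)
  then obtain \<gamma> where \<gamma>: "\<And>n. \<gamma> n \<in> transport_plans \<mu> \<sigma>"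
    "\<And>n. transport_cost (\<gamma> n) \<le> (W2 \<mu> \<sigma>)\<^sup>2 + 1 / real (Suc n)"
    "\<And>n. (\<integral>z. f (fst z) \<bullet> snd z \<partial>\<gamma> n) \<le> c - e"
    by metis
  obtain \<gamma>' H where \<gamma>': "\<gamma>' \<in> optimal_plans \<mu> \<sigma>" "H \<noteq> bot"
    and lim: "\<And>f g :: 'a \<Rightarrow> 'a. sqint \<mu> f \<Longrightarrow> sqint \<sigma> g \<Longrightarrow>
       ((\<lambda>n. \<integral>z. f (fst z) \<bullet> g (snd z) \<partial>\<gamma> n) \<longlongrightarrow> (\<integral>z. f (fst z) \<bullet> g (snd z) \<partial>\<gamma>')) H"
    by (rule nearly_optimal_plans_cluster_point[where \<gamma>=\<gamma>, OF \<mu> \<sigma> \<gamma>(1,2)]) blast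
  have "(\<integral>z. f (fst z) \<bullet> snd z \<partial>\<gamma>') \<le> c - e"
    by (rule tendsto_upperbound[OF lim[OF f P2D(4)[OF \<sigma>]]]) (auto simp: \<gamma> \<gamma>')
  with bound[OF \<gamma>'(1)] \<open>0 < e\<close> show False by linarith
qed

section \<open>Gluing and stability\<close>

lemma transport_plansI:
  assumes "prob_space M" and "f \<in> M \<rightarrow>\<^sub>M borel" "g \<in> M \<rightarrow>\<^sub>M borel"
    and "distr M borel f = \<mu>" "distr M borel g = \<sigma>"
  shows "distr M borel (\<lambda>z. (f z, g z)) \<in> transport_plans \<mu> \<sigma>"
proof -
  have m[measurable]: "f \<in> M \<rightarrow>\<^sub>M borel" "g \<in> M \<rightarrow>\<^sub>M borel" by fact+
  have p[measurable]: "(\<lambda>z. (f z, g z)) \<in> M \<rightarrow>\<^sub>M borel"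
    unfolding borel_prod[symmetric] by measurable
  have fs: "fst \<in> borel \<rightarrow>\<^sub>M borel" "snd \<in> borel \<rightarrow>\<^sub>M borel"
    by (intro borel_measurable_continuous_onI continuous_intros)+
  show ?thesis
    unfolding transport_plans_def
    using assms(1,4,5) distr_distr[OF fs(1) p] distr_distr[OF fs(2) p]
    by (auto simp: comp_def intro!: prob_space.prob_space_distr)
qed

lemma transport_cost_distr_Pair:
  assumes [measurable]: "f \<in> M \<rightarrow>\<^sub>M borel" "g \<in> M \<rightarrow>\<^sub>M borel"
  shows "transport_cost (distr M borel (\<lambda>z. (f z, g z))) = (nrm M (\<lambda>z. f z - g z))\<^sup>2"
proof -
  have p: "(\<lambda>z. (f z, g z)) \<in> M \<rightarrow>\<^sub>M borel"
    unfolding borel_prod[symmetric] by measurable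
  have c: "(\<lambda>z. (norm (fst z - snd z))\<^sup>2) \<in> borel \<rightarrow>\<^sub>M (borel :: real measure)"
    by (intro borel_measurable_continuous_onI continuous_intros)
  show ?thesis
    unfolding transport_cost_def nrm_square by (subst integral_distr[OF p c]) simp
qed

text \<open>The glued measure is \<pi>(dx,dx') \<gamma>_x(dy): given x, the points x' and y are
  drawn independently. Disintegrating \<gamma> alone accounts for the order ((x,x'),y).\<close>

lemma transport_plans_gluing:
  fixes \<nu> \<mu> \<sigma> :: "'a::euclidean_space measure"
  assumes \<pi>: "\<pi> \<in> transport_plans \<nu> \<mu>" and \<gamma>: "\<gamma> \<in> transport_plans \<nu> \<sigma>"
  obtains \<omega> :: "(('a \<times> 'a) \<times> 'a) measure" where "prob_space \<omega>" "sets \<omega> = sets borel"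
    "distr \<omega> borel fst = \<pi>" "distr \<omega> borel (\<lambda>z. (fst (fst z), snd z)) = \<gamma>"
proof -
  note P = transport_plansD[OF \<pi>] and G = transport_plansD[OF \<gamma>]
  define k where "k = disintegration \<gamma>"
  have "is_disintegration \<gamma> k"
    unfolding k_def by (rule is_disintegration_disintegration[OF G(1,2)])
  then have k[measurable]: "k \<in> borel \<rightarrow>\<^sub>M prob_algebra borel"
    and kA: "\<And>A. A \<in> sets borel \<Longrightarrow> emeasure \<gamma> A = (\<integral>\<^sup>+x. emeasure (k x) {y. (x, y) \<in> A} \<partial>\<nu>)"
    unfolding is_disintegration_def G(4) by auto
  have kp: "(\<lambda>p. k (fst p)) \<in> \<pi> \<rightarrow>\<^sub>M prob_algebra borel"
    using P(6) by measurable
  define \<omega> where "\<omega> = kernel_prod \<pi> borel (\<lambda>p. k (fst p))"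
  have sets': "sets (\<pi> \<Otimes>\<^sub>M borel) = sets (borel :: (('a \<times> 'a) \<times> 'a) measure)"
    unfolding borel_prod[symmetric, where 'a="'a \<times> 'a" and 'b='a]
    by (rule sets_pair_measure_cong) (auto simp: P)
  have sets: "sets \<omega> = sets borel"
    unfolding \<omega>_def sets_kernel_prod[OF P(1) kp] by (rule sets')
  have sp: "space \<omega> = UNIV" by (rule space_borel_measure[OF sets])
  have fs[measurable]: "fst \<in> borel \<rightarrow>\<^sub>M (borel :: ('a \<times> 'a) measure)" "fst \<in> borel \<rightarrow>\<^sub>M (borel :: 'a measure)"
    "snd \<in> (borel :: (('a \<times> 'a) \<times> 'a) measure) \<rightarrow>\<^sub>M (borel :: 'a measure)"
    by (auto intro!: borel_measurable_continuous_onI continuous_intros)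
  have q: "(\<lambda>z::('a \<times> 'a) \<times> 'a. (fst (fst z), snd z)) \<in> borel \<rightarrow>\<^sub>M borel"
    by (intro borel_measurable_continuous_onI continuous_intros)
  show thesis
  proof (rule that)
    show "prob_space \<omega>" unfolding \<omega>_def by (rule prob_space_kernel_prod[OF P(1) kp])
    show "sets \<omega> = sets borel" by (rule sets)
    have "distr \<omega> borel fst = distr \<omega> \<pi> fst"
      by (rule distr_cong) (auto simp: P)
    then show "distr \<omega> borel fst = \<pi>"
      unfolding \<omega>_def distr_kernel_prod_fst[OF P(1) kp] by simp
    show "distr \<omega> borel (\<lambda>z. (fst (fst z), snd z)) = \<gamma>"
    proof (rule measure_eqI)
      fix A assume "A \<in> sets (distr \<omega> borel (\<lambda>z. (fst (fst z), snd z)))"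
      then have A: "A \<in> sets borel" by simp
      let ?B = "(\<lambda>z. (fst (fst z), snd z)) -` A :: (('a \<times> 'a) \<times> 'a) set"
      have B: "?B \<in> sets borel"
        using measurable_sets[OF q A] by simp
      have "emeasure (distr \<omega> borel (\<lambda>z. (fst (fst z), snd z))) A = emeasure \<omega> ?B"
        using q A by (subst emeasure_distr) (auto simp: sp sets cong: measurable_cong_sets)
      also have "\<dots> = (\<integral>\<^sup>+p. emeasure (k (fst p)) (Pair p -` ?B) \<partial>\<pi>)"
        unfolding \<omega>_def by (rule emeasure_kernel_prod[OF P(1) kp]) (simp add: sets' B)
      also have "\<dots> = (\<integral>\<^sup>+p. emeasure (k (fst p)) {y. (fst p, y) \<in> A} \<partial>\<pi>)"
        by (simp add: vimage_def)
      also have "\<dots> = (\<integral>\<^sup>+x. emeasure (k x) {y. (x, y) \<in> A} \<partial>\<nu>)"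
      proof -
        have "(\<lambda>x. emeasure (k x) {y. (x, y) \<in> A}) \<in> borel_measurable borel"
        proof (rule emeasure_measurable_subprob_algebra2[where N=borel])
          have "(SIGMA x:space borel. {y. (x, y) \<in> A}) = A" by auto
          then show "(SIGMA x:space borel. {y. (x, y) \<in> A}) \<in> sets (borel \<Otimes>\<^sub>M borel)"
            unfolding borel_prod using A by simp
        qed (rule measurable_prob_algebraD[OF k])
        then show ?thesis
          unfolding P(4)[symmetric] by (subst nn_integral_distr[OF P(6)]) auto
      qed
      also have "\<dots> = emeasure \<gamma> A" by (rule kA[OF A, symmetric])
      finally show "emeasure (distr \<omega> borel (\<lambda>z. (fst (fst z), snd z))) A = emeasure \<gamma> A" .
    qed (simp add: G)
  qed
qed

text \<open>Passing from a measure on triples to random variables X, X', Y turns transport costs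
  into squares of \<open>nrm\<close> of differences, so that the Minkowski inequality
  applies.\<close>

lemma transport_plans_coupling:
  fixes \<nu> \<mu> \<sigma> :: "'a::euclidean_space measure"
  assumes \<pi>: "\<pi> \<in> transport_plans \<nu> \<mu>" and \<gamma>: "\<gamma> \<in> transport_plans \<nu> \<sigma>"
  obtains \<omega> :: "(('a \<times> 'a) \<times> 'a) measure" and X X' Y where "prob_space \<omega>"
    "X \<in> \<omega> \<rightarrow>\<^sub>M borel" "X' \<in> \<omega> \<rightarrow>\<^sub>M borel" "Y \<in> \<omega> \<rightarrow>\<^sub>M borel"
    "distr \<omega> borel X = \<nu>" "distr \<omega> borel X' = \<mu>" "distr \<omega> borel Y = \<sigma>"
    "distr \<omega> borel (\<lambda>z. (X z, X' z)) = \<pi>" "distr \<omega> borel (\<lambda>z. (X z, Y z)) = \<gamma>"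
    "distr \<omega> borel (\<lambda>z. (X' z, Y z)) \<in> transport_plans \<mu> \<sigma>"
proof -
  note P = transport_plansD[OF \<pi>] and G = transport_plansD[OF \<gamma>]
  obtain \<omega> :: "(('a \<times> 'a) \<times> 'a) measure" where \<omega>: "prob_space \<omega>" "sets \<omega> = sets borel"
    "distr \<omega> borel fst = \<pi>" "distr \<omega> borel (\<lambda>z. (fst (fst z), snd z)) = \<gamma>"
    by (rule transport_plans_gluing[OF \<pi> \<gamma>])
  have [measurable_cong]: "sets \<omega> = sets borel" by fact
  have m: "fst \<in> \<omega> \<rightarrow>\<^sub>M borel" "(\<lambda>z. fst (fst z)) \<in> \<omega> \<rightarrow>\<^sub>M borel" "(\<lambda>z. snd (fst z)) \<in> \<omega> \<rightarrow>\<^sub>M borel"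
    "snd \<in> \<omega> \<rightarrow>\<^sub>M borel" "(\<lambda>z. (fst (fst z), snd z)) \<in> \<omega> \<rightarrow>\<^sub>M borel"
    by (simp_all cong: measurable_cong_sets add: \<omega>(2))
       (intro borel_measurable_continuous_onI continuous_intros)+
  have fs: "fst \<in> borel \<rightarrow>\<^sub>M (borel :: 'a measure)" "snd \<in> borel \<rightarrow>\<^sub>M (borel :: 'a measure)"
    by (intro borel_measurable_continuous_onI continuous_intros)+
  have X: "distr \<omega> borel (\<lambda>z. fst (fst z)) = \<nu>"
    using distr_distr[OF fs(1) m(1)] by (simp add: \<omega> P comp_def)
  have X': "distr \<omega> borel (\<lambda>z. snd (fst z)) = \<mu>"
    using distr_distr[OF fs(2) m(1)] by (simp add: \<omega> P comp_def)
  have Y: "distr \<omega> borel snd = \<sigma>"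
    using distr_distr[OF fs(2) m(5)] by (simp add: \<omega> G comp_def)
  show thesis
    by (rule that[OF \<omega>(1) m(2,3,4) X X' Y _ _ transport_plansI[OF \<omega>(1) m(3,4) X' Y]])
       (simp_all add: \<omega>)
qed

lemma P2I_distr:
  assumes "prob_space M" "sqint M f"
  shows "distr M borel f \<in> P2"
proof -
  have [measurable]: "f \<in> borel_measurable M" using assms(2) by (simp add: sqint_def)
  show ?thesis
    using assms by (auto simp: P2_def integrable_distr_eq sqint_def intro!: prob_space.prob_space_distr)
qed

lemma P2_law_sqint:
  fixes f :: "'a::euclidean_space \<Rightarrow> 'a"
  assumes "X \<in> M \<rightarrow>\<^sub>M borel" "distr M borel X = \<mu>" "sqint \<mu> f"
  shows "sqint M (\<lambda>z. f (X z))" "nrm M (\<lambda>z. f (X z)) = nrm \<mu> f"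
proof -
  have "f \<in> borel_measurable borel" using assms by (auto simp: sqint_def)
  then show "sqint M (\<lambda>z. f (X z))" "nrm M (\<lambda>z. f (X z)) = nrm \<mu> f"
    using sqint_distr[OF assms(1)] nrm_distr[OF assms(1)] assms(3) unfolding assms(2) by metis+
qed

lemma W2_le_nrm:
  assumes "\<mu> \<in> P2" "\<sigma> \<in> P2" "prob_space M" "f \<in> M \<rightarrow>\<^sub>M borel" "g \<in> M \<rightarrow>\<^sub>M borel"
    "distr M borel f = \<mu>" "distr M borel g = \<sigma>"
  shows "W2 \<mu> \<sigma> \<le> nrm M (\<lambda>z. f z - g z)"
proof (rule power2_le_imp_le)
  show "(W2 \<mu> \<sigma>)\<^sup>2 \<le> (nrm M (\<lambda>z. f z - g z))\<^sup>2"
    using W2_square(2)[OF assms(1,2) transport_plansI[OF assms(3-7)]]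
    by (simp add: transport_cost_distr_Pair[OF assms(4,5)])
qed (rule nrm_nonneg)

text \<open>One distance in the triangle inequality is replaced by the cost of an arbitrary plan:
  the applications have an explicit or a nearly optimal plan at hand and want the bound in terms of
  it.\<close>

lemma W2_triangle_plan:
  fixes \<nu> \<mu> \<sigma> :: "'a::euclidean_space measure"
  assumes \<nu>: "\<nu> \<in> P2" and \<mu>: "\<mu> \<in> P2" and \<sigma>: "\<sigma> \<in> P2" and \<pi>: "\<pi> \<in> transport_plans \<nu> \<mu>"
  shows "W2 \<mu> \<sigma> \<le> sqrt (transport_cost \<pi>) + W2 \<nu> \<sigma>"
proof -
  obtain \<gamma> where \<gamma>: "\<gamma> \<in> optimal_plans \<nu> \<sigma>"
    using optimal_plans_nonempty[OF \<nu> \<sigma>] .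
  then have \<gamma>T: "\<gamma> \<in> transport_plans \<nu> \<sigma>" "transport_cost \<gamma> = (W2 \<nu> \<sigma>)\<^sup>2"
    by (auto simp: optimal_plans_iff[OF \<nu> \<sigma>])
  from transport_plans_coupling[OF \<pi> \<gamma>T(1)]
  obtain \<omega> :: "(('a \<times> 'a) \<times> 'a) measure" and X X' Y where \<omega>: "prob_space \<omega>"
    and m: "X \<in> \<omega> \<rightarrow>\<^sub>M borel" "X' \<in> \<omega> \<rightarrow>\<^sub>M borel" "Y \<in> \<omega> \<rightarrow>\<^sub>M borel"
    and d: "distr \<omega> borel X = \<nu>" "distr \<omega> borel X' = \<mu>" "distr \<omega> borel Y = \<sigma>"
    and p: "distr \<omega> borel (\<lambda>z. (X z, X' z)) = \<pi>" "distr \<omega> borel (\<lambda>z. (X z, Y z)) = \<gamma>" .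
  have sq: "sqint \<omega> X" "sqint \<omega> X'" "sqint \<omega> Y"
    using P2_law_sqint(1)[OF m(1) d(1) P2D(4)[OF \<nu>]] P2_law_sqint(1)[OF m(2) d(2) P2D(4)[OF \<mu>]]
      P2_law_sqint(1)[OF m(3) d(3) P2D(4)[OF \<sigma>]] by auto
  have c: "nrm \<omega> (\<lambda>z. X' z - X z) = sqrt (transport_cost \<pi>)" "nrm \<omega> (\<lambda>z. X z - Y z) = W2 \<nu> \<sigma>"
    using transport_cost_distr_Pair[OF m(1,2)] transport_cost_distr_Pair[OF m(1,3)] W2_square(4)[OF \<nu> \<sigma>]
    by (auto simp: p \<gamma>T nrm_nonneg nrm_diff_commute[of _ X X'])
  have "W2 \<mu> \<sigma> \<le> nrm \<omega> (\<lambda>z. (X' z - X z) + (X z - Y z))"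
    using W2_le_nrm[OF \<mu> \<sigma> \<omega> m(2,3) d(2,3)] by simp
  also have "\<dots> \<le> nrm \<omega> (\<lambda>z. X' z - X z) + nrm \<omega> (\<lambda>z. X z - Y z)"
    by (intro nrm_triangle sqint_diff sq)
  finally show ?thesis by (simp add: c)
qed

lemma transport_plans_swap:
  assumes "\<pi> \<in> transport_plans \<nu> \<mu>"
  shows "distr \<pi> borel (\<lambda>z. (snd z, fst z)) \<in> transport_plans \<mu> \<nu>"
    "transport_cost (distr \<pi> borel (\<lambda>z. (snd z, fst z))) = transport_cost \<pi>"
proof -
  note P = transport_plansD[OF assms]
  show "distr \<pi> borel (\<lambda>z. (snd z, fst z)) \<in> transport_plans \<mu> \<nu>"
    by (rule transport_plansI[OF P(1,7,6,5,4)])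
  show "transport_cost (distr \<pi> borel (\<lambda>z. (snd z, fst z))) = transport_cost \<pi>"
    unfolding transport_cost_distr_Pair[OF P(7,6)] nrm_square by (simp add: transport_cost_def norm_minus_commute)
qed

section \<open>Maps of linear growth and continuity of composition with them\<close>

lemma C1_mapsD:
  fixes w :: "'a::euclidean_space \<Rightarrow> 'a"
  assumes "w \<in> C1_maps"
  obtains C where "0 \<le> C" "\<And>x. norm (w x) \<le> C * (1 + norm x)"
proof -
  from assms obtain C where C: "\<And>x. norm (w x) / (1 + norm x) \<le> C"
    by (auto simp: C1_maps_def bdd_above_def)
  have pos: "0 < 1 + norm x" for x :: 'a
    by (simp add: add_pos_nonneg)
  have "0 \<le> norm (w 0) / (1 + norm (0::'a))" by simp
  also have "\<dots> \<le> C" by (rule C)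
  finally have "0 \<le> C" .
  moreover have "norm (w x) \<le> C * (1 + norm x)" for x
    using C[of x] pos[of x] by (simp add: pos_divide_le_eq)
  ultimately show thesis by (rule that)
qed

lemma C1_maps_growth_square:
  fixes w :: "'a::euclidean_space \<Rightarrow> 'a"
  assumes "w \<in> C1_maps"
  obtains C where "\<And>x. (norm (w x))\<^sup>2 \<le> C\<^sup>2 * (2 + 2 * (norm x)\<^sup>2)"
proof -
  obtain C where C: "0 \<le> C" "\<And>x. norm (w x) \<le> C * (1 + norm x)"
    using C1_mapsD[OF assms] by blast
  have "(norm (w x))\<^sup>2 \<le> C\<^sup>2 * (2 + 2 * (norm x)\<^sup>2)" for x
  proof -
    have "(norm (w x))\<^sup>2 \<le> (C * (1 + norm x))\<^sup>2"
      by (rule power_mono[OF C(2)]) simp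
    also have "(1 + norm x)\<^sup>2 \<le> 2 + 2 * (norm x)\<^sup>2"
      using sum_squares_bound[of 1 "norm x"] by (simp add: power2_sum)
    then have "(C * (1 + norm x))\<^sup>2 \<le> C\<^sup>2 * (2 + 2 * (norm x)\<^sup>2)"
      unfolding power_mult_distrib by (rule mult_left_mono) simp
    finally show ?thesis .
  qed
  then show thesis by (rule that)
qed

lemma C1_maps_borel: "w \<in> C1_maps \<Longrightarrow> w \<in> borel_measurable borel"
  by (auto simp: C1_maps_def intro: borel_measurable_continuous_onI)

lemma C1_maps_sqint:
  assumes w: "w \<in> C1_maps" and X: "sqint M X" and M: "prob_space M"
  shows "sqint M (\<lambda>z. w (X z))"
proof -
  interpret prob_space M by fact
  obtain C where C: "\<And>x. (norm (w x))\<^sup>2 \<le> C\<^sup>2 * (2 + 2 * (norm x)\<^sup>2)"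
    using C1_maps_growth_square[OF w] by blast
  have [measurable]: "X \<in> borel_measurable M" "w \<in> borel_measurable borel"
    using X C1_maps_borel[OF w] by (auto simp: sqint_def)
  show ?thesis
  proof (rule sqint_bound)
    show "integrable M (\<lambda>z. C\<^sup>2 * (2 + 2 * (norm (X z))\<^sup>2))"
      using X by (intro integrable_mult_right Bochner_Integration.integrable_add) (auto simp: sqint_integrable)
    show "(norm (w (X z)))\<^sup>2 \<le> C\<^sup>2 * (2 + 2 * (norm (X z))\<^sup>2)" for z
      by (rule C)
  qed measurable
qed

lemma P2_tail:
  assumes \<mu>: "\<mu> \<in> P2" and "0 < e"
  shows "\<exists>R::nat. (\<integral>x. indicator {x. real R \<le> norm x} x * (1 + (norm x)\<^sup>2) \<partial>\<mu>) < e"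
proof -
  interpret prob_space \<mu> using P2D[OF \<mu>] by simp
  have [measurable_cong]: "sets \<mu> = sets borel" using P2D[OF \<mu>] by simp
  have "(\<lambda>R::nat. \<integral>x. indicator {x. real R \<le> norm x} x * (1 + (norm x)\<^sup>2) \<partial>\<mu>) \<longlonglongrightarrow> (\<integral>x. 0 \<partial>\<mu>)"
  proof (rule integral_dominated_convergence[where w="\<lambda>x. 1 + (norm x)\<^sup>2"])
    show "integrable \<mu> (\<lambda>x. 1 + (norm x)\<^sup>2)"
      using sqint_integrable[OF P2D(4)[OF \<mu>]] by simp
    show "AE x in \<mu>. norm (indicator {x. real R \<le> norm x} x * (1 + (norm x)\<^sup>2)) \<le> 1 + (norm x)\<^sup>2" for R
      by (auto simp: indicator_def)
    show "AE x in \<mu>. (\<lambda>R. indicator {x. real R \<le> norm x} x * (1 + (norm x)\<^sup>2)) \<longlonglongrightarrow> 0"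
    proof (rule AE_I2)
      fix x :: 'a
      obtain N :: nat where "norm x < real N" using reals_Archimedean2 by blast
      then have "eventually (\<lambda>R. indicator {x. real R \<le> norm x} x * (1 + (norm x)\<^sup>2) = 0) sequentially"
        unfolding eventually_sequentially by (intro exI[of _ N]) (auto simp: indicator_def)
      then show "(\<lambda>R. indicator {x. real R \<le> norm x} x * (1 + (norm x)\<^sup>2)) \<longlonglongrightarrow> 0"
        by (rule tendsto_eventually)
    qed
  qed measurable
  then have "eventually (\<lambda>R::nat. (\<integral>x. indicator {x. real R \<le> norm x} x * (1 + (norm x)\<^sup>2) \<partial>\<mu>) < e) sequentially"
    by (intro order_tendstoD(2)) (use \<open>0 < e\<close> in auto)
  then show ?thesis using eventually_happens by force
qed

text \<open>Composition with w is continuous in L2 at \<mu>, uniformly over couplings: only the law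
  \<mu> of X' is fixed, so d serves all nearby measures at once. There are three regimes: X' large,
  handled by the tail of \<mu>; X' bounded and X close, by uniform continuity on a ball; X' bounded
  and X far, where the distance is at least \<open>d2\<close> and a multiple of its square absorbs
  everything.\<close>

lemma C1_maps_modulus:
  fixes w :: "'a::euclidean_space \<Rightarrow> 'a"
  assumes \<mu>: "\<mu> \<in> P2" and w: "w \<in> C1_maps" and e: "0 < e"
  shows "\<exists>d>0. \<forall>(M::'b measure) X X'. prob_space M \<longrightarrow> sqint M X \<longrightarrow> X' \<in> M \<rightarrow>\<^sub>M borel \<longrightarrow>
    distr M borel X' = \<mu> \<longrightarrow> nrm M (\<lambda>z. X z - X' z) < d \<longrightarrow> nrm M (\<lambda>z. w (X z) - w (X' z)) \<le> e"
proof -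
  obtain C where C: "\<And>x. (norm (w x))\<^sup>2 \<le> C\<^sup>2 * (2 + 2 * (norm x)\<^sup>2)"
    using C1_maps_growth_square[OF w] by blast
  have wc: "continuous_on UNIV w" using w by (simp add: C1_maps_def)
  \<comment> \<open>The growth bound turns 2 |w x|^2 + 2 |w x'|^2 into C^2 (8 + 4 |x|^2 + 4 |x'|^2),
    and |x|^2 is at most 2 |x - x'|^2 + 2 |x'|^2; hence 12. The 1 keeps D positive.\<close>
  define D where "D = 12 * C\<^sup>2 + 1"
  have D: "0 < D" by (simp add: D_def add_nonneg_pos)
  have crude: "(norm (w x - w x'))\<^sup>2 \<le> D * (1 + (norm x')\<^sup>2 + (norm (x - x'))\<^sup>2)" for x x'
  proof -
    have nx: "(norm x)\<^sup>2 \<le> 2 * (norm (x - x'))\<^sup>2 + 2 * (norm x')\<^sup>2"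
      using norm_add_square_le[of "x - x'" x'] by simp
    have arith: "8 + 4 * a + 4 * b \<le> 12 * (1 + b + c)" if "a \<le> 2 * c + 2 * b" "0 \<le> c" for a b c :: real
      using that by argo
    have "(norm (w x - w x'))\<^sup>2 \<le> 2 * (norm (w x))\<^sup>2 + 2 * (norm (w x'))\<^sup>2"
      using norm_add_square_le[of "w x" "- w x'"] by simp
    also have "\<dots> \<le> C\<^sup>2 * (8 + 4 * (norm x)\<^sup>2 + 4 * (norm x')\<^sup>2)"
      using C[of x] C[of x'] by (simp add: algebra_simps)
    also have "\<dots> \<le> C\<^sup>2 * (12 * (1 + (norm x')\<^sup>2 + (norm (x - x'))\<^sup>2))"
    proof (rule mult_left_mono)
      show "8 + 4 * (norm x)\<^sup>2 + 4 * (norm x')\<^sup>2 \<le> 12 * (1 + (norm x')\<^sup>2 + (norm (x - x'))\<^sup>2)"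
        using nx by (intro arith) auto
    qed simp
    also have "\<dots> \<le> D * (1 + (norm x')\<^sup>2 + (norm (x - x'))\<^sup>2)"
      unfolding D_def by (simp add: algebra_simps)
    finally show ?thesis .
  qed
  \<comment> \<open>Each of the three regimes may contribute a quarter of e^2 to the
    integral.\<close>
  define e4 where "e4 = e\<^sup>2 / 4"
  have e4: "0 < e4" using e by (simp add: e4_def)
  obtain R :: nat where R: "(\<integral>x. indicator {x. real R \<le> norm x} x * (1 + (norm x)\<^sup>2) \<partial>\<mu>) < e4 / D"
    using P2_tail[OF \<mu>, of "e4 / D"] e4 D by auto
  \<comment> \<open>The extra 1 leaves room for x, which lies within \<open>d2\<close>, hence within
    1, of a point of norm below R.\<close>
  have "uniformly_continuous_on (cball 0 (real R + 1)) w"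
    by (intro compact_uniformly_continuous continuous_on_subset[OF wc]) auto
  then obtain d1 where d1: "0 < d1"
    "\<And>x x'. x \<in> cball 0 (real R + 1) \<Longrightarrow> x' \<in> cball 0 (real R + 1) \<Longrightarrow> dist x x' < d1 \<Longrightarrow> dist (w x) (w x') < e / 2"
    unfolding uniformly_continuous_on_def using e by (metis dist_commute half_gt_zero)
  define d2 where "d2 = min d1 1"
  have d2: "0 < d2" "d2 \<le> d1" "d2 \<le> 1" using d1 by (auto simp: d2_def)
  \<comment> \<open>The first summand pays for the far regime, where |x - x'|^2 /
    \<open>d2\<close>^2 is at least 1; the second pays for the term in |x - x'|^2 of the crude
    bound.\<close>
  define K where "K = D * (1 + (real R)\<^sup>2) / d2\<^sup>2 + D"
  have K: "0 < K" unfolding K_def using D d2 by (intro add_nonneg_pos) auto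
  have fine: "(norm (w x - w x'))\<^sup>2 \<le>
      e4 + D * (indicator {x. real R \<le> norm x} x' * (1 + (norm x')\<^sup>2)) + K * (norm (x - x'))\<^sup>2" for x x'
  proof -
    have nn: "0 \<le> D * (1 + (norm x')\<^sup>2)" "0 \<le> D * (norm (x - x'))\<^sup>2" "0 \<le> D * (1 + (real R)\<^sup>2) / d2\<^sup>2 * (norm (x - x'))\<^sup>2"
      using D by auto
    have Keq: "K * (norm (x - x'))\<^sup>2 = D * (1 + (real R)\<^sup>2) / d2\<^sup>2 * (norm (x - x'))\<^sup>2 + D * (norm (x - x'))\<^sup>2"
      by (simp add: K_def algebra_simps)
    have cr: "(norm (w x - w x'))\<^sup>2 \<le> D * (1 + (norm x')\<^sup>2) + D * (norm (x - x'))\<^sup>2"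
      using crude[of x x'] by (simp add: algebra_simps)
    consider "real R \<le> norm x'" | "norm x' < real R" "norm (x - x') < d2" | "norm x' < real R" "d2 \<le> norm (x - x')"
      by linarith
    then show ?thesis
    proof cases
      case 1
      then show ?thesis using cr nn Keq e4 by simp
    next
      case 2
      have "norm x \<le> norm x' + norm (x - x')"
        using norm_triangle_ineq[of x' "x - x'"] by simp
      then have "dist (w x) (w x') < e / 2"
        using 2 d2 by (intro d1(2)) (auto simp: dist_norm)
      then have "(norm (w x - w x'))\<^sup>2 \<le> (e / 2)\<^sup>2"
        by (intro power_mono) (auto simp: dist_norm)
      also have "\<dots> = e4" by (simp add: e4_def power_divide)
      finally show ?thesis using nn Keq 2 by simp
    next
      case 3
      have "(norm x')\<^sup>2 \<le> (real R)\<^sup>2" using 3 by (intro power_mono) auto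
      moreover have "1 \<le> (norm (x - x'))\<^sup>2 / d2\<^sup>2"
        using 3 d2 power_mono[of d2 "norm (x - x')" 2] by simp
      ultimately have "D * (1 + (norm x')\<^sup>2) * 1 \<le> D * (1 + (real R)\<^sup>2) * ((norm (x - x'))\<^sup>2 / d2\<^sup>2)"
        using D by (intro mult_mono) auto
      then show ?thesis using cr nn Keq e4 3 by simp
    qed
  qed
  define d where "d = sqrt (e4 / K)"
  have d: "0 < d" using e4 K by (simp add: d_def)
  show ?thesis
  proof (intro exI[of _ d] conjI allI impI d)
    fix M :: "'b measure" and X X'
    assume M: "prob_space M" and X: "sqint M X" and X': "X' \<in> M \<rightarrow>\<^sub>M borel" "distr M borel X' = \<mu>"
      and close: "nrm M (\<lambda>z. X z - X' z) < d"
    interpret prob_space M by fact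
    have [measurable]: "X \<in> borel_measurable M" "w \<in> borel_measurable borel" "X' \<in> borel_measurable M"
      using X C1_maps_borel[OF w] X' by (auto simp: sqint_def)
    have X's: "sqint M X'" using P2_law_sqint(1)[OF X' P2D(4)[OF \<mu>]] .
    define T where "T x = indicator {x. real R \<le> norm x} x * (1 + (norm x)\<^sup>2)" for x :: 'a
    have [measurable]: "T \<in> borel_measurable borel" unfolding T_def by measurable
    have Tint: "integrable M (\<lambda>z. T (X' z))"
    proof (rule Bochner_Integration.integrable_bound)
      show "integrable M (\<lambda>z. 1 + (norm (X' z))\<^sup>2)" using sqint_integrable[OF X's] by simp
      show "AE z in M. norm (T (X' z)) \<le> norm (1 + (norm (X' z))\<^sup>2)"
        by (auto simp: T_def indicator_def)
    qed measurable
    have Teq: "(\<integral>z. T (X' z) \<partial>M) < e4 / D"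
      using R unfolding X'(2)[symmetric] T_def[symmetric] by (subst (asm) integral_distr) auto
    have sqd: "integrable M (\<lambda>z. (norm (X z - X' z))\<^sup>2)"
      by (rule sqint_integrable[OF sqint_diff[OF X X's]])
    show "nrm M (\<lambda>z. w (X z) - w (X' z)) \<le> e"
    proof (rule nrm_le)
      show "integrable M (\<lambda>z. e4 + D * T (X' z) + K * (norm (X z - X' z))\<^sup>2)"
        using Tint sqd by simp
      show "(norm (w (X z) - w (X' z)))\<^sup>2 \<le> e4 + D * T (X' z) + K * (norm (X z - X' z))\<^sup>2" for z
        using fine[of "X z" "X' z"] by (simp add: T_def)
      have "(nrm M (\<lambda>z. X z - X' z))\<^sup>2 \<le> d\<^sup>2"
        using close by (intro power_mono) (auto simp: nrm_nonneg)
      also have "d\<^sup>2 = e4 / K" using e4 K by (simp add: d_def)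
      finally have "K * (\<integral>z. (norm (X z - X' z))\<^sup>2 \<partial>M) \<le> e4"
        using K by (simp add: nrm_square field_simps)
      moreover have "D * (\<integral>z. T (X' z) \<partial>M) \<le> e4"
        using Teq D by (simp add: field_simps)
      moreover have "(\<integral>z. e4 + D * T (X' z) + K * (norm (X z - X' z))\<^sup>2 \<partial>M) =
          e4 + D * (\<integral>z. T (X' z) \<partial>M) + K * (\<integral>z. (norm (X z - X' z))\<^sup>2 \<partial>M)"
        using Tint sqd by (simp add: prob_space)
      ultimately show "(\<integral>z. e4 + D * T (X' z) + K * (norm (X z - X' z))\<^sup>2 \<partial>M) \<le> e\<^sup>2"
        using e4 unfolding e4_def by linarith
    qed (use e in auto)
  qed
qed

section \<open>The Clarke derivative of the squared distance\<close>

text \<open>Half the derivative at t = 0 of the cost of \<gamma> when its first coordinate moves by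
  t w.\<close>

abbreviation displacement_inner :: "('a::euclidean_space \<times> 'a) measure \<Rightarrow> ('a \<Rightarrow> 'a) \<Rightarrow> real" where
  "displacement_inner \<gamma> w \<equiv> \<integral>z. (fst z - snd z) \<bullet> w (fst z) \<partial>\<gamma>"

lemma integral_plan_law:
  fixes w :: "'a::euclidean_space \<Rightarrow> 'a"
  assumes m[measurable]: "X \<in> M \<rightarrow>\<^sub>M borel" "Y \<in> M \<rightarrow>\<^sub>M borel" and [measurable]: "w \<in> borel_measurable borel"
  shows "(\<integral>z. (fst z - snd z) \<bullet> w (fst z) \<partial>distr M borel (\<lambda>z. (X z, Y z))) = (\<integral>z. (X z - Y z) \<bullet> w (X z) \<partial>M)"
proof -
  have p: "(\<lambda>z. (X z, Y z)) \<in> M \<rightarrow>\<^sub>M borel"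
    unfolding borel_prod[symmetric] by measurable
  have c: "(\<lambda>z. (fst z - snd z) \<bullet> w (fst z)) \<in> borel \<rightarrow>\<^sub>M (borel :: real measure)"
    unfolding borel_prod[symmetric] by measurable
  show ?thesis
    by (subst integral_distr[OF p c]) simp
qed

text \<open>The first term is the same for all plans, so bounds on \<open>displacement_inner\<close>
  translate into bounds on the pairing of w(x) with y, to which the compactness of plans
  applies.\<close>

lemma transport_plans_diff_inner:
  fixes w :: "'a::euclidean_space \<Rightarrow> 'a"
  assumes \<mu>: "\<mu> \<in> P2" and \<sigma>: "\<sigma> \<in> P2" and \<gamma>: "\<gamma> \<in> transport_plans \<mu> \<sigma>" and w: "sqint \<mu> w"
  shows "displacement_inner \<gamma> w = L2_inner \<mu> (\<lambda>x. x) w - (\<integral>z. w (fst z) \<bullet> snd z \<partial>\<gamma>)"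
proof -
  note T = transport_plansD[OF \<gamma>]
  have sw: "sqint \<gamma> (\<lambda>z. w (fst z))" and sf: "sqint \<gamma> fst" and ss: "sqint \<gamma> snd"
    using transport_plans_sqint(1)[OF \<gamma> w] transport_plans_sqint(1)[OF \<gamma> P2D(4)[OF \<mu>]]
      transport_plans_sqint(3)[OF \<gamma> P2D(4)[OF \<sigma>]] by auto
  have wb[measurable]: "w \<in> borel_measurable borel"
    using w P2D(2)[OF \<mu>] by (simp add: sqint_def cong: measurable_cong_sets)
  have "L2_inner \<mu> (\<lambda>x. x) w = (\<integral>z. fst z \<bullet> w (fst z) \<partial>\<gamma>)"
    unfolding L2_inner_def T(4)[symmetric] by (subst integral_distr[OF T(6)]) auto
  then show ?thesis
    using sqint_inner[OF sf sw] sqint_inner[OF sw ss]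
    by (simp add: inner_diff_left inner_commute[of "w _"])
qed

text \<open>Displacing the first coordinate of \<gamma> gives a competitor whose cost is exactly
  quadratic in t. The sign of t is free: the lower bound for the Clarke derivative uses -t.\<close>

lemma W2_square_perturb_le:
  fixes w :: "'a::euclidean_space \<Rightarrow> 'a"
  assumes \<nu>: "\<nu> \<in> P2" and \<sigma>: "\<sigma> \<in> P2" and \<gamma>: "\<gamma> \<in> transport_plans \<nu> \<sigma>" and w: "sqint \<nu> w"
  shows "(W2 (distr \<nu> borel (\<lambda>x. x + t *\<^sub>R w x)) \<sigma>)\<^sup>2 \<le>
    transport_cost \<gamma> + 2 * t * displacement_inner \<gamma> w + t\<^sup>2 * (nrm \<nu> w)\<^sup>2"
proof -
  note T = transport_plansD[OF \<gamma>] and N = P2D[OF \<nu>]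
  have wb[measurable]: "w \<in> borel_measurable borel"
    using w N(2) by (simp add: sqint_def cong: measurable_cong_sets)
  note [measurable] = T(6,7)
  have \<nu>': "distr \<nu> borel (\<lambda>x. x + t *\<^sub>R w x) \<in> P2"
    by (intro P2I_distr N sqint_add sqint_scaleR w)
  have m: "(\<lambda>z. fst z + t *\<^sub>R w (fst z)) \<in> \<gamma> \<rightarrow>\<^sub>M borel" by measurable
  have d: "distr \<gamma> borel (\<lambda>z. fst z + t *\<^sub>R w (fst z)) = distr \<nu> borel (\<lambda>x. x + t *\<^sub>R w x)"
    unfolding T(4)[symmetric] by (subst distr_distr[OF _ T(6)]) (auto simp: comp_def)
  have sw: "sqint \<gamma> (\<lambda>z. w (fst z))" "nrm \<gamma> (\<lambda>z. w (fst z)) = nrm \<nu> w"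
    using transport_plans_sqint(1,2)[OF \<gamma> w] by auto
  have sf: "sqint \<gamma> fst" and ss: "sqint \<gamma> snd"
    using transport_plans_sqint(1)[OF \<gamma> N(4)] transport_plans_sqint(3)[OF \<gamma> P2D(4)[OF \<sigma>]] by auto
  have "W2 (distr \<nu> borel (\<lambda>x. x + t *\<^sub>R w x)) \<sigma> \<le> nrm \<gamma> (\<lambda>z. fst z + t *\<^sub>R w (fst z) - snd z)"
    by (rule W2_le_nrm[OF \<nu>' \<sigma> T(1) m T(7) d T(5)])
  then have "(W2 (distr \<nu> borel (\<lambda>x. x + t *\<^sub>R w x)) \<sigma>)\<^sup>2 \<le> (nrm \<gamma> (\<lambda>z. (fst z - snd z) + t *\<^sub>R w (fst z)))\<^sup>2"
    using W2_square(4)[OF \<nu>' \<sigma>] by (intro power_mono) (auto simp: algebra_simps)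
  also have "\<dots> = transport_cost \<gamma> + 2 * t * displacement_inner \<gamma> w + t\<^sup>2 * (nrm \<nu> w)\<^sup>2"
    by (subst nrm_square_add[OF sqint_diff[OF sf ss] sqint_scaleR[OF sw(1)]])
       (simp add: nrm_scaleR sw(2) power_mult_distrib nrm_square transport_cost_def)
  finally show ?thesis .
qed

text \<open>Glue an optimal \<gamma> for \<nu> with a nearly optimal plan between \<nu> and \<mu>.
  Replacing X by X' changes the displacement pairing by the integrals of (X - X') . w X and (X' - Y)
  . (w X - w X'). The first is small by Cauchy-Schwarz, the second by \<open>C1_maps_modulus\<close>
  as well. The bound on \<open>nrm \<nu> w\<close> enters the first and, later, the quadratic
  remainder.\<close>

lemma optimal_plans_stability:
  fixes w :: "'a::euclidean_space \<Rightarrow> 'a"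
  assumes \<mu>: "\<mu> \<in> P2" and \<sigma>: "\<sigma> \<in> P2" and w: "w \<in> C1_maps" and e: "0 < e"
  shows "\<exists>d>0. \<forall>\<nu>\<in>P2. W2 \<nu> \<mu> < d \<longrightarrow> (\<forall>\<gamma>\<in>optimal_plans \<nu> \<sigma>. nrm \<nu> w \<le> nrm \<mu> w + 1 \<and>
    (\<exists>\<gamma>'\<in>transport_plans \<mu> \<sigma>. transport_cost \<gamma>' \<le> (W2 \<mu> \<sigma>)\<^sup>2 + e \<and>
      displacement_inner \<gamma> w \<le> displacement_inner \<gamma>' w + e))"
proof -
  define W where "W = W2 \<mu> \<sigma>"
  define A where "A = nrm \<mu> w"
  have W: "0 \<le> W" unfolding W_def by (rule W2_square(4)[OF \<mu> \<sigma>])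
  have A: "0 \<le> A" unfolding A_def by (rule nrm_nonneg)
  have wb[measurable]: "w \<in> borel_measurable borel" by (rule C1_maps_borel[OF w])
  \<comment> \<open>W + 2 bounds the L2 distance of X' and Y, which is at most W + 2r with r below
    1.\<close>
  define \<eta> where "\<eta> = min 1 (e / (2 * (W + 2)))"
  have \<eta>: "0 < \<eta>" "\<eta> \<le> 1" "(W + 2) * \<eta> \<le> e / 2"
  proof -
    have "\<eta> \<le> e / (2 * (W + 2))" by (simp add: \<eta>_def)
    then show "(W + 2) * \<eta> \<le> e / 2" using W by (simp add: field_simps)
  qed (use e W in \<open>auto simp: \<eta>_def\<close>)
  obtain d0 where d0: "0 < d0" and mod: "\<And>(M::(('a \<times> 'a) \<times> 'a) measure) X X'. prob_space M \<Longrightarrow> sqint M X \<Longrightarrow>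
    X' \<in> M \<rightarrow>\<^sub>M borel \<Longrightarrow> distr M borel X' = \<mu> \<Longrightarrow> nrm M (\<lambda>z. X z - X' z) < d0 \<Longrightarrow> nrm M (\<lambda>z. w (X z) - w (X' z)) \<le> \<eta>"
    using C1_maps_modulus[OF \<mu> w \<eta>(1)] by blast
  \<comment> \<open>The four bounds give in turn the validity of the modulus, r below 1, r * nrm
    \<nu> w at most e / 2, and a cost excess 4 W r + 4 r^2 of at most e.\<close>
  define d where "d = min (min d0 1) (min (e / (2 * (A + 1))) (e / (4 * W + 4)))"
  have d: "0 < d" "d \<le> d0" "d \<le> 1" "d * (A + 1) \<le> e / 2" "d * (4 * W + 4) \<le> e"
  proof -
    have "d \<le> e / (2 * (A + 1))" "d \<le> e / (4 * W + 4)" by (auto simp: d_def)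
    then show "d * (A + 1) \<le> e / 2" "d * (4 * W + 4) \<le> e" using W A by (simp_all add: field_simps)
  qed (use e W A d0 in \<open>auto simp: d_def\<close>)
  show ?thesis
  proof (intro exI[of _ d] conjI ballI impI d)
    fix \<nu> \<gamma> assume \<nu>: "\<nu> \<in> P2" and near: "W2 \<nu> \<mu> < d" and \<gamma>: "\<gamma> \<in> optimal_plans \<nu> \<sigma>"
    from \<gamma> have \<gamma>T: "\<gamma> \<in> transport_plans \<nu> \<sigma>" "transport_cost \<gamma> = (W2 \<nu> \<sigma>)\<^sup>2"
      by (auto simp: optimal_plans_iff[OF \<nu> \<sigma>])
    have "(W2 \<nu> \<mu>)\<^sup>2 < d\<^sup>2"
      using near W2_square(4)[OF \<nu> \<mu>] by (intro power_strict_mono) auto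
    then obtain \<pi> where \<pi>: "\<pi> \<in> transport_plans \<nu> \<mu>" "transport_cost \<pi> < d\<^sup>2"
      using W2_square(3)[OF \<nu> \<mu>, of "d\<^sup>2 - (W2 \<nu> \<mu>)\<^sup>2"] by auto
    define r where "r = sqrt (transport_cost \<pi>)"
    have r: "0 \<le> r" "r < d"
      using \<pi>(2) d(1) by (auto simp: r_def transport_cost_def intro!: real_less_lsqrt)
    from transport_plans_coupling[OF \<pi>(1) \<gamma>T(1)]
    obtain \<omega> :: "(('a \<times> 'a) \<times> 'a) measure" and X X' Y where \<omega>: "prob_space \<omega>"
      and m: "X \<in> \<omega> \<rightarrow>\<^sub>M borel" "X' \<in> \<omega> \<rightarrow>\<^sub>M borel" "Y \<in> \<omega> \<rightarrow>\<^sub>M borel"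
      and dd: "distr \<omega> borel X = \<nu>" "distr \<omega> borel X' = \<mu>" "distr \<omega> borel Y = \<sigma>"
      and p: "distr \<omega> borel (\<lambda>z. (X z, X' z)) = \<pi>" "distr \<omega> borel (\<lambda>z. (X z, Y z)) = \<gamma>"
      and \<gamma>': "distr \<omega> borel (\<lambda>z. (X' z, Y z)) \<in> transport_plans \<mu> \<sigma>" .
    have sq: "sqint \<omega> X" "sqint \<omega> X'" "sqint \<omega> Y"
      using P2_law_sqint(1)[OF m(1) dd(1) P2D(4)[OF \<nu>]] P2_law_sqint(1)[OF m(2) dd(2) P2D(4)[OF \<mu>]]
        P2_law_sqint(1)[OF m(3) dd(3) P2D(4)[OF \<sigma>]] by auto
    note wX = C1_maps_sqint[OF w sq(1) \<omega>] and wX' = C1_maps_sqint[OF w sq(2) \<omega>]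
    have rX: "nrm \<omega> (\<lambda>z. X z - X' z) = r" and XY: "nrm \<omega> (\<lambda>z. X z - Y z) = W2 \<nu> \<sigma>"
      using transport_cost_distr_Pair[OF m(1,2)] transport_cost_distr_Pair[OF m(1,3)] W2_square(4)[OF \<nu> \<sigma>]
      by (auto simp: p \<gamma>T nrm_nonneg r_def)
    have close: "nrm \<omega> (\<lambda>z. w (X z) - w (X' z)) \<le> \<eta>"
      by (rule mod[OF \<omega> sq(1) m(2) dd(2)]) (use rX r d in simp)
    have law: "nrm \<omega> (\<lambda>z. w (X z)) = nrm \<nu> w" "nrm \<omega> (\<lambda>z. w (X' z)) = A"
      unfolding A_def dd(1,2)[symmetric] by (simp_all add: nrm_distr m wb)
    have "nrm \<omega> (\<lambda>z. w (X' z) + (w (X z) - w (X' z))) \<le> A + \<eta>"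
      using nrm_triangle[OF wX' sqint_diff[OF wX wX']] close law(2) by linarith
    then have nw: "nrm \<nu> w \<le> A + 1" using \<eta>(2) law(1) by simp
    then show "nrm \<nu> w \<le> nrm \<mu> w + 1" by (simp add: A_def)
    \<comment> \<open>The triangle inequality is used twice, out to \<nu> and back to \<mu>; whence
      2r.\<close>
    have "W2 \<nu> \<sigma> \<le> r + W"
      using W2_triangle_plan[OF \<mu> \<nu> \<sigma> transport_plans_swap(1)[OF \<pi>(1)]]
      by (simp add: transport_plans_swap(2)[OF \<pi>(1)] r_def W_def)
    then have X'Y: "nrm \<omega> (\<lambda>z. X' z - Y z) \<le> W + 2 * r"
      using nrm_triangle[OF sqint_diff[OF sq(2,1)] sqint_diff[OF sq(1,3)]] rX XY
        nrm_diff_commute[of \<omega> X X'] by simp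
    define \<gamma>\<^sub>1 where "\<gamma>\<^sub>1 = distr \<omega> borel (\<lambda>z. (X' z, Y z))"
    have "transport_cost \<gamma>\<^sub>1 \<le> (W + 2 * r)\<^sup>2"
      unfolding \<gamma>\<^sub>1_def transport_cost_distr_Pair[OF m(2,3)]
      using X'Y by (intro power_mono nrm_nonneg)
    also have "\<dots> = W\<^sup>2 + r * (4 * W + 4 * r)"
      by (simp add: power2_eq_square algebra_simps)
    also have "\<dots> \<le> W\<^sup>2 + d * (4 * W + 4)"
      using r d W by (intro add_left_mono mult_mono) auto
    also have "\<dots> \<le> W\<^sup>2 + e" using d(5) by simp
    finally have cost: "transport_cost \<gamma>\<^sub>1 \<le> W\<^sup>2 + e" .
    have int: "integrable \<omega> (\<lambda>z. (X z - X' z) \<bullet> w (X z))" "integrable \<omega> (\<lambda>z. (X' z - Y z) \<bullet> (w (X z) - w (X' z)))"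
      "integrable \<omega> (\<lambda>z. (X' z - Y z) \<bullet> w (X' z))"
      by (intro sqint_inner sqint_diff sq wX wX')+
    have "(\<integral>z. (X z - Y z) \<bullet> w (X z) \<partial>\<omega>) =
      (\<integral>z. (X z - X' z) \<bullet> w (X z) + (X' z - Y z) \<bullet> (w (X z) - w (X' z)) + (X' z - Y z) \<bullet> w (X' z) \<partial>\<omega>)"
      by (rule Bochner_Integration.integral_cong) (auto simp: inner_diff_left inner_diff_right)
    also have "\<dots> = (\<integral>z. (X z - X' z) \<bullet> w (X z) \<partial>\<omega>) + (\<integral>z. (X' z - Y z) \<bullet> (w (X z) - w (X' z)) \<partial>\<omega>) +
        (\<integral>z. (X' z - Y z) \<bullet> w (X' z) \<partial>\<omega>)"
      using int by simp
    also have "\<dots> \<le> r * nrm \<nu> w + (W + 2 * r) * \<eta> + (\<integral>z. (X' z - Y z) \<bullet> w (X' z) \<partial>\<omega>)"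
    proof -
      have "(\<integral>z. (X z - X' z) \<bullet> w (X z) \<partial>\<omega>) \<le> r * nrm \<nu> w"
        using sqint_Cauchy_Schwarz[OF sqint_diff[OF sq(1,2)] wX] by (simp add: rX law)
      moreover have "(\<integral>z. (X' z - Y z) \<bullet> (w (X z) - w (X' z)) \<partial>\<omega>) \<le>
          nrm \<omega> (\<lambda>z. X' z - Y z) * nrm \<omega> (\<lambda>z. w (X z) - w (X' z))"
        using sqint_Cauchy_Schwarz[OF sqint_diff[OF sq(2,3)] sqint_diff[OF wX wX']] by linarith
      moreover have "nrm \<omega> (\<lambda>z. X' z - Y z) * nrm \<omega> (\<lambda>z. w (X z) - w (X' z)) \<le> (W + 2 * r) * \<eta>"
        using X'Y close W r by (intro mult_mono) (auto simp: nrm_nonneg)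
      ultimately show ?thesis by linarith
    qed
    also have "\<dots> \<le> (\<integral>z. (X' z - Y z) \<bullet> w (X' z) \<partial>\<omega>) + e"
    proof -
      have "r * nrm \<nu> w \<le> d * (A + 1)"
        using r nw d by (intro mult_mono) (auto simp: nrm_nonneg)
      moreover have "(W + 2 * r) * \<eta> \<le> (W + 2) * \<eta>"
        using r d \<eta> by (intro mult_right_mono) auto
      ultimately show ?thesis using d(4) \<eta>(3) by linarith
    qed
    finally have "displacement_inner \<gamma> w \<le> (\<integral>z. (fst z - snd z) \<bullet> w (fst z) \<partial>\<gamma>\<^sub>1) + e"
      unfolding \<gamma>\<^sub>1_def p(2)[symmetric] integral_plan_law[OF m(1,3) wb] integral_plan_law[OF m(2,3) wb] .
    with cost \<gamma>' show "\<exists>\<gamma>'\<in>transport_plans \<mu> \<sigma>. transport_cost \<gamma>' \<le> (W2 \<mu> \<sigma>)\<^sup>2 + e \<and>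
      displacement_inner \<gamma> w \<le> displacement_inner \<gamma>' w + e"
      unfolding W_def \<gamma>\<^sub>1_def by blast
  qed
qed

lemma eventually_W2_nhds: "0 < d \<Longrightarrow> eventually (\<lambda>\<nu>. \<nu> \<in> P2 \<and> W2 \<nu> \<mu> < d) (W2_nhds \<mu>)"
  unfolding W2_nhds_def by (rule eventually_INF1[of d]) (auto simp: eventually_principal)

lemma clarke_derivative_le:
  fixes w :: "'a::euclidean_space \<Rightarrow> 'a"
  assumes \<mu>: "\<mu> \<in> P2" and \<sigma>: "\<sigma> \<in> P2" and w: "w \<in> C1_maps"
    and bound: "\<And>\<gamma>. \<gamma> \<in> optimal_plans \<mu> \<sigma> \<Longrightarrow> 2 * displacement_inner \<gamma> w \<le> c"
  shows "clarke_derivative (\<lambda>\<nu>. (W2 \<nu> \<sigma>)\<^sup>2) \<mu> w \<le> ereal c"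
proof (rule ereal_le_epsilon2)
  fix e :: real assume e: "0 < e"
  have ws: "sqint \<mu> w" if "\<mu> \<in> P2" for \<mu>
    by (rule C1_maps_sqint[OF w P2D(4,1)[OF that]])
  define A where "A = nrm \<mu> w"
  have A: "0 \<le> A" unfolding A_def by (rule nrm_nonneg)
  note diff = transport_plans_diff_inner[OF \<mu> \<sigma> _ ws[OF \<mu>]]
  have "\<exists>d>0. \<forall>\<gamma>\<in>transport_plans \<mu> \<sigma>. transport_cost \<gamma> \<le> (W2 \<mu> \<sigma>)\<^sup>2 + d \<longrightarrow>
    (L2_inner \<mu> (\<lambda>x. x) w - c / 2) - e / 8 \<le> (\<integral>z. w (fst z) \<bullet> snd z \<partial>\<gamma>)"
  proof (rule nearly_optimal_plans_bound[OF \<mu> \<sigma> ws[OF \<mu>]])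
    fix \<gamma> assume \<gamma>: "\<gamma> \<in> optimal_plans \<mu> \<sigma>"
    then have "\<gamma> \<in> transport_plans \<mu> \<sigma>" by (simp add: optimal_plans_def)
    from bound[OF \<gamma>] diff[OF this]
    show "L2_inner \<mu> (\<lambda>x. x) w - c / 2 \<le> (\<integral>z. w (fst z) \<bullet> snd z \<partial>\<gamma>)" by linarith
  qed (use e in simp)
  then obtain d1 where d1: "0 < d1"
    "\<And>\<gamma>. \<gamma> \<in> transport_plans \<mu> \<sigma> \<Longrightarrow> transport_cost \<gamma> \<le> (W2 \<mu> \<sigma>)\<^sup>2 + d1 \<Longrightarrow>
      (L2_inner \<mu> (\<lambda>x. x) w - c / 2) - e / 8 \<le> (\<integral>z. w (fst z) \<bullet> snd z \<partial>\<gamma>)"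
    by blast
  \<comment> \<open>Doubling the pairing errors e / 8 and e1 gives at most e / 2; the quadratic
    remainder takes the other half through \<open>t0\<close>.\<close>
  define e1 where "e1 = min d1 (e / 8)"
  have e1: "0 < e1" "e1 \<le> d1" "e1 \<le> e / 8" using d1 e by (auto simp: e1_def)
  obtain d where d: "0 < d" and stab: "\<And>\<nu> \<gamma>. \<nu> \<in> P2 \<Longrightarrow> W2 \<nu> \<mu> < d \<Longrightarrow> \<gamma> \<in> optimal_plans \<nu> \<sigma> \<Longrightarrow>
    nrm \<nu> w \<le> nrm \<mu> w + 1 \<and> (\<exists>\<gamma>'\<in>transport_plans \<mu> \<sigma>. transport_cost \<gamma>' \<le> (W2 \<mu> \<sigma>)\<^sup>2 + e1 \<and>
      displacement_inner \<gamma> w \<le> displacement_inner \<gamma>' w + e1)"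
    using optimal_plans_stability[OF \<mu> \<sigma> w e1(1)] by blast
  define t0 where "t0 = e / (2 * (A + 1)\<^sup>2)"
  have t0: "0 < t0" using e A by (simp add: t0_def)
  have quot: "((W2 (distr \<nu> borel (\<lambda>x. x + t *\<^sub>R w x)) \<sigma>)\<^sup>2 - (W2 \<nu> \<sigma>)\<^sup>2) / t \<le> c + e"
    if \<nu>: "\<nu> \<in> P2" and near: "W2 \<nu> \<mu> < d" and t: "0 < t" "t < t0" for \<nu> t
  proof -
    obtain \<gamma> where \<gamma>: "\<gamma> \<in> optimal_plans \<nu> \<sigma>"
      using optimal_plans_nonempty[OF \<nu> \<sigma>] .
    then have \<gamma>T: "\<gamma> \<in> transport_plans \<nu> \<sigma>" "transport_cost \<gamma> = (W2 \<nu> \<sigma>)\<^sup>2"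
      by (auto simp: optimal_plans_iff[OF \<nu> \<sigma>])
    define I where "I = displacement_inner \<gamma> w"
    from stab[OF \<nu> near \<gamma>] obtain \<gamma>' where nw: "nrm \<nu> w \<le> A + 1" and \<gamma>': "\<gamma>' \<in> transport_plans \<mu> \<sigma>"
      and cost: "transport_cost \<gamma>' \<le> (W2 \<mu> \<sigma>)\<^sup>2 + e1"
      and I: "I \<le> displacement_inner \<gamma>' w + e1"
      unfolding A_def I_def by blast
    have "2 * I \<le> c + e / 2"
      using I d1(2)[OF \<gamma>'] cost e1 diff[OF \<gamma>'] by linarith
    moreover have "t * (nrm \<nu> w)\<^sup>2 \<le> e / 2"
    proof -
      have "t * (nrm \<nu> w)\<^sup>2 \<le> t0 * (A + 1)\<^sup>2"
        using t nw by (intro mult_mono power_mono) (auto simp: nrm_nonneg)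
      also have "\<dots> = e / 2" using A by (simp add: t0_def)
      finally show ?thesis .
    qed
    moreover have "((W2 (distr \<nu> borel (\<lambda>x. x + t *\<^sub>R w x)) \<sigma>)\<^sup>2 - (W2 \<nu> \<sigma>)\<^sup>2) / t \<le>
        (2 * t * I + t\<^sup>2 * (nrm \<nu> w)\<^sup>2) / t"
      using W2_square_perturb_le[OF \<nu> \<sigma> \<gamma>T(1) ws[OF \<nu>], of t] t(1)
      by (intro divide_right_mono) (auto simp: I_def \<gamma>T(2))
    moreover have "(2 * t * I + t\<^sup>2 * (nrm \<nu> w)\<^sup>2) / t = 2 * I + t * (nrm \<nu> w)\<^sup>2"
      using t(1) by (simp add: field_simps power2_eq_square)
    ultimately show ?thesis by linarith
  qed
  have "eventually (\<lambda>t. 0 < t \<and> t < t0) (at_right 0)"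
    using t0 by (intro eventually_at_rightI[of 0 t0]) auto
  with eventually_W2_nhds[OF d]
  have "eventually (\<lambda>(\<nu>, t). ((W2 (distr \<nu> borel (\<lambda>x. x + t *\<^sub>R w x)) \<sigma>)\<^sup>2 - (W2 \<nu> \<sigma>)\<^sup>2) / t \<le> c + e)
      (W2_nhds \<mu> \<times>\<^sub>F at_right 0)"
    unfolding eventually_prod_filter using quot by (intro exI conjI) auto
  then show "clarke_derivative (\<lambda>\<nu>. (W2 \<nu> \<sigma>)\<^sup>2) \<mu> w \<le> ereal c + ereal e"
    unfolding clarke_derivative_def
    by (intro Limsup_bounded) (auto elim!: eventually_mono)
qed

text \<open>A limit superior over F dominates the asymptotic values along any curve p tending to F;
  the curve intended is t -> (\<open>\<nu> t\<close>, t), with \<open>\<nu> t\<close> the displaced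
  base point.\<close>

lemma le_Limsup_filterlim:
  fixes X :: "'b \<Rightarrow> ereal"
  assumes p: "filterlim p F G" and G: "G \<noteq> bot"
    and ev: "\<And>e. 0 < e \<Longrightarrow> eventually (\<lambda>t. ereal (L - e) \<le> X (p t)) G"
  shows "ereal L \<le> Limsup F X"
proof (rule ccontr)
  assume "\<not> ereal L \<le> Limsup F X"
  then obtain y where y: "Limsup F X < ereal y" "ereal y < ereal L"
    using ereal_dense2 by (metis not_le)
  have "eventually (\<lambda>t. X (p t) < ereal y) G"
    using filterlim_iff[THEN iffD1, OF p, rule_format, OF Limsup_lessD[OF y(1)]] .
  moreover have "eventually (\<lambda>t. ereal (L - (L - y)) \<le> X (p t)) G"
    using y by (intro ev) simp
  ultimately have "eventually (\<lambda>t. False) G"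
    by eventually_elim simp
  with G show False by simp
qed

text \<open>The base points \<open>(id - t w)\<^sub>#\<mu>\<close> turn the Clarke derivative into minus the one-sided
  derivative in direction \<open>-w\<close>, which sees every optimal plan.\<close>

lemma clarke_derivative_ge:
  fixes w :: "'a::euclidean_space \<Rightarrow> 'a"
  assumes \<mu>: "\<mu> \<in> P2" and \<sigma>: "\<sigma> \<in> P2" and w: "w \<in> C1_maps" and \<gamma>: "\<gamma> \<in> optimal_plans \<mu> \<sigma>"
  shows "ereal (2 * displacement_inner \<gamma> w) \<le> clarke_derivative (\<lambda>\<nu>. (W2 \<nu> \<sigma>)\<^sup>2) \<mu> w"
proof -
  define L where "L = displacement_inner \<gamma> w"
  note M = P2D[OF \<mu>]
  have \<gamma>T: "\<gamma> \<in> transport_plans \<mu> \<sigma>" "transport_cost \<gamma> = (W2 \<mu> \<sigma>)\<^sup>2"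
    using \<gamma> by (auto simp: optimal_plans_iff[OF \<mu> \<sigma>])
  define W where "W = W2 \<mu> \<sigma>"
  define A where "A = nrm \<mu> w"
  have W: "0 \<le> W" unfolding W_def by (rule W2_square(4)[OF \<mu> \<sigma>])
  have A: "0 \<le> A" unfolding A_def by (rule nrm_nonneg)
  have wb[measurable]: "w \<in> borel_measurable borel" by (rule C1_maps_borel[OF w])
  have [measurable_cong]: "sets \<mu> = sets borel" by (rule M(2))
  have ws: "sqint \<mu> w" by (rule C1_maps_sqint[OF w M(4,1)])
  define p where "p t x = x - t *\<^sub>R w x" for t x
  define \<nu> where "\<nu> t = distr \<mu> borel (p t)" for t
  have ps: "sqint \<mu> (p t)" for t
    unfolding p_def by (intro sqint_diff sqint_scaleR ws M(4))
  have pm[measurable]: "p t \<in> \<mu> \<rightarrow>\<^sub>M borel" for t using ps[of t] by (simp add: sqint_def)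
  have pb[measurable]: "p t \<in> borel \<rightarrow>\<^sub>M borel" for t unfolding p_def by measurable
  have \<nu>P: "\<nu> t \<in> P2" for t unfolding \<nu>_def by (rule P2I_distr[OF M(1) ps])
  have id\<mu>: "distr \<mu> borel (\<lambda>x. x) = \<mu>"
    using distr_id2[of borel \<mu>] M(2) by simp
  have pid: "nrm \<mu> (\<lambda>x. p t x - x) = \<bar>t\<bar> * A" for t
    using nrm_scaleR[of \<mu> "- t" w] by (simp add: p_def A_def)
  have near: "W2 (\<nu> t) \<mu> \<le> \<bar>t\<bar> * A" for t
    using W2_le_nrm[OF \<nu>P \<mu> M(1) pm _ \<nu>_def[symmetric] id\<mu>, of t] pid[of t] by simp
  have lim0: "((\<lambda>t. \<bar>t\<bar> * A) \<longlongrightarrow> 0) (at_right 0)"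
    by (rule tendsto_eq_intros | simp)+
  have \<nu>lim: "filterlim \<nu> (W2_nhds \<mu>) (at_right 0)"
    unfolding W2_nhds_def filterlim_INF filterlim_principal
  proof
    fix e :: real assume "e \<in> {0<..}"
    then have "eventually (\<lambda>t. \<bar>t\<bar> * A < e) (at_right 0)"
      using order_tendstoD(2)[OF lim0] by auto
    then show "eventually (\<lambda>t. \<nu> t \<in> {\<nu> \<in> P2. W2 \<nu> \<mu> < e}) (at_right 0)"
      by eventually_elim (use \<nu>P in \<open>auto intro: le_less_trans[OF near]\<close>)
  qed
  have "filterlim (\<lambda>t. (\<nu> t, t)) (W2_nhds \<mu> \<times>\<^sub>F at_right 0) (at_right 0)"
    by (intro filterlim_Pair \<nu>lim filterlim_ident)
  then show ?thesis
    unfolding clarke_derivative_def L_def[symmetric]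
  proof (rule le_Limsup_filterlim)
    fix e :: real assume e: "0 < e"
    \<comment> \<open>Half of e is for the imperfect return to \<mu>, which costs at most 2 W \<eta>
      per unit time in squared distance; the other half is for t A^2.\<close>
    define \<eta> where "\<eta> = e / (4 * (W + 1))"
    have \<eta>: "0 < \<eta>" "2 * W * \<eta> \<le> e / 2" using e W by (auto simp: \<eta>_def field_simps)
    obtain d where d: "0 < d" and mod': "\<And>(M::'a measure) X X'. prob_space M \<Longrightarrow> sqint M X \<Longrightarrow>
      X' \<in> M \<rightarrow>\<^sub>M borel \<Longrightarrow> distr M borel X' = \<mu> \<Longrightarrow> nrm M (\<lambda>z. X z - X' z) < d \<Longrightarrow> nrm M (\<lambda>z. w (X z) - w (X' z)) \<le> \<eta>"
      using C1_maps_modulus[OF \<mu> w \<eta>(1)] by blast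
    have id_meas: "(\<lambda>x. x) \<in> \<mu> \<rightarrow>\<^sub>M borel" by simp
    note mod = mod'[OF M(1) _ id_meas id\<mu>]
    have "eventually (\<lambda>t. \<bar>t\<bar> * A < d) (at_right 0)"
      by (rule order_tendstoD(2)[OF lim0 d])
    moreover have "eventually (\<lambda>t. t * A\<^sup>2 < e / 2) (at_right 0)"
    proof (rule order_tendstoD(2))
      show "((\<lambda>t. t * A\<^sup>2) \<longlongrightarrow> 0) (at_right 0)" by (rule tendsto_eq_intros | simp)+
    qed (use e in simp)
    moreover have "eventually (\<lambda>t::real. 0 < t) (at_right 0)"
      by (rule eventually_at_right_less)
    ultimately show "eventually (\<lambda>t. ereal (2 * L - e) \<le> (case (\<nu> t, t) of (\<nu>, t) \<Rightarrow>
      ereal (((W2 (distr \<nu> borel (\<lambda>x. x + t *\<^sub>R w x)) \<sigma>)\<^sup>2 - (W2 \<nu> \<sigma>)\<^sup>2) / t))) (at_right 0)"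
    proof eventually_elim
      case (elim t)
      \<comment> \<open>The composite of \<open>p t\<close> followed by id + t w is id + t q, so q
        measures, per unit time, how far the return misses \<mu>.\<close>
      define q where "q x = w (p t x) - w x" for x
      have q: "nrm \<mu> q \<le> \<eta>"
        unfolding q_def using mod[OF ps] elim(1) pid[of t] by simp
      have qs: "sqint \<mu> q"
        unfolding q_def by (intro sqint_diff C1_maps_sqint[OF w ps M(1)] ws)
      define \<rho> where "\<rho> = distr (\<nu> t) borel (\<lambda>x. x + t *\<^sub>R w x)"
      have "\<rho> = distr \<mu> borel (\<lambda>x. p t x + t *\<^sub>R w (p t x))"
        unfolding \<rho>_def \<nu>_def by (subst distr_distr) (auto simp: comp_def)
      also have "(\<lambda>x. p t x + t *\<^sub>R w (p t x)) = (\<lambda>x. x + t *\<^sub>R q x)"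
        by (simp add: p_def q_def algebra_simps)
      finally have \<rho>: "\<rho> = distr \<mu> borel (\<lambda>x. x + t *\<^sub>R q x)" .
      have rs: "sqint \<mu> (\<lambda>x. x + t *\<^sub>R q x)"
        by (intro sqint_add sqint_scaleR qs M(4))
      then have rm: "(\<lambda>x. x + t *\<^sub>R q x) \<in> \<mu> \<rightarrow>\<^sub>M borel" by (simp add: sqint_def)
      have \<rho>P: "\<rho> \<in> P2" unfolding \<rho> by (rule P2I_distr[OF M(1) rs])
      define \<pi> where "\<pi> = distr \<mu> borel (\<lambda>x. (x + t *\<^sub>R q x, x))"
      have \<pi>: "\<pi> \<in> transport_plans \<rho> \<mu>"
        unfolding \<pi>_def by (rule transport_plansI[OF M(1) rm _ \<rho>[symmetric] id\<mu>]) simp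
      have "transport_cost \<pi> = (t * nrm \<mu> q)\<^sup>2"
        unfolding \<pi>_def by (subst transport_cost_distr_Pair[OF rm]) (auto simp: nrm_scaleR power_mult_distrib)
      then have "sqrt (transport_cost \<pi>) = t * nrm \<mu> q"
        using elim(3) by (simp add: nrm_nonneg)
      moreover have "t * nrm \<mu> q \<le> t * \<eta>" using q elim(3) by simp
      ultimately have lip: "W \<le> t * \<eta> + W2 \<rho> \<sigma>"
        using W2_triangle_plan[OF \<rho>P \<mu> \<sigma> \<pi>] by (simp add: W_def)
      \<comment> \<open>Squaring \<open>lip\<close> requires W - t \<eta> to be nonnegative;
        otherwise the left-hand side here is itself at most 0.\<close>
      have \<rho>_ge: "W\<^sup>2 - 2 * W * (t * \<eta>) \<le> (W2 \<rho> \<sigma>)\<^sup>2"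
      proof (cases "t * \<eta> \<le> W")
        case True
        then have "(W - t * \<eta>)\<^sup>2 \<le> (W2 \<rho> \<sigma>)\<^sup>2"
          using lip by (intro power_mono) auto
        moreover have "(W - t * \<eta>)\<^sup>2 = W\<^sup>2 - 2 * W * (t * \<eta>) + (t * \<eta>)\<^sup>2"
          by (simp add: power2_diff)
        ultimately show ?thesis using zero_le_power2[of "t * \<eta>"] by linarith
      next
        case False
        then have "W * W \<le> W * (t * \<eta>)" using W by (intro mult_left_mono) auto
        moreover have "0 \<le> W * W" "0 \<le> (W2 \<rho> \<sigma>)\<^sup>2" by simp_all
        ultimately show ?thesis unfolding power2_eq_square[of W] by linarith
      qed
      have \<nu>_le: "(W2 (\<nu> t) \<sigma>)\<^sup>2 \<le> W\<^sup>2 - 2 * t * L + t\<^sup>2 * A\<^sup>2"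
        using W2_square_perturb_le[OF \<mu> \<sigma> \<gamma>T(1) ws, of "- t"]
        by (simp add: \<nu>_def p_def[abs_def] L_def A_def W_def \<gamma>T(2))
      have "2 * L - e \<le> 2 * L - t * A\<^sup>2 - 2 * W * \<eta>"
        using elim(2) \<eta>(2) by linarith
      also have "\<dots> = (W\<^sup>2 - 2 * W * (t * \<eta>) - (W\<^sup>2 - 2 * t * L + t\<^sup>2 * A\<^sup>2)) / t"
        using elim(3) by (simp add: field_simps power2_eq_square)
      also have "\<dots> \<le> ((W2 \<rho> \<sigma>)\<^sup>2 - (W2 (\<nu> t) \<sigma>)\<^sup>2) / t"
        using \<rho>_ge \<nu>_le elim(3) by (intro divide_right_mono) auto
      finally show ?case by (simp add: \<rho>_def)
    qed
  qed simp
qed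

section \<open>Barycentric projections and separation\<close>

text \<open>The barycentric projection is the conditional mean of y given x, so pairing it with a
  function of x amounts to pairing y with that function. Membership in L2 is Jensen's inequality in
  each fibre, obtained from Cauchy-Schwarz; fibres with infinite second moment, where the Bochner
  integral may be a default value, occur only over a null set.\<close>

lemma
  assumes \<mu>: "\<mu> \<in> P2" and \<sigma>: "\<sigma> \<in> P2" and \<gamma>: "\<gamma> \<in> transport_plans \<mu> \<sigma>"
  shows barycentric_projection_sqint: "sqint \<mu> (barycentric_projection \<gamma>)"
    and barycentric_projection_inner: "sqint \<mu> f \<Longrightarrow>
      L2_inner \<mu> (barycentric_projection \<gamma>) f = (\<integral>z. f (fst z) \<bullet> snd z \<partial>\<gamma>)"
proof -
  note T = transport_plansD[OF \<gamma>] and M = P2D[OF \<mu>]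
  define k where "k = disintegration \<gamma>"
  define B where "B = barycentric_projection \<gamma>"
  have B: "B x = (\<integral>y. y \<partial>k x)" for x
    by (simp add: B_def k_def barycentric_projection_def)
  have "is_disintegration \<gamma> k"
    unfolding k_def by (rule is_disintegration_disintegration[OF T(1,2)])
  then have kb: "k \<in> borel \<rightarrow>\<^sub>M prob_algebra borel" and \<gamma>k: "\<gamma> = kernel_prod \<mu> borel k"
    by (simp_all add: is_disintegration_kernel_prod[OF T(1,2)] T(4))
  have k: "k \<in> \<mu> \<rightarrow>\<^sub>M prob_algebra borel"
    using kb by (simp cong: measurable_cong_sets add: M(2))
  have kx: "prob_space (k x)" "sets (k x) = sets borel" for x
    using prob_space_prob_kernel[OF M(1) k] sets_prob_kernel[OF M(1) k] by (auto simp: M(3))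
  have Bm[measurable]: "B \<in> borel_measurable \<mu>"
    unfolding B
    by (rule measurable_compose[OF measurable_prob_algebraD[OF k] integral_measurable_subprob_algebra]) simp
  have \<mu>b: "sets (\<mu> \<Otimes>\<^sub>M borel) = sets (borel :: ('a \<times> 'a) measure)"
    unfolding borel_prod[symmetric] by (rule sets_pair_measure_cong) (auto simp: M)
  have ss: "sqint \<gamma> snd"
    using transport_plans_sqint(3)[OF \<gamma> P2D(4)[OF \<sigma>]] by simp
  have AE_sq: "AE x in \<mu>. integrable (k x) (\<lambda>y. (norm y)\<^sup>2)"
    using AE_integrable_kernel_prod[OF M(1) k, of "\<lambda>z. (norm (snd z))\<^sup>2"] sqint_integrable[OF ss]
    by (simp add: \<gamma>k[symmetric])
  have int_id: "integrable (k x) (\<lambda>y. y)" if "integrable (k x) (\<lambda>y. (norm y)\<^sup>2)" for x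
  proof (rule Bochner_Integration.integrable_bound)
    interpret prob_space "k x" by (rule kx)
    show "integrable (k x) (\<lambda>y. 1 + (norm y)\<^sup>2)" using that by simp
    show "(\<lambda>y. y) \<in> borel_measurable (k x)" by (simp cong: measurable_cong_sets add: kx)
    have "norm y \<le> 1 + (norm y)\<^sup>2" for y :: 'a
      using sum_squares_bound[of 1 "norm y"] norm_ge_zero[of y] unfolding power_one mult_1_right by linarith
    then show "AE y in k x. norm y \<le> norm (1 + (norm y)\<^sup>2)" by (intro AE_I2) simp
  qed
  have jensen: "ennreal ((norm (B x))\<^sup>2) \<le> (\<integral>\<^sup>+y. ennreal ((norm y)\<^sup>2) \<partial>k x)"
    if sq: "integrable (k x) (\<lambda>y. (norm y)\<^sup>2)" for x
  proof -
    interpret prob_space "k x" by (rule kx)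
    have [measurable_cong]: "sets (k x) = sets borel" by (rule kx)
    have "ennreal (norm (B x)) \<le> (\<integral>\<^sup>+y. ennreal (norm y) \<partial>k x)"
      unfolding B by (rule integral_norm_bound_ennreal[OF int_id[OF sq]])
    then have "(ennreal (norm (B x)))\<^sup>2 \<le> (\<integral>\<^sup>+y. ennreal (norm y) * 1 \<partial>k x)\<^sup>2"
      by (intro power_mono) auto
    also have "\<dots> \<le> (\<integral>\<^sup>+y. (ennreal (norm y))\<^sup>2 \<partial>k x) * (\<integral>\<^sup>+y. 1\<^sup>2 \<partial>k x)"
      by (rule Cauchy_Schwarz_nn_integral) measurable
    finally show ?thesis by (simp add: ennreal_power emeasure_space_1)
  qed
  show Bsq: "sqint \<mu> (barycentric_projection \<gamma>)"
    unfolding B_def[symmetric] sqint_def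
  proof
    have "(\<integral>\<^sup>+x. ennreal ((norm (B x))\<^sup>2) \<partial>\<mu>) \<le> (\<integral>\<^sup>+x. \<integral>\<^sup>+y. ennreal ((norm y)\<^sup>2) \<partial>k x \<partial>\<mu>)"
      using AE_sq by (intro nn_integral_mono_AE, eventually_elim) (rule jensen)
    also have "\<dots> = (\<integral>\<^sup>+z. ennreal ((norm (snd z))\<^sup>2) \<partial>\<gamma>)"
      unfolding \<gamma>k by (subst nn_integral_kernel_prod[OF M(1) k]) auto
    also have "\<dots> < \<infinity>"
      using sqint_integrable[OF ss] by (simp add: integrable_iff_bounded)
    finally show "integrable \<mu> (\<lambda>x. (norm (B x))\<^sup>2)"
      by (intro integrableI_bounded) auto
  qed (rule Bm)
  assume f: "sqint \<mu> f"
  have fm[measurable]: "f \<in> borel_measurable \<mu>" using f by (simp add: sqint_def)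
  have "integrable \<gamma> (\<lambda>z. f (fst z) \<bullet> snd z)"
    using transport_plans_inner_bound(1)[OF \<gamma> f P2D(4)[OF \<sigma>]] .
  then have "(\<integral>z. f (fst z) \<bullet> snd z \<partial>\<gamma>) = (\<integral>x. \<integral>y. f x \<bullet> y \<partial>k x \<partial>\<mu>)"
    using integral_kernel_prod[OF M(1) k, of "\<lambda>z. f (fst z) \<bullet> snd z"] by (simp add: \<gamma>k[symmetric])
  also have "\<dots> = (\<integral>x. B x \<bullet> f x \<partial>\<mu>)"
  proof (rule integral_cong_AE)
    show eq: "AE x in \<mu>. (\<integral>y. f x \<bullet> y \<partial>k x) = B x \<bullet> f x"
      using AE_sq by eventually_elim (simp add: B int_id inner_commute[of _ "f _"])
    show "(\<lambda>x. B x \<bullet> f x) \<in> borel_measurable \<mu>" by measurable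
    have "(\<lambda>z. f (fst z) \<bullet> snd z) \<in> borel_measurable (\<mu> \<Otimes>\<^sub>M borel)" by measurable
    from integral_kernel_measurable[OF M(1) k this]
    show "(\<lambda>x. \<integral>y. f x \<bullet> y \<partial>k x) \<in> borel_measurable \<mu>" by simp
  qed
  finally show "L2_inner \<mu> (barycentric_projection \<gamma>) f = (\<integral>z. f (fst z) \<bullet> snd z \<partial>\<gamma>)"
    by (simp add: L2_inner_def B_def)
qed

section \<open>Convex combinations of maps and separation in L2\<close>

lemma nrm_sum_le:
  "finite I \<Longrightarrow> (\<And>i. i \<in> I \<Longrightarrow> sqint M (f i)) \<Longrightarrow> nrm M (\<lambda>x. \<Sum>i\<in>I. f i x) \<le> (\<Sum>i\<in>I. nrm M (f i))"
proof (induction I rule: finite_induct)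
  case empty
  then show ?case by (simp add: nrm_def)
next
  case (insert i I)
  have "nrm M (\<lambda>x. f i x + (\<Sum>i\<in>I. f i x)) \<le> nrm M (f i) + nrm M (\<lambda>x. \<Sum>i\<in>I. f i x)"
    using insert by (intro nrm_triangle sqint_sum) auto
  with insert show ?case by simp
qed

lemma L2_inner_sum:
  assumes "finite F" "\<And>f. f \<in> F \<Longrightarrow> sqint \<mu> f" "sqint \<mu> w"
  shows "L2_inner \<mu> (\<lambda>x. \<Sum>f\<in>F. c f *\<^sub>R f x) w = (\<Sum>f\<in>F. c f * L2_inner \<mu> f w)"
  using assms unfolding L2_inner_def
  by (simp add: inner_sum_left sqint_inner)

lemma L2_inner_diff:
  assumes "sqint \<mu> f" "sqint \<mu> g" "sqint \<mu> w"
  shows "L2_inner \<mu> (\<lambda>x. f x - g x) w = L2_inner \<mu> f w - L2_inner \<mu> g w"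
  using assms by (simp add: L2_inner_def inner_diff_left sqint_inner)

lemma abs_L2_inner_le: "sqint \<mu> f \<Longrightarrow> sqint \<mu> w \<Longrightarrow> \<bar>L2_inner \<mu> f w\<bar> \<le> nrm \<mu> f * nrm \<mu> w"
  unfolding L2_inner_def by (rule sqint_Cauchy_Schwarz)

lemma fun_convex_hull_superset: "f \<in> S \<Longrightarrow> f \<in> fun_convex_hull S"
  unfolding fun_convex_hull_def by (rule CollectI, rule exI[of _ "{f}"], rule exI[of _ "\<lambda>_. 1"]) simp

lemma fun_convex_hull_sqint:
  assumes S: "\<And>f. f \<in> S \<Longrightarrow> sqint \<mu> f" "\<And>f. f \<in> S \<Longrightarrow> nrm \<mu> f \<le> b" and g: "g \<in> fun_convex_hull S"
  shows "sqint \<mu> g" "nrm \<mu> g \<le> b"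
proof -
  obtain F c where g: "g = (\<lambda>x. \<Sum>f\<in>F. c f *\<^sub>R f x)" and F: "finite F" "F \<subseteq> S"
    and c: "\<And>f. f \<in> F \<Longrightarrow> 0 \<le> c f" "sum c F = 1"
    using g by (auto simp: fun_convex_hull_def)
  have sq: "sqint \<mu> (\<lambda>x. c f *\<^sub>R f x)" if "f \<in> F" for f
    using that F S by (intro sqint_scaleR) auto
  show "sqint \<mu> g" unfolding g by (rule sqint_sum[OF F(1) sq])
  have "nrm \<mu> g \<le> (\<Sum>f\<in>F. nrm \<mu> (\<lambda>x. c f *\<^sub>R f x))"
    unfolding g by (rule nrm_sum_le[OF F(1) sq])
  also have "\<dots> \<le> (\<Sum>f\<in>F. c f * b)"
    using F S(2) c by (intro sum_mono) (auto simp: nrm_scaleR intro!: mult_left_mono)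
  also have "\<dots> = b" by (simp add: c flip: sum_distrib_right)
  finally show "nrm \<mu> g \<le> b" .
qed

text \<open>A weighted average of the finitely many values at the generators is at most their
  maximum, which is attained.\<close>

lemma fun_convex_hull_inner_le:
  assumes S: "\<And>f. f \<in> S \<Longrightarrow> sqint \<mu> f" and w: "sqint \<mu> w" and g: "g \<in> fun_convex_hull S"
  shows "\<exists>f\<in>S. L2_inner \<mu> g w \<le> L2_inner \<mu> f w"
proof -
  obtain F c where g: "g = (\<lambda>x. \<Sum>f\<in>F. c f *\<^sub>R f x)" and F: "finite F" "F \<subseteq> S"
    and c: "\<And>f. f \<in> F \<Longrightarrow> 0 \<le> c f" "sum c F = 1"
    using g by (auto simp: fun_convex_hull_def)
  have "F \<noteq> {}" using c(2) by auto
  define m where "m = Max ((\<lambda>f. L2_inner \<mu> f w) ` F)"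
  have "m \<in> (\<lambda>f. L2_inner \<mu> f w) ` F"
    unfolding m_def using F(1) \<open>F \<noteq> {}\<close> by (intro Max_in) auto
  then obtain f where f: "f \<in> F" "m = L2_inner \<mu> f w" by auto
  have "L2_inner \<mu> g w = (\<Sum>f\<in>F. c f * L2_inner \<mu> f w)"
    unfolding g using F S w by (intro L2_inner_sum) auto
  also have "\<dots> \<le> (\<Sum>f\<in>F. c f * m)"
    using F(1) c(1) by (intro sum_mono mult_left_mono) (auto simp: m_def)
  also have "\<dots> = m" by (simp add: c flip: sum_distrib_right)
  finally show ?thesis using f F by auto
qed

lemma fun_convex_hull_convex:
  assumes g: "g \<in> fun_convex_hull S" and h: "h \<in> fun_convex_hull S" and s: "0 \<le> s" "s \<le> 1"
  shows "(\<lambda>x. g x + s *\<^sub>R (h x - g x)) \<in> fun_convex_hull S"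
proof -
  obtain F c where g: "g = (\<lambda>x. \<Sum>f\<in>F. c f *\<^sub>R f x)" and F: "finite F" "F \<subseteq> S"
    and c: "\<And>f. f \<in> F \<Longrightarrow> 0 \<le> c f" "sum c F = 1"
    using g by (auto simp: fun_convex_hull_def)
  obtain E d where h: "h = (\<lambda>x. \<Sum>f\<in>E. d f *\<^sub>R f x)" and E: "finite E" "E \<subseteq> S"
    and d: "\<And>f. f \<in> E \<Longrightarrow> 0 \<le> d f" "sum d E = 1"
    using h by (auto simp: fun_convex_hull_def)
  \<comment> \<open>Extending both families of coefficients by 0 to \<open>F \<union> E\<close> lets
    the combinations be added termwise; a map occurring in both receives both contributions.\<close>
  define c' where "c' f = (if f \<in> F then c f else 0)" for f
  define d' where "d' f = (if f \<in> E then d f else 0)" for f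
  have c'0: "0 \<le> c' f" and d'0: "0 \<le> d' f" for f
    using c(1) d(1) by (auto simp: c'_def d'_def)
  have c's: "sum c' (F \<union> E) = 1"
    unfolding c(2)[symmetric] using F(1) E(1)
    by (intro sum.mono_neutral_cong_right) (auto simp: c'_def)
  have d's: "sum d' (F \<union> E) = 1"
    unfolding d(2)[symmetric] using F(1) E(1)
    by (intro sum.mono_neutral_cong_right) (auto simp: d'_def)
  have g': "g x = (\<Sum>f\<in>F \<union> E. c' f *\<^sub>R f x)" for x
    unfolding g using F(1) E(1) by (intro sum.mono_neutral_cong_left) (auto simp: c'_def)
  have h': "h x = (\<Sum>f\<in>F \<union> E. d' f *\<^sub>R f x)" for x
    unfolding h using F(1) E(1) by (intro sum.mono_neutral_cong_left) (auto simp: d'_def)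
  define b where "b f = (1 - s) * c' f + s * d' f" for f
  have "(\<lambda>x. g x + s *\<^sub>R (h x - g x)) = (\<lambda>x. \<Sum>f\<in>F \<union> E. b f *\<^sub>R f x)"
  proof
    fix x
    have "g x + s *\<^sub>R (h x - g x) = (1 - s) *\<^sub>R g x + s *\<^sub>R h x"
      by (simp add: algebra_simps)
    also have "\<dots> = (\<Sum>f\<in>F \<union> E. b f *\<^sub>R f x)"
      by (simp add: g' h' b_def scaleR_sum_right scaleR_add_left sum.distrib)
    finally show "g x + s *\<^sub>R (h x - g x) = (\<Sum>f\<in>F \<union> E. b f *\<^sub>R f x)" .
  qed
  moreover have "\<forall>f\<in>F \<union> E. 0 \<le> b f" using s c'0 d'0 by (simp add: b_def)
  moreover have "sum b (F \<union> E) = 1"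
    by (simp add: b_def sum.distrib c's d's flip: sum_distrib_left)
  moreover have "finite (F \<union> E)" "F \<union> E \<subseteq> S" using F E by auto
  ultimately show ?thesis unfolding fun_convex_hull_def by blast
qed

text \<open>Separation without completeness: a nearly closest point of the convex set already yields a
  separating direction.\<close>

lemma sqint_convex_separation:
  fixes \<Xi> :: "'a::euclidean_space \<Rightarrow> 'a"
  assumes \<Xi>: "sqint \<mu> \<Xi>" and e: "0 < e" and ne: "K \<noteq> {}"
    and K: "\<And>g. g \<in> K \<Longrightarrow> sqint \<mu> g" "\<And>g. g \<in> K \<Longrightarrow> nrm \<mu> g \<le> b"
    and conv: "\<And>g h s. g \<in> K \<Longrightarrow> h \<in> K \<Longrightarrow> 0 \<le> s \<Longrightarrow> s \<le> 1 \<Longrightarrow> (\<lambda>x. g x + s *\<^sub>R (h x - g x)) \<in> K"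
    and far: "\<And>g. g \<in> K \<Longrightarrow> e \<le> nrm \<mu> (\<lambda>x. \<Xi> x - g x)"
  shows "\<exists>v. sqint \<mu> v \<and> (\<forall>g\<in>K. e\<^sup>2 / 2 \<le> L2_inner \<mu> \<Xi> v - L2_inner \<mu> g v)"
proof -
  define N where "N g = (nrm \<mu> (\<lambda>x. \<Xi> x - g x))\<^sup>2" for g
  define i where "i = (INF g\<in>K. N g)"
  have bdd: "bdd_below (N ` K)" by (rule bdd_belowI2[of _ 0]) (simp add: N_def)
  have i_le: "i \<le> N g" if "g \<in> K" for g
    unfolding i_def by (rule cINF_lower[OF bdd that])
  have i_ge: "e\<^sup>2 \<le> i"
    unfolding i_def using far e by (intro cINF_greatest[OF ne]) (auto simp: N_def intro: power_mono)
  \<comment> \<open>Step length along the segment from \<xi> to g. The quadratic term, in which |g -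
    \<xi>|^2 is at most 4 b^2, then costs at most e^2 / 2 per unit of s.\<close>
  define s where "s = min 1 (e\<^sup>2 / (2 * (4 * b\<^sup>2 + 1)))"
  have pos: "0 < 4 * b\<^sup>2 + 1" by (simp add: add_nonneg_pos)
  have s: "0 < s" "s \<le> 1" "s * (4 * b\<^sup>2) \<le> e\<^sup>2 / 2"
  proof -
    have "s * (4 * b\<^sup>2 + 1) \<le> e\<^sup>2 / (2 * (4 * b\<^sup>2 + 1)) * (4 * b\<^sup>2 + 1)"
      using pos by (intro mult_right_mono) (auto simp: s_def)
    also have "\<dots> = e\<^sup>2 / 2" using pos by (simp add: field_simps)
    finally have "s * (4 * b\<^sup>2) + s \<le> e\<^sup>2 / 2" by (simp add: algebra_simps)
    moreover show "0 < s" using e pos by (simp add: s_def)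
    ultimately show "s * (4 * b\<^sup>2) \<le> e\<^sup>2 / 2" by linarith
  qed (simp add: s_def)
  \<comment> \<open>The defect from minimality allowed to \<xi>. It scales with s, so that division
    by 2s bounds the pairing of v with g - \<xi> by e^2 / 2; as |v|^2 is at least e^2, a gap of e^2
    / 2 remains.\<close>
  define d where "d = s * e\<^sup>2 / 2"
  have d: "0 < d" using s e by (simp add: d_def)
  obtain \<xi> where \<xi>: "\<xi> \<in> K" "N \<xi> < i + d"
    using cINF_less_iff[OF ne bdd, of "i + d"] d by (auto simp: i_def)
  define v where "v x = \<Xi> x - \<xi> x" for x
  have v: "sqint \<mu> v" unfolding v_def by (intro sqint_diff \<Xi> K \<xi>)
  have "e\<^sup>2 / 2 \<le> L2_inner \<mu> \<Xi> v - L2_inner \<mu> g v" if g: "g \<in> K" for g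
  proof -
    define u where "u x = g x - \<xi> x" for x
    have u: "sqint \<mu> u" unfolding u_def by (intro sqint_diff K \<xi> g)
    have "nrm \<mu> u \<le> 2 * b"
      using nrm_triangle[OF K(1)[OF g] sqint_scaleR[OF K(1)[OF \<xi>(1)], of "-1"]] nrm_scaleR[of \<mu> "-1" \<xi>]
        K(2)[OF g] K(2)[OF \<xi>(1)] by (simp add: u_def[abs_def])
    then have ub: "(nrm \<mu> u)\<^sup>2 \<le> 4 * b\<^sup>2"
      using power_mono[of "nrm \<mu> u" "2 * b" 2] by (simp add: nrm_nonneg power_mult_distrib)
    have "i \<le> N (\<lambda>x. \<xi> x + s *\<^sub>R (g x - \<xi> x))"
      using s by (intro i_le conv \<xi> g) auto
    also have "\<dots> = (nrm \<mu> (\<lambda>x. v x + (- s) *\<^sub>R u x))\<^sup>2"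
      by (simp add: N_def v_def u_def algebra_simps)
    also have "\<dots> = (nrm \<mu> v)\<^sup>2 - 2 * s * L2_inner \<mu> v u + s\<^sup>2 * (nrm \<mu> u)\<^sup>2"
      by (subst nrm_square_add[OF v sqint_scaleR[OF u]])
         (use nrm_scaleR[of \<mu> "- s" u] in \<open>simp add: L2_inner_def power_mult_distrib\<close>)
    also have "(nrm \<mu> v)\<^sup>2 = N \<xi>" by (simp add: N_def v_def[abs_def])
    finally have "2 * s * L2_inner \<mu> v u \<le> d + s\<^sup>2 * (nrm \<mu> u)\<^sup>2"
      using \<xi>(2) by linarith
    also have "\<dots> \<le> d + s\<^sup>2 * (4 * b\<^sup>2)"
      using ub by (intro add_left_mono mult_left_mono) auto
    also have "\<dots> = d + s * (s * (4 * b\<^sup>2))"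
      by (simp add: power2_eq_square)
    also have "\<dots> \<le> d + s * (e\<^sup>2 / 2)"
      using s by (intro add_left_mono mult_left_mono) auto
    also have "\<dots> = 2 * s * (e\<^sup>2 / 2)" by (simp add: d_def)
    finally have vu: "L2_inner \<mu> v u \<le> e\<^sup>2 / 2"
      using s(1) by simp
    have "e\<^sup>2 \<le> L2_inner \<mu> v v"
      using i_ge i_le[OF \<xi>(1)] by (simp add: N_def v_def[symmetric] nrm_square L2_inner_def power2_norm_eq_inner)
    moreover have "L2_inner \<mu> \<Xi> v - L2_inner \<mu> g v = L2_inner \<mu> v v - L2_inner \<mu> v u"
    proof -
      have "L2_inner \<mu> v u = L2_inner \<mu> u v" by (simp add: L2_inner_def inner_commute)
      then show ?thesis
        using L2_inner_diff[OF \<Xi> K(1)[OF \<xi>(1)] v] L2_inner_diff[OF K(1)[OF g] K(1)[OF \<xi>(1)] v]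
        by (simp add: v_def[symmetric] u_def[symmetric])
    qed
    ultimately show ?thesis using vu by linarith
  qed
  with v show ?thesis by blast
qed

lemma bounded_continuous_C1_maps:
  assumes "continuous_on UNIV w" "bounded (range w)"
  shows "w \<in> C1_maps"
proof -
  obtain b where b: "\<And>x. norm (w x) \<le> b"
    using assms(2) by (auto simp: bounded_iff)
  have "norm (w x) / (1 + norm x) \<le> b" for x
  proof -
    have "norm (w x) / (1 + norm x) \<le> norm (w x) / 1"
      by (intro divide_left_mono) (auto simp: add_pos_nonneg)
    then show ?thesis using b[of x] by simp
  qed
  then show ?thesis using assms(1) by (auto simp: C1_maps_def bdd_above_def)
qed

section \<open>Identification of the subdifferential with the closed convex hull\<close>

theorem theorem4p3:
  fixes \<mu> \<sigma> :: "'a::euclidean_space measure"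
  assumes "\<mu> \<in> P2" and "\<sigma> \<in> P2"
  shows "clarke_subdifferential (\<lambda>\<nu>. (W2 \<nu> \<sigma>)\<^sup>2) \<mu> =
         L2_closure \<mu> (fun_convex_hull
           {(\<lambda>x. 2 *\<^sub>R x - 2 *\<^sub>R barycentric_projection \<gamma> x) | \<gamma>. \<gamma> \<in> optimal_plans \<mu> \<sigma>})"
proof -
  note \<mu> = assms(1) and \<sigma> = assms(2)
  note M = P2D[OF \<mu>]
  define D where "D = clarke_derivative (\<lambda>\<nu>. (W2 \<nu> \<sigma>)\<^sup>2) \<mu>"
  define \<Phi> where "\<Phi> \<gamma> x = 2 *\<^sub>R x - 2 *\<^sub>R barycentric_projection \<gamma> x" for \<gamma> and x :: 'a
  define S where "S = {\<Phi> \<gamma> | \<gamma>. \<gamma> \<in> optimal_plans \<mu> \<sigma>}"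
  have S_eq: "S = {(\<lambda>x. 2 *\<^sub>R x - 2 *\<^sub>R barycentric_projection \<gamma> x) | \<gamma>. \<gamma> \<in> optimal_plans \<mu> \<sigma>}"
    by (simp add: S_def \<Phi>_def[abs_def])
  have ws: "sqint \<mu> w" if "w \<in> C1_maps" for w :: "'a \<Rightarrow> 'a"
    by (rule C1_maps_sqint[OF that M(4,1)])
  have \<Phi>: "sqint \<mu> (\<Phi> \<gamma>)" "nrm \<mu> (\<Phi> \<gamma>) \<le> 2 * nrm \<mu> (\<lambda>x. x) + 2 * nrm \<sigma> (\<lambda>x. x)"
    "\<And>w :: 'a \<Rightarrow> 'a. sqint \<mu> w \<Longrightarrow> L2_inner \<mu> (\<Phi> \<gamma>) w = 2 * displacement_inner \<gamma> w"
    if "\<gamma> \<in> optimal_plans \<mu> \<sigma>" for \<gamma>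
  proof -
    have \<gamma>: "\<gamma> \<in> transport_plans \<mu> \<sigma>" using that by (simp add: optimal_plans_def)
    define B where "B = barycentric_projection \<gamma>"
    have B: "sqint \<mu> B" "\<And>f. sqint \<mu> f \<Longrightarrow> L2_inner \<mu> B f = (\<integral>z. f (fst z) \<bullet> snd z \<partial>\<gamma>)"
      unfolding B_def using barycentric_projection_sqint[OF \<mu> \<sigma> \<gamma>] barycentric_projection_inner[OF \<mu> \<sigma> \<gamma>] by auto
    have \<Phi>B: "\<Phi> \<gamma> = (\<lambda>x. 2 *\<^sub>R x - 2 *\<^sub>R B x)" by (simp add: \<Phi>_def[abs_def] B_def)
    have two: "sqint \<mu> (\<lambda>x. 2 *\<^sub>R x)" "sqint \<mu> (\<lambda>x. 2 *\<^sub>R B x)"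
      by (intro sqint_scaleR M(4) B(1))+
    show "sqint \<mu> (\<Phi> \<gamma>)" unfolding \<Phi>B by (rule sqint_diff[OF two])
    \<comment> \<open>Pairing B with itself shows that its norm is at most that of the second
      marginal, which bounds S uniformly in L2.\<close>
    have "(nrm \<mu> B)\<^sup>2 \<le> nrm \<mu> B * nrm \<sigma> (\<lambda>x. x)"
    proof -
      have "(nrm \<mu> B)\<^sup>2 = (\<integral>z. B (fst z) \<bullet> snd z \<partial>\<gamma>)"
        using B(2)[OF B(1)] by (simp add: nrm_square L2_inner_def power2_norm_eq_inner)
      then show ?thesis
        using transport_plans_inner_bound(2)[OF \<gamma> B(1) P2D(4)[OF \<sigma>]] by linarith
    qed
    then have nB: "nrm \<mu> B \<le> nrm \<sigma> (\<lambda>x. x)"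
      using nrm_nonneg[of \<mu> B] nrm_nonneg[of \<sigma> "\<lambda>x. x"]
      by (cases "nrm \<mu> B = 0") (auto simp: power2_eq_square)
    have "nrm \<mu> (\<lambda>x. 2 *\<^sub>R x + (-1) *\<^sub>R (2 *\<^sub>R B x)) \<le> 2 * nrm \<mu> (\<lambda>x. x) + 2 * nrm \<mu> B"
      using nrm_triangle[OF two(1) sqint_scaleR[OF two(2), of "-1"]]
        nrm_scaleR[of \<mu> 2 "\<lambda>x. x"] nrm_scaleR[of \<mu> "-1" "\<lambda>x. 2 *\<^sub>R B x"] nrm_scaleR[of \<mu> 2 B] by simp
    then show "nrm \<mu> (\<Phi> \<gamma>) \<le> 2 * nrm \<mu> (\<lambda>x. x) + 2 * nrm \<sigma> (\<lambda>x. x)"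
      using nB by (simp add: \<Phi>B)
    fix w :: "'a \<Rightarrow> 'a" assume w: "sqint \<mu> w"
    have "L2_inner \<mu> (\<Phi> \<gamma>) w = 2 * L2_inner \<mu> (\<lambda>x. x) w - 2 * L2_inner \<mu> B w"
      unfolding \<Phi>B using L2_inner_diff[OF two w] by (simp add: L2_inner_def)
    then show "L2_inner \<mu> (\<Phi> \<gamma>) w = 2 * displacement_inner \<gamma> w"
      using transport_plans_diff_inner[OF \<mu> \<sigma> \<gamma> w] B(2)[OF w] by simp
  qed
  have S_sq: "sqint \<mu> f" "nrm \<mu> f \<le> 2 * nrm \<mu> (\<lambda>x. x) + 2 * nrm \<sigma> (\<lambda>x. x)" if "f \<in> S" for f
    using that \<Phi>(1,2) by (auto simp: S_def)
  have K_sq: "sqint \<mu> g" "nrm \<mu> g \<le> 2 * nrm \<mu> (\<lambda>x. x) + 2 * nrm \<sigma> (\<lambda>x. x)"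
    if "g \<in> fun_convex_hull S" for g
    using fun_convex_hull_sqint[OF _ _ that] S_sq by blast+
  have S_le: "ereal (L2_inner \<mu> f w) \<le> D w" if "f \<in> S" "w \<in> C1_maps" for f w
    using that \<Phi>(3)[OF _ ws] clarke_derivative_ge[OF \<mu> \<sigma>] by (auto simp: S_def D_def)
  have "clarke_subdifferential (\<lambda>\<nu>. (W2 \<nu> \<sigma>)\<^sup>2) \<mu> = L2_closure \<mu> (fun_convex_hull S)"
  proof (intro set_eqI iffI)
    fix \<Xi> assume "\<Xi> \<in> L2_closure \<mu> (fun_convex_hull S)"
    then have \<Xi>: "sqint \<mu> \<Xi>" and approx: "\<And>e. 0 < e \<Longrightarrow> \<exists>g\<in>fun_convex_hull S. nrm \<mu> (\<lambda>x. \<Xi> x - g x) < e"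
      by (auto simp: L2_closure_def L2_iff_sqint L2_norm_eq_nrm)
    \<comment> \<open>A nearby hull element is dominated in direction w by one of its generators, to
      which \<open>clarke_derivative_ge\<close> applies; the approximation costs at most d * nrm
      \<mu> w.\<close>
    have "ereal (L2_inner \<mu> \<Xi> w) \<le> D w" if w: "w \<in> C1_maps" for w
    proof (rule ereal_le_epsilon2)
      fix e :: real assume e: "0 < e"
      define d where "d = e / (nrm \<mu> w + 1)"
      have d: "0 < d" "d * nrm \<mu> w \<le> e"
        using e nrm_nonneg[of \<mu> w] by (auto simp: d_def field_simps add_pos_nonneg)
      obtain g where g: "g \<in> fun_convex_hull S" "nrm \<mu> (\<lambda>x. \<Xi> x - g x) < d"
        using approx[OF d(1)] by blast
      note gs = K_sq(1)[OF g(1)]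
      obtain f where f: "f \<in> S" "L2_inner \<mu> g w \<le> L2_inner \<mu> f w"
        using fun_convex_hull_inner_le[OF S_sq(1) ws[OF w] g(1)] by blast
      have "L2_inner \<mu> \<Xi> w - L2_inner \<mu> g w \<le> nrm \<mu> (\<lambda>x. \<Xi> x - g x) * nrm \<mu> w"
        using abs_L2_inner_le[OF sqint_diff[OF \<Xi> gs] ws[OF w]] L2_inner_diff[OF \<Xi> gs ws[OF w]] by linarith
      also have "\<dots> \<le> d * nrm \<mu> w"
        using g(2) by (intro mult_right_mono) (auto simp: nrm_nonneg)
      finally have "L2_inner \<mu> \<Xi> w \<le> L2_inner \<mu> f w + e"
        using f(2) d(2) by linarith
      then have "ereal (L2_inner \<mu> \<Xi> w) \<le> ereal (L2_inner \<mu> f w) + ereal e" by simp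
      also have "\<dots> \<le> D w + ereal e"
        by (rule add_right_mono[OF S_le[OF f(1) w]])
      finally show "ereal (L2_inner \<mu> \<Xi> w) \<le> D w + ereal e" .
    qed
    with \<Xi> show "\<Xi> \<in> clarke_subdifferential (\<lambda>\<nu>. (W2 \<nu> \<sigma>)\<^sup>2) \<mu>"
      by (simp add: clarke_subdifferential_def L2_iff_sqint D_def)
  next
    fix \<Xi> assume "\<Xi> \<in> clarke_subdifferential (\<lambda>\<nu>. (W2 \<nu> \<sigma>)\<^sup>2) \<mu>"
    then have \<Xi>: "sqint \<mu> \<Xi>" and sub: "\<And>w. w \<in> C1_maps \<Longrightarrow> ereal (L2_inner \<mu> \<Xi> w) \<le> D w"
      by (auto simp: clarke_subdifferential_def L2_iff_sqint D_def)
    show "\<Xi> \<in> L2_closure \<mu> (fun_convex_hull S)"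
    proof (rule ccontr)
      assume "\<not> ?thesis"
      then obtain e where e: "0 < e" and far: "\<And>g. g \<in> fun_convex_hull S \<Longrightarrow> e \<le> nrm \<mu> (\<lambda>x. \<Xi> x - g x)"
        using \<Xi> K_sq(1) by (fastforce simp: L2_closure_def L2_iff_sqint L2_norm_eq_nrm not_less)
      obtain \<gamma>\<^sub>0 where \<gamma>\<^sub>0: "\<gamma>\<^sub>0 \<in> optimal_plans \<mu> \<sigma>"
        using optimal_plans_nonempty[OF \<mu> \<sigma>] .
      have "\<Phi> \<gamma>\<^sub>0 \<in> fun_convex_hull S"
        using \<gamma>\<^sub>0 by (intro fun_convex_hull_superset) (auto simp: S_def)
      then have ne: "fun_convex_hull S \<noteq> {}" by blast
      define b where "b = 2 * nrm \<mu> (\<lambda>x. x) + 2 * nrm \<sigma> (\<lambda>x. x)"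
      obtain v where v: "sqint \<mu> v" and sep: "\<And>g. g \<in> fun_convex_hull S \<Longrightarrow> e\<^sup>2 / 2 \<le> L2_inner \<mu> \<Xi> v - L2_inner \<mu> g v"
        using sqint_convex_separation[OF \<Xi> e ne K_sq fun_convex_hull_convex far] by blast
      \<comment> \<open>c bounds the norm of \<Xi> - \<Phi> \<gamma> for every optimal \<gamma>, so
        exchanging v for a map w within e^2 / (4 c) spends e^2 / 4 of the gap e^2 / 2.\<close>
      define c where "c = nrm \<mu> \<Xi> + b + 1"
      have c: "0 < c"
        unfolding c_def b_def using nrm_nonneg[of \<mu> \<Xi>] nrm_nonneg[of \<mu> "\<lambda>x. x"] nrm_nonneg[of \<sigma> "\<lambda>x. x"] by linarith
      obtain w where w: "continuous_on UNIV w" "bounded (range w)" "sqint \<mu> w"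
        and vw: "nrm \<mu> (\<lambda>x. v x - w x) < e\<^sup>2 / (4 * c)"
        using sqint_continuous_approx[OF prob_space.finite_measure[OF M(1)] M(2) v, of "e\<^sup>2 / (4 * c)"] e c by auto
      have wC: "w \<in> C1_maps" by (rule bounded_continuous_C1_maps[OF w(1,2)])
      have "2 * displacement_inner \<gamma> w \<le> L2_inner \<mu> \<Xi> w - e\<^sup>2 / 4"
        if \<gamma>: "\<gamma> \<in> optimal_plans \<mu> \<sigma>" for \<gamma>
      proof -
        have "\<Phi> \<gamma> \<in> fun_convex_hull S"
          using \<gamma> by (intro fun_convex_hull_superset) (auto simp: S_def)
        note sep' = sep[OF this]
        note sq = sqint_diff[OF \<Xi> \<Phi>(1)[OF \<gamma>]]
        have nb: "nrm \<mu> (\<lambda>x. \<Xi> x - \<Phi> \<gamma> x) \<le> c"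
          using nrm_triangle[OF \<Xi> sqint_scaleR[OF \<Phi>(1)[OF \<gamma>], of "-1"]] nrm_scaleR[of \<mu> "-1" "\<Phi> \<gamma>"]
            \<Phi>(2)[OF \<gamma>] by (simp add: c_def b_def)
        have "L2_inner \<mu> (\<lambda>x. \<Xi> x - \<Phi> \<gamma> x) (\<lambda>x. v x - w x) \<le> nrm \<mu> (\<lambda>x. \<Xi> x - \<Phi> \<gamma> x) * nrm \<mu> (\<lambda>x. v x - w x)"
          using abs_L2_inner_le[OF sq sqint_diff[OF v w(3)]] by linarith
        also have "\<dots> \<le> c * (e\<^sup>2 / (4 * c))"
          using nb vw c by (intro mult_mono) (auto simp: nrm_nonneg)
        also have "\<dots> = e\<^sup>2 / 4" using c by simp
        also have "L2_inner \<mu> (\<lambda>x. \<Xi> x - \<Phi> \<gamma> x) (\<lambda>x. v x - w x) =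
            L2_inner \<mu> (\<lambda>x. \<Xi> x - \<Phi> \<gamma> x) v - L2_inner \<mu> (\<lambda>x. \<Xi> x - \<Phi> \<gamma> x) w"
          using L2_inner_diff[OF v w(3) sq] by (simp add: L2_inner_def inner_commute)
        finally have "e\<^sup>2 / 4 \<le> L2_inner \<mu> \<Xi> w - L2_inner \<mu> (\<Phi> \<gamma>) w"
          using sep' by (simp add: L2_inner_diff[OF \<Xi> \<Phi>(1)[OF \<gamma>] v] L2_inner_diff[OF \<Xi> \<Phi>(1)[OF \<gamma>] w(3)])
        then show ?thesis using \<Phi>(3)[OF \<gamma> w(3)] by linarith
      qed
      \<comment> \<open>The remaining gap e^2 / 4 is the same for all optimal \<gamma>, so it passes
        to the Clarke derivative and puts it strictly below the pairing of \<Xi> with w.\<close>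
      from clarke_derivative_le[OF \<mu> \<sigma> wC this]
      have "D w \<le> ereal (L2_inner \<mu> \<Xi> w - e\<^sup>2 / 4)" by (simp add: D_def)
      with sub[OF wC] have "ereal (L2_inner \<mu> \<Xi> w) \<le> ereal (L2_inner \<mu> \<Xi> w - e\<^sup>2 / 4)"
        by (rule order.trans)
      with e show False by simp
    qed
  qed
  then show ?thesis unfolding S_eq .
qed

end
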